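(* Let $d\ge2$ and $\tau_0,\tau_1,\ldots,\tau_d>0$. Let $e_0,\ldots,e_d$ be the standard orthonormal basis of $\mathbb R^{d+1}$ and consider the simplex $$S=\Bigl[u,\frac{e_1}{\tau_1},\ldots,\frac{e_d}{\tau_d}\Bigr],\qquad u:=\frac{\tau_0e_0+\cdots+\tau_de_d}{\tau_0^2+\cdots+\tau_d^2}.$$ Let $k\in\{0,\ldots,d-1\}$. (i) The internal and external angles of $S$ at its $k$-dimensional face $F=[u,\frac{e_1}{\tau_1},\ldots,\frac{e_k}{\tau_k}]$ are $$\beta(F,S)=\mathbf g_{d-k}(\tau_0^2;\ \tau_{k+1}^2,\ldots,\tau_d^2;\ 1,\ldots,1),$$ $$\gamma(F,S)=\mathbf g_{d-k}(-\tau_0^2-\tau_{k+1}^2-\cdots-\tau_d^2;\ \tau_{k+1}^2,\ldots,\tau_d^2;\ 1,\ldots,1),$$ where, for integers $\ell\ge0$, $\lambda_1,\ldots,\lambda_\ell>0$ and $\lambda_0\in\mathbb R$ with either $\lambda_0>0$ or $\lambda_0<-\lambda_1-\cdots-\lambda_\ell$, $$\mathbf g_\ell(\lambda_0;\lambda_1,\ldots,\lambda_\ell;1,\ldots,1)=\frac1{\sqrt{2\pi}}\int_{-\infty}^\infty\prod_{j=1}^\ell\Phi\Bigl(\sqrt{\tfrac{\lambda_j}{\lambda_0}}\,x\Bigr)e^{-x^2/2}\,dx$$ (for $\lambda_0<0$ with the convention $\sqrt{\lambda_0}=i\sqrt{-\lambda_0}$, i.e. $\sqrt{\lambda_j/\lambda_0}:=\sqrt{\lambda_j}/(i\sqrt{-\lambda_0})$).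 (ii) The internal and external angles of $S$ at its $k$-dimensional face $F=[\frac{e_1}{\tau_1},\ldots,\frac{e_{k+1}}{\tau_{k+1}}]$ are $$\beta(F,S)=\mathbf g_{d-k}(\tau_0^2;\ -\tau_0^2-\cdots-\tau_d^2,\tau_{k+2}^2,\ldots,\tau_d^2;\ -1,1,\ldots,1),$$ $$\gamma(F,S)=\mathbf g_{d-k}(\tau_1^2+\cdots+\tau_{k+1}^2;\ -\tau_0^2-\cdots-\tau_d^2,\tau_{k+2}^2,\ldots,\tau_d^2;\ 1,\ldots,1),$$ where, for $\ell\in\mathbb N$, $\lambda_0>0$, $\lambda_2>0,\ldots,\lambda_\ell>0$, $\lambda_1<-(\lambda_0+\lambda_2+\cdots+\lambda_\ell)$ and $\varepsilon_1\in\{\pm1\}$, $$\mathbf g_\ell(\lambda_0;\lambda_1,\ldots,\lambda_\ell;\varepsilon_1,1,\ldots,1)=\sqrt{\frac{\lambda_0}{2\pi}}\Biggl(\int_0^\infty e^{-\frac{\lambda_0y^2}2}\prod_{j=2}^\ell\Phi\bigl(\varepsilon_1\sqrt{\lambda_j}\,y\bigr)dy+2\int_0^\infty e^{\frac{\lambda_0y^2}2}\Phi\bigl(-\sqrt{-\lambda_1}\,y\bigr)\operatorname{Im}\Bigl(\prod_{j=2}^\ell\Phi\bigl(i\varepsilon_1\sqrt{\lambda_j}\,y\bigr)\Bigr)dy\Biggr).$$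
   Context: $[\ldots]$ denotes the convex hull, $i=\sqrt{-1}$ in arguments of $\Phi$, and $\Phi:\mathbb C\to\mathbb C$, $\Phi(z)=\frac12+\frac1{\sqrt{2\pi}}\int_0^ze^{-x^2/2}\,dx$ (along any contour from $0$ to $z$). Empty products equal $1$. Angles: the solid angle of a polyhedral cone $C$ is $\alpha(C)=\mathbb P[\xi\in C]$ with $\xi$ a standard Gaussian vector on the linear hull of $C$. For a face $F$ of a polytope $P\subseteq\mathbb R^N$ and $x_0$ in the relative interior of $F$, the tangent cone is $T(F,P)=\{v\in\mathbb R^N: x_0+\varepsilon v\in P\text{ for some }\varepsilon>0\}$ and the normal cone is its polar $N(F,P)=\{v\in\mathbb R^N:\langle v,z-x_0\rangle\le0\text{ for all }z\in P\}$; $\beta(F,P):=\alpha(T(F,P))$ and $\gamma(F,P):=\alpha(N(F,P))$ are the internal and external angles. Function $\mathbf g_\ell$: for $\ell\in\mathbb N$, nonzero real $\lambda_0,\ldots,\lambda_\ell$ such that either (A) all are positive, or (B) exactly one is negative, all others are positive and $\lambda_0+\cdots+\lambda_\ell<0$, and for $\varepsilon_1,\ldots,\varepsilon_\ell\in\{\pm1\}$, $\mathbf g_\ell(\lambda_0;\lambda_1,\ldots,\lambda_\ell;\varepsilon_1,\ldots,\varepsilon_\ell):=\mathbb P[\varepsilon_1\eta_1\le0,\ldots,\varepsilon_\ell\eta_\ell\le0]$, where $(\eta_1,\ldots,\eta_\ell)$ is centered Gaussian with covariance matrix $\bigl(\frac1{\lambda_0}+\frac{\delta_{ij}}{\lambda_i}\bigr)_{i,j=1}^\ell$.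 Also $\mathbf g_0(\lambda_0):=1$ for all $\lambda_0\in\mathbb R$. *)

theory Defs
  imports "HOL-Probability.Probability" "HOL-Complex_Analysis.Complex_Analysis"
begin

text \<open>The integrand is entire, so the straight segment may replace any contour from 0 to z.\<close>

definition Phi :: "complex \<Rightarrow> complex" where
  "Phi z = 1 / 2 + complex_of_real (1 / sqrt (2 * pi)) *
     contour_integral (linepath 0 z) (\<lambda>x. exp (- (x\<^sup>2) / 2))"

text \<open>The quotient \<open>sqrt (a / b)\<close> for \<open>a > 0\<close> and \<open>b \<noteq> 0\<close>, with the convention
  \<open>sqrt b = i sqrt (- b)\<close> for negative \<open>b\<close>.\<close>

definition sqrt_quot :: "real \<Rightarrow> real \<Rightarrow> complex" where
  "sqrt_quot a b =
     (if b > 0 then complex_of_real (sqrt (a / b))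
      else complex_of_real (sqrt a) / (\<i> * complex_of_real (sqrt (- b))))"


definition orthonormal_basis_of :: "'a::euclidean_space set \<Rightarrow> 'a set \<Rightarrow> bool" where
  "orthonormal_basis_of L B \<longleftrightarrow>
     pairwise orthogonal B \<and> (\<forall>b\<in>B. norm b = 1) \<and> span B = L"

text \<open>A standard Gaussian vector on a linear subspace has independent standard normal coordinates
  with respect to an orthonormal basis.  The law does not depend on the basis chosen, by rotation
  invariance.\<close>

definition std_gaussian_on :: "'a::euclidean_space set \<Rightarrow> 'a measure" where
  "std_gaussian_on L =
     (let B = (SOME B. orthonormal_basis_of L B)
      in distr (PiM B (\<lambda>_. density lborel std_normal_density)) borel
           (\<lambda>x. \<Sum>b\<in>B. x b *\<^sub>R b))"

definition solid_angle :: "'a::euclidean_space set \<Rightarrow> real" where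
  "solid_angle C = measure (std_gaussian_on (span C)) C"

definition tangent_cone_at :: "'a::euclidean_space \<Rightarrow> 'a set \<Rightarrow> 'a set" where
  "tangent_cone_at x0 P = {v. \<exists>\<epsilon>>0. x0 + \<epsilon> *\<^sub>R v \<in> P}"

definition normal_cone_at :: "'a::euclidean_space \<Rightarrow> 'a set \<Rightarrow> 'a set" where
  "normal_cone_at x0 P = {v. \<forall>z\<in>P. v \<bullet> (z - x0) \<le> 0}"

text \<open>For a nonempty face \<open>F\<close> of a polytope \<open>P\<close> the two cones are the same for every relative
  interior point of \<open>F\<close>.\<close>

definition tangent_cone :: "'a::euclidean_space set \<Rightarrow> 'a set \<Rightarrow> 'a set" where
  "tangent_cone F P = tangent_cone_at (SOME x0. x0 \<in> rel_interior F) P"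

definition normal_cone :: "'a::euclidean_space set \<Rightarrow> 'a set \<Rightarrow> 'a set" where
  "normal_cone F P = normal_cone_at (SOME x0. x0 \<in> rel_interior F) P"

definition internal_angle :: "'a::euclidean_space set \<Rightarrow> 'a set \<Rightarrow> real" where
  "internal_angle F P = solid_angle (tangent_cone F P)"

definition external_angle :: "'a::euclidean_space set \<Rightarrow> 'a set \<Rightarrow> real" where
  "external_angle F P = solid_angle (normal_cone F P)"


text \<open>Laws of random vectors \<open>(\<eta> 1, \<dots>, \<eta> l)\<close> are measures on the product space
  \<open>PiM {1..l} (\<lambda>_. borel)\<close>.  The centered Gaussian law with covariance matrix \<open>V\<close> is given by its
  characteristic function, which determines it; it exists whenever \<open>V\<close> is symmetric and positive
  semidefinite.\<close>

definition is_centered_gaussian ::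
    "nat \<Rightarrow> (nat \<Rightarrow> nat \<Rightarrow> real) \<Rightarrow> (nat \<Rightarrow> real) measure \<Rightarrow> bool" where
  "is_centered_gaussian l V M \<longleftrightarrow>
     prob_space M \<and> sets M = sets (PiM {1..l} (\<lambda>_. borel)) \<and>
     (\<forall>t :: nat \<Rightarrow> real.
        (\<integral>x. iexp (\<Sum>i\<in>{1..l}. t i * x i) \<partial>M) =
        complex_of_real (exp (- (\<Sum>i\<in>{1..l}. \<Sum>j\<in>{1..l}. V i j * t i * t j) / 2)))"

definition centered_gaussian :: "nat \<Rightarrow> (nat \<Rightarrow> nat \<Rightarrow> real) \<Rightarrow> (nat \<Rightarrow> real) measure" where
  "centered_gaussian l V = (THE M. is_centered_gaussian l V M)"

text \<open>\<open>gfun l \<lambda>0 \<lambda> \<epsilon>\<close> is the orthant probability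
  \<open>g\<^sub>l(\<lambda>0; \<lambda> 1, \<dots>, \<lambda> l; \<epsilon> 1, \<dots>, \<epsilon> l)\<close>; values of \<open>\<lambda>\<close> and \<open>\<epsilon>\<close> outside \<open>{1..l}\<close> are ignored.
  For \<open>l > 0\<close> it is meaningful only if the \<open>\<epsilon> i\<close> are \<open>1\<close> or \<open>- 1\<close> and the parameters
  \<open>\<lambda>0, \<lambda> 1, \<dots>, \<lambda> l\<close> are either all positive, or nonzero with exactly one negative and a negative
  sum; the covariance matrix is then positive definite.\<close>

definition gfun :: "nat \<Rightarrow> real \<Rightarrow> (nat \<Rightarrow> real) \<Rightarrow> (nat \<Rightarrow> real) \<Rightarrow> real" where
  "gfun l lam0 lam eps =
     (if l = 0 then 1
      else let M = centered_gaussian l (\<lambda>i j. 1 / lam0 + (if i = j then 1 / lam i else 0))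
           in measure M {x \<in> space M. \<forall>i\<in>{1..l}. eps i * x i \<le> 0})"

end

theory Submission
  imports Defs
begin

text \<open>
  Angles: the vertices of \<open>S\<close> form a basis of the ambient space, and the dual basis gives facet
  functionals.  Hence the tangent cone at a face is \<open>{v \<in> L. v \<bullet> m j \<le> 0}\<close>, up to signs, with \<open>L\<close> the
  direction space of \<open>S\<close> and \<open>m j\<close> facet normals; the normal cone has the same form with \<open>L\<close> the
  orthogonal complement of the direction space of the face and \<open>m j\<close> the projections of the
  remaining vertices.  In each case the Gram matrix of the \<open>m j\<close> is \<open>1 / \<lambda>\<^sub>0 + \<delta>\<^sub>i\<^sub>j / \<lambda>\<^sub>i\<close>, so the
  solid angle is the orthant probability, a Gaussian law being determined by its characteristic
  function.

  Formula (i): with \<open>\<kappa> = 1 / sqrt \<lambda>\<^sub>0\<close>, possibly imaginary, the Gaussian density with this covariance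
  is \<open>\<integral> \<phi>(\<xi>) \<Prod>\<^sub>i n\<^sub>i(y\<^sub>i - \<kappa> \<xi>) d\<xi>\<close>, where \<open>\<phi>\<close> is the standard normal density and \<open>n\<^sub>i\<close> the
  entire extension of the density of variance \<open>1 / \<lambda>\<^sub>i\<close>.  Integrating over the orthant first turns each
  factor into a value of \<open>Phi\<close>.

  Formula (ii): conditioning on the first coordinate and applying the formula for negative \<open>\<lambda>\<^sub>0\<close> to
  the remaining ones gives the integral of \<open>exp (- a s\<^sup>2 / 2 - m t\<^sup>2 / 2) * H (s + \<i> t)\<close> over the
  half-plane \<open>s \<ge> 0\<close>, with \<open>H\<close> entire.  For fixed \<open>t\<close> the half-line \<open>\<i> t + [0, \<infinity>)\<close> is moved by
  Cauchy's theorem to the segment from \<open>\<i> t\<close> to \<open>0\<close> followed by \<open>[0, \<infinity>)\<close>; the integral over \<open>t\<close>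
  is then elementary on each of the two pieces.
\<close>

text \<open>The mixture has to converge absolutely before integrations are exchanged. For imaginary
  \<kappa> the norms of the complex densities grow with \<xi>: together they contribute
  \<open>exp (Lam * \<xi>\<^sup>2 / (2 * \<bar>lam0\<bar>))\<close>, where \<open>Lam\<close> is the
  sum of the \<open>lam i\<close>. The condition \<open>lam0 < - Lam\<close> is what keeps this
  below the decay of the normal density. The mixture cannot be used directly when
  \<open>lam 1 < 0\<close>, because a factor of negative variance is a growing exponential.
  Conditioning on the first coordinate removes that factor: with \<open>m = - lam 1 - lam0\<close>
  the residuals of the other coordinates again form a mixture, now with leading parameter
  \<open>- m\<close>, and the hypothesis on \<open>lam 1\<close> says exactly that \<open>m\<close>
  exceeds the sum of the remaining \<open>lam j\<close>. The sign condition on the first coordinate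
  confines the contour to a half-line, so that moving it to the real axis leaves a vertical segment.
  The segments for \<open>t\<close> and \<open>- t\<close> contribute complex conjugates, which is
  the origin of the imaginary part in formula (ii); integrating over all \<open>t\<close> beyond a
  height \<open>y\<close> produces the factor \<open>Phi (- sqrt (- lam 1) * y)\<close>.\<close>

section \<open>Uniqueness of laws with a given characteristic function\<close>

text \<open>The bounds make \<open>h\<close> a density of positive finite mass; the lemma is applied to \<open>2 + Re g\<close> and
  \<open>2 + Im g\<close> for complex \<open>g\<close> with \<open>norm (g x) \<le> 1\<close>.\<close>

lemma weighted_distribution_unique:
  fixes h :: "'a \<Rightarrow> real"
  assumes "prob_space M1" "prob_space M2" and sets: "sets M1 = sets N" "sets M2 = sets N"
    and X [measurable]: "X \<in> borel_measurable N" and h [measurable]: "h \<in> borel_measurable N"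
    and h1: "\<And>x. 1 \<le> h x" and h3: "\<And>x. h x \<le> 3"
    and eq: "\<And>s::real. (\<integral>x. complex_of_real (h x) * iexp (s * X x) \<partial>M1) =
                  (\<integral>x. complex_of_real (h x) * iexp (s * X x) \<partial>M2)"
    and B [measurable]: "B \<in> sets borel"
  shows "(\<integral>x. h x * indicator B (X x) \<partial>M1) = (\<integral>x. h x * indicator B (X x) \<partial>M2)"
proof -
  define c where "c = (\<integral>x. h x \<partial>M1)"
  have int: "integrable M h" if "prob_space M" "sets M = sets N" for M
  proof -
    interpret prob_space M by fact
    have [measurable]: "h \<in> borel_measurable M" using h that by (simp cong: measurable_cong_sets)
    show ?thesis
    proof (rule integrable_const_bound[where B=3])
      show "AE x in M. norm (h x) \<le> 3"
      proof (rule AE_I2)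
        fix x show "norm (h x) \<le> 3" using h1[of x] h3[of x] by simp
      qed
    qed simp
  qed
  \<comment> \<open>At \<open>s = 0\<close> the hypothesis compares total masses, so one constant
    \<open>c\<close> normalises both measures.\<close>
  have cc: "c = (\<integral>x. h x \<partial>M2)"
    using eq[of 0] unfolding c_def by simp
  have c1: "c \<ge> 1"
  proof -
    interpret prob_space M1 by fact
    have "(\<integral>x. 1 \<partial>M1) \<le> c" unfolding c_def
      by (intro integral_mono int assms h1) auto
    then show ?thesis by (simp add: prob_space)
  qed
  \<comment> \<open>The law of \<open>X\<close> under the probability measure with density
    \<open>h / c\<close>. Its characteristic function is the integral in the hypothesis divided by
    \<open>c\<close>, so one-dimensional Levy uniqueness applies.\<close>
  define \<nu> where "\<nu> M = distr (density M (\<lambda>x. ennreal (h x / c))) borel X" for M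
  have main: "real_distribution (\<nu> M) \<and> (\<forall>s. char (\<nu> M) s = (\<integral>x. complex_of_real (h x) * iexp (s * X x) \<partial>M) / c)
      \<and> measure (\<nu> M) B = (\<integral>x. h x * indicator B (X x) \<partial>M) / c"
    if M: "prob_space M" "sets M = sets N" and cM: "c = (\<integral>x. h x \<partial>M)" for M
  proof -
    interpret prob_space M by fact
    have [measurable]: "h \<in> borel_measurable M" "X \<in> borel_measurable M"
      using X h that by (simp_all cong: measurable_cong_sets)
    have hc: "0 \<le> h x / c" for x using h1[of x] c1 by simp
    have 1: "prob_space (density M (\<lambda>x. ennreal (h x / c)))"
    proof (rule prob_spaceI)
      have "emeasure (density M (\<lambda>x. ennreal (h x / c))) (space M) = (\<integral>\<^sup>+x. ennreal (h x / c) \<partial>M)"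
        by (subst emeasure_density) (auto intro!: nn_integral_cong)
      also have "\<dots> = ennreal (\<integral>x. h x / c \<partial>M)"
        by (rule nn_integral_eq_integral) (use int M hc in auto)
      also have "(\<integral>x. h x / c \<partial>M) = 1" using cM c1 by simp
      finally show "emeasure (density M (\<lambda>x. ennreal (h x / c))) (space (density M (\<lambda>x. ennreal (h x / c)))) = 1" by simp
    qed
    have 2: "real_distribution (\<nu> M)"
      unfolding \<nu>_def real_distribution_def real_distribution_axioms_def
      by (auto intro!: prob_space.prob_space_distr 1)
    have 3: "char (\<nu> M) s = (\<integral>x. complex_of_real (h x) * iexp (s * X x) \<partial>M) / c" for s
    proof -
      have "char (\<nu> M) s = (\<integral>x. iexp (s * X x) \<partial>density M (\<lambda>x. ennreal (h x / c)))"
        unfolding char_def \<nu>_def by (subst integral_distr) auto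
      also have "\<dots> = (\<integral>x. (h x / c) *\<^sub>R iexp (s * X x) \<partial>M)"
        by (subst integral_density) (use hc in auto)
      also have "\<dots> = (\<integral>x. complex_of_real (h x) * iexp (s * X x) / c \<partial>M)"
        by (intro Bochner_Integration.integral_cong) (auto simp: scaleR_conv_of_real)
      finally show ?thesis by simp
    qed
    have "measure (\<nu> M) B = measure (density M (\<lambda>x. ennreal (h x / c))) (X -` B \<inter> space M)"
      unfolding \<nu>_def by (subst measure_distr) auto
    also have "\<dots> = (\<integral>x. indicator (X -` B \<inter> space M) x \<partial>density M (\<lambda>x. ennreal (h x / c)))"
      by simp
    also have "\<dots> = (\<integral>x. (h x / c) *\<^sub>R indicator (X -` B \<inter> space M) x \<partial>M)"
      by (subst integral_density) (use hc in auto)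
    also have "\<dots> = (\<integral>x. h x * indicator B (X x) / c \<partial>M)"
      by (intro Bochner_Integration.integral_cong) (auto split: split_indicator)
    finally show ?thesis using 2 3 by simp
  qed
  have "\<nu> M1 = \<nu> M2"
    by (rule Levy_uniqueness) (use main[of M1] main[of M2] assms cc c_def eq in \<open>auto simp: fun_eq_iff\<close>)
  then have "(\<integral>x. h x * indicator B (X x) \<partial>M1) / c = (\<integral>x. h x * indicator B (X x) \<partial>M2) / c"
    using main[of M1] main[of M2] assms cc c_def by metis
  then show ?thesis using c1 by simp
qed

text \<open>The real and imaginary parts of \<open>g\<close> are linear combinations of
  \<open>g\<close> and \<open>cnj g\<close>, and the hypothesis for \<open>cnj g\<close> is the
  conjugate of the one for \<open>g\<close> at \<open>- s\<close>. Adding 2 turns such a part into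
  an admissible weight; the contribution of the constant 2 is subtracted again by means of
  \<open>eq0\<close>.\<close>

lemma complex_weighted_distribution_unique:
  fixes g :: "'a \<Rightarrow> complex"
  assumes M1: "prob_space M1" and M2: "prob_space M2" and sets: "sets M1 = sets N" "sets M2 = sets N"
    and X [measurable]: "X \<in> borel_measurable N" and g [measurable]: "g \<in> borel_measurable N"
    and g1: "\<And>x. norm (g x) \<le> 1"
    and eq0: "\<And>s::real. (\<integral>x. iexp (s * X x) \<partial>M1) = (\<integral>x. iexp (s * X x) \<partial>M2)"
    and eq: "\<And>s::real. (\<integral>x. g x * iexp (s * X x) \<partial>M1) = (\<integral>x. g x * iexp (s * X x) \<partial>M2)"
    and B [measurable]: "B \<in> sets borel"
  shows "(\<integral>x. g x * indicator B (X x) \<partial>M1) = (\<integral>x. g x * indicator B (X x) \<partial>M2)"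
proof -
  have meas: "f \<in> borel_measurable M" if "f \<in> borel_measurable N" "sets M = sets N"
    for M and f :: "'a \<Rightarrow> 'b::{topological_space}"
    using that by (simp cong: measurable_cong_sets)
  have int: "integrable M f" if "prob_space M" "sets M = sets N" "f \<in> borel_measurable N"
     "\<And>x. norm (f x) \<le> K" for M and f :: "'a \<Rightarrow> 'b::{banach,second_countable_topology}" and K
  proof -
    interpret prob_space M by fact
    show ?thesis
      by (rule integrable_const_bound[where B=K]) (use that meas in \<open>auto\<close>)
  qed
  have eqc: "(\<integral>x. cnj (g x) * iexp (s * X x) \<partial>M1) = (\<integral>x. cnj (g x) * iexp (s * X x) \<partial>M2)" for s
  proof -
    have "(\<integral>x. cnj (g x) * iexp (s * X x) \<partial>M) = cnj (\<integral>x. g x * iexp (- s * X x) \<partial>M)" for M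
      by (subst Bochner_Integration.integral_cnj[symmetric], rule Bochner_Integration.integral_cong) (simp_all add: exp_cnj)
    then show ?thesis using eq[of "-s"] by simp
  qed
  have gc [measurable]: "(\<lambda>x. cnj (g x)) \<in> borel_measurable N"
    using measurable_compose[OF g borel_measurable_continuous_onI[of cnj]] by (simp add: continuous_intros)
  have nrm: "norm (g x * iexp (s * X x)) \<le> 1" "norm (cnj (g x) * iexp (s * X x)) \<le> 1"
    "norm (iexp (s * X x)) \<le> 1" for s x
    using g1[of x] by (simp_all add: norm_mult)
  have step: "(\<integral>x. f x * indicator B (X x) \<partial>M1) = (\<integral>x. f x * indicator B (X x) \<partial>M2)"
    if f: "\<And>x. complex_of_real (f x) = a * g x + b * cnj (g x)" and f1: "\<And>x. \<bar>f x\<bar> \<le> 1" for f :: "'a \<Rightarrow> real" and a b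
  proof -
    have fe: "f = (\<lambda>x. Re (a * g x + b * cnj (g x)))" using f by (metis Re_complex_of_real)
    have [measurable]: "f \<in> borel_measurable N" unfolding fe by measurable
    have e: "(\<integral>x. complex_of_real (2 + f x) * iexp (s * X x) \<partial>M) =
       2 * (\<integral>x. iexp (s * X x) \<partial>M) + a * (\<integral>x. g x * iexp (s * X x) \<partial>M) + b * (\<integral>x. cnj (g x) * iexp (s * X x) \<partial>M)"
       if "prob_space M" "sets M = sets N" for M s
    proof -
      have i: "integrable M (\<lambda>x. iexp (s * X x))" "integrable M (\<lambda>x. g x * iexp (s * X x))"
        "integrable M (\<lambda>x. cnj (g x) * iexp (s * X x))"
        by (rule int[OF that _ nrm(3)] int[OF that _ nrm(1)] int[OF that _ nrm(2)]; measurable)+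
      have "(\<integral>x. complex_of_real (2 + f x) * iexp (s * X x) \<partial>M) =
        (\<integral>x. (2 * iexp (s * X x) + a * (g x * iexp (s * X x))) + b * (cnj (g x) * iexp (s * X x)) \<partial>M)"
        by (intro Bochner_Integration.integral_cong) (auto simp: f algebra_simps)
      also have "\<dots> = 2 * (\<integral>x. iexp (s * X x) \<partial>M) + a * (\<integral>x. g x * iexp (s * X x) \<partial>M) + b * (\<integral>x. cnj (g x) * iexp (s * X x) \<partial>M)"
        using i by simp
      finally show ?thesis .
    qed
    have bd: "1 \<le> 2 + f x" "2 + f x \<le> 3" for x using f1[of x] by auto
    have 1: "(\<integral>x. (2 + f x) * indicator B (X x) \<partial>M1) = (\<integral>x. (2 + f x) * indicator B (X x) \<partial>M2)"
      by (rule weighted_distribution_unique[where N=N]) (use assms bd e eqc in auto)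
    have 2: "(\<integral>x. 2 * indicator B (X x) \<partial>M1) = (\<integral>x. 2 * indicat_real B (X x) \<partial>M2)"
      by (rule weighted_distribution_unique[where N=N]) (use assms eq0 in auto)
    have 3: "(\<integral>x. (2 + f x) * indicator B (X x) \<partial>M) = (\<integral>x. 2 * indicat_real B (X x) \<partial>M) + (\<integral>x. f x * indicator B (X x) \<partial>M)"
      if "prob_space M" "sets M = sets N" for M
    proof -
      have "norm (f x * indicator B (X x)) \<le> 1" "norm (2 * indicat_real B (X x)) \<le> 2" for x
        using f1[of x] by (auto split: split_indicator)
      then have "integrable M (\<lambda>x. f x * indicator B (X x))" "integrable M (\<lambda>x. 2 * indicat_real B (X x))"
        by (intro int[OF that]; measurable; fail | blast)+
      then show ?thesis by (subst Bochner_Integration.integral_add[symmetric]) (auto simp: algebra_simps)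
    qed
    show ?thesis using 1 2 3[of M1] 3[of M2] assms by simp
  qed
  have "\<bar>Re (g x)\<bar> \<le> 1" "\<bar>Im (g x)\<bar> \<le> 1" for x
    using order_trans[OF abs_Re_le_cmod g1] order_trans[OF abs_Im_le_cmod g1] by auto
  note b = this
  have re: "(\<integral>x. Re (g x) * indicator B (X x) \<partial>M1) = (\<integral>x. Re (g x) * indicator B (X x) \<partial>M2)"
    by (rule step[of _ "1/2" "1/2"]) (use b in \<open>auto simp: complex_eq_iff\<close>)
  have im: "(\<integral>x. Im (g x) * indicator B (X x) \<partial>M1) = (\<integral>x. Im (g x) * indicator B (X x) \<partial>M2)"
    by (rule step[of _ "1/(2*\<i>)" "-1/(2*\<i>)"]) (use b in \<open>auto simp: complex_eq_iff Re_divide Im_divide\<close>)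
  have "(\<integral>x. g x * indicator B (X x) \<partial>M) =
     Complex (\<integral>x. Re (g x) * indicator B (X x) \<partial>M) (\<integral>x. Im (g x) * indicator B (X x) \<partial>M)"
    if "prob_space M" "sets M = sets N" for M
  proof -
    have "norm (g x * indicator B (X x)) \<le> 1" for x using g1[of x] by (auto split: split_indicator)
    then have i: "integrable M (\<lambda>x. g x * indicator B (X x))" by (intro int[OF that]; measurable)
    show ?thesis
      by (auto simp: complex_eq_iff integral_Re[OF i, symmetric] integral_Im[OF i, symmetric]
         intro!: Bochner_Integration.integral_cong split: split_indicator)
  qed
  then show ?thesis using re im assms by simp
qed

text \<open>Once every coordinate carries an indicator, the identity says that the two measures
  agree on boxes, an intersection-stable generator of the product algebra.\<close>

lemma char_fun_PiM_unique:
  fixes M1 M2 :: "('i \<Rightarrow> real) measure"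
  assumes M1: "prob_space M1" and M2: "prob_space M2" and I: "finite I"
    and sets: "sets M1 = sets (PiM I (\<lambda>_. borel))" "sets M2 = sets (PiM I (\<lambda>_. borel))"
    and eq: "\<And>t. (\<integral>x. iexp (\<Sum>i\<in>I. t i * x i) \<partial>M1) = (\<integral>x. iexp (\<Sum>i\<in>I. t i * x i) \<partial>M2)"
  shows "M1 = M2"
proof -
  \<comment> \<open>the coordinates are moved one at a time from the exponential to an indicator\<close>
  have *: "(\<integral>x. (\<Prod>i\<in>J. indicator (A i) (x i)) * iexp (\<Sum>i\<in>I - J. t i * x i) \<partial>M1) =
        (\<integral>x. (\<Prod>i\<in>J. indicator (A i) (x i)) * iexp (\<Sum>i\<in>I - J. t i * x i) \<partial>M2)"
    if "finite J" "J \<subseteq> I" "\<And>i. A i \<in> sets borel" for J A t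
    using that
  proof (induction J arbitrary: t)
    case empty
    then show ?case using eq by simp
  next
    case (insert j J)
    have j: "j \<in> I" and J: "J \<subseteq> I" "j \<notin> J" using insert by auto
    have [measurable]: "A i \<in> sets borel" for i using insert by auto
    have meas [measurable]: "(\<lambda>x. x i) \<in> borel_measurable (PiM I (\<lambda>_. borel))" if "i \<in> I" for i
      using that by measurable
    \<comment> \<open>The weight of norm at most 1 with which the one-dimensional lemma is applied
      to coordinate \<open>j\<close>; the induction hypothesis at \<open>t(j := s)\<close> supplies
      its premise.\<close>
    define g where "g x = (\<Prod>i\<in>J. indicator (A i) (x i)) * iexp (\<Sum>i\<in>I - insert j J. t i * x i)" for x :: "'i \<Rightarrow> real"
    have gm [measurable]: "g \<in> borel_measurable (PiM I (\<lambda>_. borel))"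
    proof -
      have "(\<lambda>x. indicator (A i) (x i) :: complex) \<in> borel_measurable (PiM I (\<lambda>_. borel))" if "i \<in> J" for i
        using J that by (intro measurable_compose[OF meas, of i "indicator (A i)"]) auto
      moreover have "(\<lambda>x. t i * x i) \<in> borel_measurable (PiM I (\<lambda>_. borel))" if "i \<in> I - insert j J" for i
        using that by (intro borel_measurable_times meas) auto
      ultimately show ?thesis
        unfolding g_def
        by (intro borel_measurable_times borel_measurable_prod borel_measurable_exp[THEN measurable_compose[rotated]]
           borel_measurable_of_real borel_measurable_sum measurable_const)
           auto
    qed
    have g1: "norm (g x) \<le> 1" for x
      unfolding g_def by (auto simp: norm_mult prod_norm[symmetric] intro!: prod_le_1 split: split_indicator)
    have e0: "(\<integral>x. iexp (s * x j) \<partial>M1) = (\<integral>x. iexp (s * x j) \<partial>M2)" for s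
    proof -
      have "(\<Sum>i\<in>I. (if i = j then s else 0) * x i) = s * x j" for x :: "'i \<Rightarrow> real"
        using j I by (subst sum.remove[of _ j]) auto
      then show ?thesis using eq[of "\<lambda>i. if i = j then s else 0"] by simp
    qed
    have e1: "(\<integral>x. g x * iexp (s * x j) \<partial>M1) = (\<integral>x. g x * iexp (s * x j) \<partial>M2)" for s
    proof -
      have "(\<Sum>i\<in>I - J. (t(j:=s)) i * x i) = s * x j + (\<Sum>i\<in>I - insert j J. t i * x i)" for x :: "'i \<Rightarrow> real"
      proof -
        have "(\<Sum>i\<in>I - J. (t(j:=s)) i * x i) = s * x j + (\<Sum>i\<in>I - J - {j}. (t(j:=s)) i * x i)"
          using I j J by (subst sum.remove[of _ j]) auto
        also have "I - J - {j} = I - insert j J" by auto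
        finally show ?thesis by (auto intro!: sum.cong)
      qed
      then have "g x * iexp (s * x j) = (\<Prod>i\<in>J. indicator (A i) (x i)) * iexp (\<Sum>i\<in>I - J. (t(j:=s)) i * x i)" for x
        unfolding g_def by (simp add: exp_add ring_distribs)
      then show ?thesis using insert.IH[of "t(j:=s)"] insert.prems by simp
    qed
    have "(\<integral>x. g x * indicator (A j) (x j) \<partial>M1) = (\<integral>x. g x * indicator (A j) (x j) \<partial>M2)"
      by (rule complex_weighted_distribution_unique[OF M1 M2 sets _ _ _ e0 e1])
         (use g1 j in \<open>auto\<close>)
    then show ?case using insert.hyps unfolding g_def by (simp add: mult_ac)
  qed
  show ?thesis
  proof (rule measure_eqI_PiM_finite[OF I sets(1) sets(2)])
    fix A :: "'i \<Rightarrow> real set" assume A: "\<And>i. i \<in> I \<Longrightarrow> A i \<in> sets borel"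
    \<comment> \<open>The inner claim asks for Borel sets at every index, while \<open>A\<close> is
      known to be Borel on \<open>I\<close> only.\<close>
    define A' where "A' i = (if i \<in> I then A i else {})" for i
    have A': "A' i \<in> sets borel" for i using A by (auto simp: A'_def)
    have PE: "Pi\<^sub>E I A \<in> sets (PiM I (\<lambda>_. borel))" using A I by (intro sets_PiM_I_finite) auto
    have "(\<integral>x. (\<Prod>i\<in>I. indicator (A' i) (x i)) * iexp (\<Sum>i\<in>I - I. 0 * x i) \<partial>M) = complex_of_real (measure M (Pi\<^sub>E I A))"
      if "sets M = sets (PiM I (\<lambda>_. borel))" for M
    proof -
      have sp: "space M = Pi\<^sub>E I (\<lambda>_. UNIV)" using sets_eq_imp_space_eq[OF that] by (simp add: space_PiM)
      have "(\<integral>x. (\<Prod>i\<in>I. indicator (A' i) (x i)) * iexp (\<Sum>i\<in>I - I. 0 * x i) \<partial>M) = (\<integral>x. complex_of_real (indicator (Pi\<^sub>E I A) x) \<partial>M)"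
      proof (intro Bochner_Integration.integral_cong refl)
        fix x assume "x \<in> space M"
        then have "x \<in> Pi\<^sub>E I A \<longleftrightarrow> (\<forall>i\<in>I. x i \<in> A i)" by (auto simp: sp PiE_def Pi_def)
        then show "(\<Prod>i\<in>I. indicator (A' i) (x i)) * iexp (\<Sum>i\<in>I - I. 0 * x i) = complex_of_real (indicator (Pi\<^sub>E I A) x)"
          using I by (auto simp: A'_def indicator_def)
      qed
      also have "\<dots> = complex_of_real (measure M (Pi\<^sub>E I A))"
        using PE that sets.sets_into_space[of "Pi\<^sub>E I A" M] by (simp add: Int_absorb2)
      finally show ?thesis .
    qed
    then have "measure M1 (Pi\<^sub>E I A) = measure M2 (Pi\<^sub>E I A)"
      using *[of I A' "\<lambda>_. 0"] A' I sets by auto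
    then show "emeasure M1 (Pi\<^sub>E I A) = emeasure M2 (Pi\<^sub>E I A)"
      using M1 M2 by (simp add: finite_measure.emeasure_eq_measure prob_space_def)
  next
    show "range (\<lambda>_::nat. space (PiM I (\<lambda>_. borel :: real measure))) \<subseteq> prod_algebra I (\<lambda>_. borel)"
      using I by (auto simp: space_PiM intro!: prod_algebraI_finite)
    show "(\<Union>i::nat. space (PiM I (\<lambda>_. borel :: real measure))) = space (PiM I (\<lambda>_. borel))" by simp
    show "emeasure M1 (space (PiM I (\<lambda>_. borel))) \<noteq> \<infinity>"
      using M1 by (simp add: finite_measure.emeasure_eq_measure prob_space_def)
  qed
qed

lemma centered_gaussian_eq:
  assumes "is_centered_gaussian l V M"
  shows "centered_gaussian l V = M"
  unfolding centered_gaussian_def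
proof (rule the_equality)
  fix M' assume "is_centered_gaussian l V M'"
  with assms show "M' = M"
    by (intro char_fun_PiM_unique[of M' M "{1..l}"]) (auto simp: is_centered_gaussian_def)
qed fact

section \<open>Gaussian vectors on subspaces and solid angles of orthants\<close>

lemma orthonormal_basis_of_finite:
  assumes "orthonormal_basis_of L B"
  shows "finite B"
proof -
  have "pairwise orthogonal B" "0 \<notin> B" using assms by (auto simp: orthonormal_basis_of_def)
  then show ?thesis using pairwise_orthogonal_independent independent_imp_finite by blast
qed

lemma orthonormal_basis_of_inner_self:
  assumes "orthonormal_basis_of L B" "t \<in> L"
  shows "(\<Sum>b\<in>B. (t \<bullet> b)\<^sup>2) = t \<bullet> t"
proof -
  have "(\<Sum>b\<in>B. (t \<bullet> b) *\<^sub>R b) = t"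
    using assms orthonormal_basis_of_finite[OF assms(1)]
    by (intro orthonormal_basis_expand) (auto simp: orthonormal_basis_of_def)
  then have "t \<bullet> t = t \<bullet> (\<Sum>b\<in>B. (t \<bullet> b) *\<^sub>R b)" by simp
  then show ?thesis by (simp add: inner_sum_right power2_eq_square)
qed

lemma measurable_basis_combination:
  fixes B :: "'a::euclidean_space set"
  shows "(\<lambda>x. \<Sum>b\<in>B. x b *\<^sub>R b) \<in> borel_measurable (PiM B (\<lambda>_. std_normal_distribution))"
proof (intro borel_measurable_sum borel_measurable_scaleR)
  fix b assume "b \<in> B"
  then have "(\<lambda>x. x b) \<in> measurable (PiM B (\<lambda>_. std_normal_distribution)) std_normal_distribution"
    by (rule measurable_component_singleton)
  then show "(\<lambda>x. x b) \<in> borel_measurable (PiM B (\<lambda>_. std_normal_distribution))"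
    by (simp cong: measurable_cong_sets)
qed simp

context
  fixes L :: "'a::euclidean_space set"
  assumes L: "subspace L"
begin

lemma std_gaussian_on_obtain_basis:
  obtains B where "orthonormal_basis_of L B"
    "std_gaussian_on L = distr (PiM B (\<lambda>_. std_normal_distribution)) borel (\<lambda>x. \<Sum>b\<in>B. x b *\<^sub>R b)"
proof
  obtain B where "pairwise orthogonal B" "\<And>x. x \<in> B \<Longrightarrow> norm x = 1" "span B = L"
    using orthonormal_basis_subspace[OF L] by metis
  then have "\<exists>B. orthonormal_basis_of L B"
    unfolding orthonormal_basis_of_def by auto
  then show "orthonormal_basis_of L (SOME B. orthonormal_basis_of L B)"
    by (rule someI_ex)
qed (unfold std_gaussian_on_def Let_def, rule refl)

lemma sets_std_gaussian_on [measurable_cong]: "sets (std_gaussian_on L) = sets borel"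
  by (simp add: std_gaussian_on_def Let_def)

lemma prob_space_std_gaussian_on: "prob_space (std_gaussian_on L)"
proof -
  obtain B where D: "std_gaussian_on L = distr (PiM B (\<lambda>_. std_normal_distribution)) borel (\<lambda>x. \<Sum>b\<in>B. x b *\<^sub>R b)"
    by (rule std_gaussian_on_obtain_basis)
  have "prob_space (PiM B (\<lambda>_. std_normal_distribution))"
    by (intro prob_space_PiM prob_space_normal_density) simp
  then show ?thesis
    unfolding D by (rule prob_space.prob_space_distr) (rule measurable_basis_combination)
qed

text \<open>The Gaussian vector takes all its values in \<open>L\<close>, so a cone in
  \<open>L\<close> can be measured by its linear inequalities alone.\<close>

lemma measure_std_gaussian_on_Int:
  assumes A: "A \<in> sets borel"
  shows "measure (std_gaussian_on L) (L \<inter> A) = measure (std_gaussian_on L) A"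
proof -
  obtain B where B: "orthonormal_basis_of L B"
    and D: "std_gaussian_on L = distr (PiM B (\<lambda>_. std_normal_distribution)) borel (\<lambda>x. \<Sum>b\<in>B. x b *\<^sub>R b)"
    by (rule std_gaussian_on_obtain_basis)
  have span: "span B = L" using B by (simp add: orthonormal_basis_of_def)
  have mem: "(\<Sum>b\<in>B. x b *\<^sub>R b) \<in> L" for x
    unfolding span[symmetric] by (intro span_sum span_scale span_base)
  then have "(\<lambda>x. \<Sum>b\<in>B. x b *\<^sub>R b) -` (L \<inter> A) = (\<lambda>x. \<Sum>b\<in>B. x b *\<^sub>R b) -` A" by blast
  moreover have LA: "L \<inter> A \<in> sets borel" using A closed_subspace[OF L] by auto
  ultimately show ?thesis
    unfolding D measure_distr[OF measurable_basis_combination LA] measure_distr[OF measurable_basis_combination A]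
    by simp
qed

text \<open>For \<open>t\<close> in \<open>L\<close>, Parseval's identity turns the sum of squared
  coordinates into \<open>t \<bullet> t\<close>, and the basis chosen by \<open>SOME\<close>
  disappears from the result.\<close>

lemma char_std_gaussian_on:
  assumes "t \<in> L"
  shows "(\<integral>x. iexp (x \<bullet> t) \<partial>std_gaussian_on L) = complex_of_real (exp (- (t \<bullet> t) / 2))"
proof -
  obtain B where B: "orthonormal_basis_of L B"
    and D: "std_gaussian_on L = distr (PiM B (\<lambda>_. std_normal_distribution)) borel (\<lambda>x. \<Sum>b\<in>B. x b *\<^sub>R b)"
    by (rule std_gaussian_on_obtain_basis)
  note fin = orthonormal_basis_of_finite[OF B]
  interpret product_sigma_finite "\<lambda>_::'a. std_normal_distribution"
    unfolding product_sigma_finite_def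
    by (intro allI prob_space_imp_sigma_finite prob_space_normal_density) simp
  have i: "integrable std_normal_distribution (\<lambda>x. iexp (c * x))" for c :: real
  proof -
    interpret prob_space std_normal_distribution by (rule prob_space_normal_density) simp
    show ?thesis by (rule integrable_const_bound[where B=1]) auto
  qed
  have "(\<integral>x. iexp (x \<bullet> t) \<partial>std_gaussian_on L) = (\<integral>x. iexp ((\<Sum>b\<in>B. x b *\<^sub>R b) \<bullet> t) \<partial>PiM B (\<lambda>_. std_normal_distribution))"
    unfolding D by (subst integral_distr[OF measurable_basis_combination]) simp_all
  also have "\<dots> = (\<integral>x. (\<Prod>b\<in>B. iexp ((t \<bullet> b) * x b)) \<partial>PiM B (\<lambda>_. std_normal_distribution))"
  proof (intro Bochner_Integration.integral_cong refl)
    fix x :: "'a \<Rightarrow> real"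
    have "(\<Sum>b\<in>B. x b *\<^sub>R b) \<bullet> t = (\<Sum>b\<in>B. (t \<bullet> b) * x b)"
      by (simp add: inner_sum_left inner_commute[of t] mult.commute)
    then show "iexp ((\<Sum>b\<in>B. x b *\<^sub>R b) \<bullet> t) = (\<Prod>b\<in>B. iexp ((t \<bullet> b) * x b))"
      by (simp only: of_real_sum sum_distrib_left exp_sum[OF fin])
  qed
  also have "\<dots> = (\<Prod>b\<in>B. \<integral>x. iexp ((t \<bullet> b) * x) \<partial>std_normal_distribution)"
    by (intro product_integral_prod fin i)
  also have "\<dots> = (\<Prod>b\<in>B. complex_of_real (exp (- ((t \<bullet> b)\<^sup>2) / 2)))"
    using char_std_normal_distribution unfolding char_def fun_eq_iff by (intro prod.cong refl) auto
  also have "\<dots> = complex_of_real (exp (\<Sum>b\<in>B. - ((t \<bullet> b)\<^sup>2) / 2))"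
    by (simp add: exp_sum[OF fin])
  also have "(\<Sum>b\<in>B. - ((t \<bullet> b)\<^sup>2) / 2) = - (t \<bullet> t) / 2"
    using orthonormal_basis_of_inner_self[OF B assms] by (simp add: sum_negf flip: sum_divide_distrib)
  finally show ?thesis .
qed

lemma is_centered_gaussian_inner:
  assumes m: "\<And>j. j \<in> {1..l} \<Longrightarrow> m j \<in> L"
    and V: "\<And>i j. i \<in> {1..l} \<Longrightarrow> j \<in> {1..l} \<Longrightarrow> V i j = m i \<bullet> m j"
  shows "is_centered_gaussian l V (distr (std_gaussian_on L) (PiM {1..l} (\<lambda>_. borel)) (\<lambda>v. \<lambda>j\<in>{1..l}. v \<bullet> m j))"
proof -
  interpret prob_space "std_gaussian_on L" by (rule prob_space_std_gaussian_on)
  have meas [measurable]: "(\<lambda>v. \<lambda>j\<in>{1..l}. v \<bullet> m j) \<in> measurable (std_gaussian_on L) (PiM {1..l} (\<lambda>_. borel))"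
    by (intro measurable_restrict) auto
  have "(\<integral>x. iexp (\<Sum>i\<in>{1..l}. t i * x i) \<partial>distr (std_gaussian_on L) (PiM {1..l} (\<lambda>_. borel)) (\<lambda>v. \<lambda>j\<in>{1..l}. v \<bullet> m j)) =
     complex_of_real (exp (- (\<Sum>i\<in>{1..l}. \<Sum>j\<in>{1..l}. V i j * t i * t j) / 2))" for t :: "nat \<Rightarrow> real"
  proof -
    have "(\<integral>x. iexp (\<Sum>i\<in>{1..l}. t i * x i) \<partial>distr (std_gaussian_on L) (PiM {1..l} (\<lambda>_. borel)) (\<lambda>v. \<lambda>j\<in>{1..l}. v \<bullet> m j))
       = (\<integral>v. iexp (\<Sum>i\<in>{1..l}. t i * (v \<bullet> m i)) \<partial>std_gaussian_on L)"
      by (subst integral_distr[OF meas]) (auto intro!: Bochner_Integration.integral_cong)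
    also have "\<dots> = (\<integral>v. iexp (v \<bullet> (\<Sum>i\<in>{1..l}. t i *\<^sub>R m i)) \<partial>std_gaussian_on L)"
      by (simp add: inner_sum_right)
    also have "\<dots> = complex_of_real (exp (- ((\<Sum>i\<in>{1..l}. t i *\<^sub>R m i) \<bullet> (\<Sum>i\<in>{1..l}. t i *\<^sub>R m i)) / 2))"
      using L m by (intro char_std_gaussian_on subspace_sum subspace_scale)
    also have "(\<Sum>i\<in>{1..l}. t i *\<^sub>R m i) \<bullet> (\<Sum>i\<in>{1..l}. t i *\<^sub>R m i) = (\<Sum>i\<in>{1..l}. \<Sum>j\<in>{1..l}. V i j * t i * t j)"
      by (subst inner_sum_left, intro sum.cong refl, subst inner_sum_right, intro sum.cong refl) (simp add: V mult_ac)
    finally show ?thesis .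
  qed
  then show ?thesis
    unfolding is_centered_gaussian_def using prob_space_distr[OF meas] by auto
qed

text \<open>The solid angle refers to the Gaussian vector on the span of the cone, so besides
  identifying the law it must be shown that the cone spans \<open>L\<close>. It does, because some
  point of it satisfies every inequality strictly. Such a point comes from solving a linear system
  with the Gram matrix, whose determinant is \<open>(lam0 + (\<Sum>j=1..l. lam j)) / lam0\<close>
  divided by the product of the \<open>lam j\<close>.\<close>

lemma solid_angle_orthant:
  assumes l: "l > 0" and m: "\<And>j. j \<in> {1..l} \<Longrightarrow> m j \<in> L"
    and gram: "\<And>i j. i \<in> {1..l} \<Longrightarrow> j \<in> {1..l} \<Longrightarrow> m i \<bullet> m j = 1 / lam0 + (if i = j then 1 / lam i else 0)"
    and nz: "lam0 \<noteq> 0" "\<And>j. j \<in> {1..l} \<Longrightarrow> lam j \<noteq> 0" "lam0 + (\<Sum>j=1..l. lam j) \<noteq> 0"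
      "\<And>j. j \<in> {1..l} \<Longrightarrow> eps j \<noteq> 0"
  shows "solid_angle {v\<in>L. \<forall>j\<in>{1..l}. eps j * (v \<bullet> m j) \<le> 0} = gfun l lam0 lam eps"
proof -
  let ?C = "{v\<in>L. \<forall>j\<in>{1..l}. eps j * (v \<bullet> m j) \<le> 0}"
  let ?V = "\<lambda>i j. 1 / lam0 + (if i = j then 1 / lam i else 0)"
  let ?T = "lam0 + (\<Sum>j=1..l. lam j)"
  let ?P = "PiM {1..l} (\<lambda>_. borel) :: (nat \<Rightarrow> real) measure"
  interpret prob_space "std_gaussian_on L" by (rule prob_space_std_gaussian_on)
  have "centered_gaussian l ?V = distr (std_gaussian_on L) ?P (\<lambda>v. \<lambda>j\<in>{1..l}. v \<bullet> m j)"
    by (intro centered_gaussian_eq is_centered_gaussian_inner m) (simp_all add: gram)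
  moreover have "measure (distr (std_gaussian_on L) ?P (\<lambda>v. \<lambda>j\<in>{1..l}. v \<bullet> m j))
      {x \<in> space ?P. \<forall>i\<in>{1..l}. eps i * x i \<le> 0} = measure (std_gaussian_on L) {v. \<forall>j\<in>{1..l}. eps j * (v \<bullet> m j) \<le> 0}"
  proof -
    have f: "(\<lambda>v. \<lambda>j\<in>{1..l}. v \<bullet> m j) \<in> measurable (std_gaussian_on L) ?P"
      by (intro measurable_restrict) auto
    have A: "{x \<in> space ?P. \<forall>i\<in>{1..l}. eps i * x i \<le> 0} \<in> sets ?P"
      by measurable
    have sp: "space (std_gaussian_on L) = UNIV"
      using sets_eq_imp_space_eq[OF sets_std_gaussian_on] by simp
    have "(\<lambda>v. \<lambda>j\<in>{1..l}. v \<bullet> m j) -` {x \<in> space ?P. \<forall>i\<in>{1..l}. eps i * x i \<le> 0} \<inter> space (std_gaussian_on L)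
        = {v. \<forall>j\<in>{1..l}. eps j * (v \<bullet> m j) \<le> 0}"
      unfolding sp by (auto simp: space_PiM)
    then show ?thesis unfolding measure_distr[OF f A] by (rule arg_cong)
  qed
  moreover have "measure (std_gaussian_on L) {v. \<forall>j\<in>{1..l}. eps j * (v \<bullet> m j) \<le> 0} = measure (std_gaussian_on L) ?C"
  proof -
    have "{v::'a. \<forall>j\<in>{1..l}. eps j * (v \<bullet> m j) \<le> 0} \<in> sets borel" by measurable
    from measure_std_gaussian_on_Int[OF this] show ?thesis
      by (simp add: Int_def)
  qed
  moreover have "span ?C = L"
  proof (rule antisym)
    show "span ?C \<subseteq> L" by (rule span_minimal) (use L in auto)
    show "L \<subseteq> span ?C"
    proof
      fix v assume v: "v \<in> L"
      \<comment> \<open>\<open>a\<close> solves \<open>\<Sum>j. (m i \<bullet> m j) * a j = eps i\<close>, by the Sherman-Morrison formula\<close>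
      define s where "s = (\<Sum>j=1..l. lam j * eps j)"
      define a where "a j = lam j * eps j - lam j * s / ?T" for j
      \<comment> \<open>The strict point: \<open>p \<bullet> m i = - eps i\<close> gives the i-th
        constraint the value \<open>- (eps i)\<^sup>2\<close>, which stays negative after a small
        step in any direction \<open>v\<close>.\<close>
      define p where "p = - (\<Sum>j=1..l. a j *\<^sub>R m j)"
      have pL: "p \<in> L" unfolding p_def using L m by (intro subspace_neg subspace_sum subspace_scale)
      have pm: "p \<bullet> m i = - eps i" if i: "i \<in> {1..l}" for i
      proof -
        have "(\<Sum>j=1..l. a j) = s - (\<Sum>j=1..l. lam j) * s / ?T"
          by (simp add: a_def sum_subtractf s_def sum_distrib_right sum_divide_distrib)
        also have "\<dots> = s * lam0 / ?T" using nz by (simp add: field_simps)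
        finally have sa: "(\<Sum>j=1..l. a j) = s * lam0 / ?T" .
        have "- (p \<bullet> m i) = (\<Sum>j=1..l. a j * (1 / lam0 + (if j = i then 1 / lam j else 0)))"
          unfolding p_def inner_minus_left minus_minus inner_sum_left using i gram
          by (intro sum.cong refl) simp
        also have "\<dots> = (\<Sum>j=1..l. a j) / lam0 + (\<Sum>j=1..l. if j = i then a j / lam j else 0)"
          unfolding sum_divide_distrib sum.distrib[symmetric] by (intro sum.cong refl) (simp add: distrib_left)
        also have "\<dots> = s / ?T + a i / lam i" unfolding sa using i nz by simp
        also have "a i / lam i = eps i - s / ?T" using nz i by (simp add: a_def diff_divide_distrib)
        finally show ?thesis by simp
      qed
      have "\<exists>\<delta>>0. \<forall>j\<in>{1..l}. eps j * ((p + \<delta> *\<^sub>R v) \<bullet> m j) \<le> 0"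
      proof -
        have ev: "\<forall>\<^sub>F \<delta> in at_right (0::real). \<forall>j\<in>{1..l}. eps j * ((p + \<delta> *\<^sub>R v) \<bullet> m j) < 0"
        proof (rule eventually_ball_finite, simp, intro ballI)
          fix j assume j: "j \<in> {1..l}"
          have "((\<lambda>\<delta>. eps j * ((p + \<delta> *\<^sub>R v) \<bullet> m j)) \<longlongrightarrow> eps j * ((p + 0 *\<^sub>R v) \<bullet> m j)) (at_right (0::real))"
            by (intro tendsto_intros)
          moreover have "eps j * ((p + 0 *\<^sub>R v) \<bullet> m j) < 0"
            using pm[OF j] nz(4)[OF j] by (simp add: not_sum_squares_lt_zero less_le)
          ultimately show "\<forall>\<^sub>F \<delta> in at_right (0::real). eps j * ((p + \<delta> *\<^sub>R v) \<bullet> m j) < 0"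
            by (rule order_tendstoD(2))
        qed
        have "\<forall>\<^sub>F \<delta> in at_right (0::real). \<delta> > 0" by (rule eventually_at_right_less)
        with ev have "\<forall>\<^sub>F \<delta> in at_right (0::real). \<delta> > 0 \<and> (\<forall>j\<in>{1..l}. eps j * ((p + \<delta> *\<^sub>R v) \<bullet> m j) \<le> 0)"
          by eventually_elim (auto intro: less_imp_le)
        then show ?thesis using eventually_happens'[OF trivial_limit_at_right_real] by blast
      qed
      then obtain \<delta> where \<delta>: "\<delta> > 0" "\<forall>j\<in>{1..l}. eps j * ((p + \<delta> *\<^sub>R v) \<bullet> m j) \<le> 0" by blast
      have "p \<in> ?C" using pL pm by (auto simp: mult_nonneg_nonneg)
      moreover have "p + \<delta> *\<^sub>R v \<in> ?C" using pL v L \<delta> by (auto intro: subspace_add subspace_scale)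
      ultimately have "(1 / \<delta>) *\<^sub>R ((p + \<delta> *\<^sub>R v) - p) \<in> span ?C"
        by (intro span_scale span_diff span_base)
      then show "v \<in> span ?C" using \<delta> by simp
    qed
  qed
  ultimately show ?thesis using l by (simp add: solid_angle_def gfun_def Let_def)
qed

end

section \<open>Angles of the simplex\<close>

text \<open>The numbers \<open>x \<bullet> g i\<close> are the coordinates of \<open>x\<close> in
  the basis \<open>w\<close>. On the simplex they are the barycentric coordinates, so relative
  interiors and cones can be read off from their signs.\<close>

locale biorthogonal_basis =
  fixes J :: "nat set" and w g :: "nat \<Rightarrow> 'a::euclidean_space"
  assumes fin: "finite J"
    and dual: "\<And>i j. i \<in> J \<Longrightarrow> j \<in> J \<Longrightarrow> w i \<bullet> g j = (if i = j then 1 else 0)"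
    and expand: "\<And>x. (\<Sum>i\<in>J. (x \<bullet> g i) *\<^sub>R w i) = x"
begin

lemma inj: "inj_on w J"
proof (rule inj_onI)
  fix i j assume "i \<in> J" "j \<in> J" "w i = w j"
  then show "i = j" using dual[of i j] dual[of j j] by (auto split: if_splits)
qed

lemma inner_dual_sum:
  assumes "I \<subseteq> J" "j \<in> J"
  shows "(\<Sum>i\<in>I. c i *\<^sub>R w i) \<bullet> g j = (if j \<in> I then c j else 0)"
proof -
  have "finite I" using assms fin finite_subset by blast
  have "(\<Sum>i\<in>I. c i *\<^sub>R w i) \<bullet> g j = (\<Sum>i\<in>I. if i = j then c i else 0)"
    unfolding inner_sum_left using assms dual by (intro sum.cong refl) auto
  then show ?thesis using \<open>finite I\<close> by simp
qed

lemma affine_independent: "\<not> affine_dependent (w ` J)"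
proof
  assume "affine_dependent (w ` J)"
  then have "dependent (w ` J)" by (rule affine_dependent_imp_dependent)
  then obtain u i where u: "(\<Sum>v\<in>w ` J. u v *\<^sub>R v) = 0" "i \<in> J" "u (w i) \<noteq> 0"
    using fin by (auto simp: dependent_finite)
  then have "(\<Sum>i\<in>J. u (w i) *\<^sub>R w i) = 0" by (simp add: sum.reindex[OF inj])
  with u inner_dual_sum[of J i "\<lambda>i. u (w i)"] show False by simp
qed

lemma simplex_hull: "card J = n + 1 \<Longrightarrow> int n simplex (convex hull (w ` J))"
  unfolding simplex_def using affine_independent card_image[OF inj] by (intro exI[of _ "w ` J"]) auto

lemma face_of_hull: "I \<subseteq> J \<Longrightarrow> convex hull (w ` I) face_of convex hull (w ` J)"
  unfolding face_of_convex_hull_affine_independent[OF affine_independent] by (intro exI[of _ "w ` I"]) auto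

lemma affine_independent_face: "I \<subseteq> J \<Longrightarrow> \<not> affine_dependent (w ` I)"
  by (rule affine_independent_subset[OF affine_independent image_mono])

lemma aff_dim_hull: "I \<subseteq> J \<Longrightarrow> card I = n + 1 \<Longrightarrow> aff_dim (convex hull (w ` I)) = int n"
  using aff_dim_affine_independent[OF affine_independent_face, of I] card_image[OF inj_on_subset[OF inj, of I]]
  by (simp add: aff_dim_convex_hull)

lemma hull_eq: "convex hull (w ` J) = {x. (\<forall>i\<in>J. 0 \<le> x \<bullet> g i) \<and> (\<Sum>i\<in>J. x \<bullet> g i) = 1}"
proof (intro equalityI subsetI)
  fix x assume "x \<in> convex hull (w ` J)"
  then obtain u where u: "\<forall>v\<in>w ` J. 0 \<le> u v" "sum u (w ` J) = 1" "(\<Sum>v\<in>w ` J. u v *\<^sub>R v) = x"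
    unfolding convex_hull_finite[OF finite_imageI[OF fin]] by blast
  then have x: "(\<Sum>i\<in>J. u (w i) *\<^sub>R w i) = x" and s: "(\<Sum>i\<in>J. u (w i)) = 1"
    by (simp_all add: sum.reindex[OF inj])
  have "x \<bullet> g j = u (w j)" if "j \<in> J" for j
    using inner_dual_sum[of J j "\<lambda>i. u (w i)"] that x by simp
  with u s show "x \<in> {x. (\<forall>i\<in>J. 0 \<le> x \<bullet> g i) \<and> (\<Sum>i\<in>J. x \<bullet> g i) = 1}" by simp
next
  fix x assume x: "x \<in> {x. (\<forall>i\<in>J. 0 \<le> x \<bullet> g i) \<and> (\<Sum>i\<in>J. x \<bullet> g i) = 1}"
  then have "(\<Sum>i\<in>J. (x \<bullet> g i) *\<^sub>R w i) \<in> convex hull (w ` J)"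
    using fin by (intro convex_sum) (auto intro: hull_inc)
  then show "x \<in> convex hull (w ` J)" by (simp add: expand)
qed

lemma rel_interior_hull:
  assumes I: "I \<subseteq> J" and x: "x \<in> rel_interior (convex hull (w ` I))"
  shows "\<And>i. i \<in> I \<Longrightarrow> 0 < x \<bullet> g i" "\<And>i. i \<in> J - I \<Longrightarrow> x \<bullet> g i = 0"
    "(\<Sum>i\<in>J. x \<bullet> g i) = 1" "(\<Sum>i\<in>I. x \<bullet> g i) = 1" "(\<Sum>i\<in>I. (x \<bullet> g i) *\<^sub>R w i) = x"
proof -
  have injI: "inj_on w I" using inj I by (rule inj_on_subset)
  obtain u where u: "\<forall>v\<in>w ` I. 0 < u v" "sum u (w ` I) = 1" "(\<Sum>v\<in>w ` I. u v *\<^sub>R v) = x"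
    using x unfolding rel_interior_convex_hull_explicit[OF affine_independent_face[OF I]] by blast
  then have xs: "(\<Sum>i\<in>I. u (w i) *\<^sub>R w i) = x" and s: "(\<Sum>i\<in>I. u (w i)) = 1"
    by (simp_all add: sum.reindex[OF injI])
  have c: "x \<bullet> g j = (if j \<in> I then u (w j) else 0)" if "j \<in> J" for j
    using inner_dual_sum[OF I that, of "\<lambda>i. u (w i)"] xs by simp
  show "\<And>i. i \<in> I \<Longrightarrow> 0 < x \<bullet> g i" "\<And>i. i \<in> J - I \<Longrightarrow> x \<bullet> g i = 0"
    using c I u by auto
  have cI: "x \<bullet> g i = u (w i)" if "i \<in> I" for i using c[of i] I that by auto
  show "(\<Sum>i\<in>I. x \<bullet> g i) = 1" using s by (simp add: cI)
  then show "(\<Sum>i\<in>J. x \<bullet> g i) = 1"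
    using fin I c by (subst sum.mono_neutral_right[of J I]) auto
  show "(\<Sum>i\<in>I. (x \<bullet> g i) *\<^sub>R w i) = x" using xs by (simp add: cI)
qed

text \<open>At a relative interior point of the face the coordinates in \<open>I\<close> are
  strictly positive and tolerate a small step in any direction. The others vanish and must not
  decrease; the coordinate sum must remain 1.\<close>

lemma tangent_cone_eq:
  assumes I: "I \<subseteq> J" "I \<noteq> {}"
  shows "tangent_cone (convex hull (w ` I)) (convex hull (w ` J)) =
    {v. (\<Sum>i\<in>J. v \<bullet> g i) = 0 \<and> (\<forall>i\<in>J - I. 0 \<le> v \<bullet> g i)}"
proof -
  define x where "x = (SOME x0. x0 \<in> rel_interior (convex hull (w ` I)))"
  have x: "x \<in> rel_interior (convex hull (w ` I))"
    unfolding x_def by (rule someI_ex) (use I in \<open>auto simp: ex_in_conv rel_interior_eq_empty\<close>)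
  note r = rel_interior_hull[OF I(1) x]
  show ?thesis
    unfolding tangent_cone_def x_def[symmetric] tangent_cone_at_def hull_eq
  proof (intro equalityI subsetI)
    fix v assume "v \<in> {v. \<exists>\<epsilon>>0. x + \<epsilon> *\<^sub>R v \<in> {x. (\<forall>i\<in>J. 0 \<le> x \<bullet> g i) \<and> (\<Sum>i\<in>J. x \<bullet> g i) = 1}}"
    then obtain \<epsilon> where e: "\<epsilon> > 0" "\<forall>i\<in>J. 0 \<le> x \<bullet> g i + \<epsilon> * (v \<bullet> g i)" "(\<Sum>i\<in>J. x \<bullet> g i + \<epsilon> * (v \<bullet> g i)) = 1"
      by (auto simp: inner_add_left)
    from e(3) r(3) have "\<epsilon> * (\<Sum>i\<in>J. v \<bullet> g i) = 0" by (simp add: sum.distrib sum_distrib_left)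
    moreover have "0 \<le> v \<bullet> g i" if "i \<in> J - I" for i
    proof -
      have "0 \<le> \<epsilon> * (v \<bullet> g i)" using e(2) r(2)[OF that] that by force
      then show ?thesis using e(1) by (simp add: zero_le_mult_iff)
    qed
    ultimately show "v \<in> {v. (\<Sum>i\<in>J. v \<bullet> g i) = 0 \<and> (\<forall>i\<in>J - I. 0 \<le> v \<bullet> g i)}" using e(1) by auto
  next
    fix v assume v: "v \<in> {v. (\<Sum>i\<in>J. v \<bullet> g i) = 0 \<and> (\<forall>i\<in>J - I. 0 \<le> v \<bullet> g i)}"
    have "\<forall>\<^sub>F \<epsilon> in at_right (0::real). \<forall>i\<in>J. 0 \<le> x \<bullet> g i + \<epsilon> * (v \<bullet> g i)"
    proof (intro eventually_ball_finite fin ballI)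
      fix i assume i: "i \<in> J"
      show "\<forall>\<^sub>F \<epsilon> in at_right (0::real). 0 \<le> x \<bullet> g i + \<epsilon> * (v \<bullet> g i)"
      proof (cases "i \<in> I")
        case True
        have "((\<lambda>\<epsilon>. x \<bullet> g i + \<epsilon> * (v \<bullet> g i)) \<longlongrightarrow> x \<bullet> g i + 0 * (v \<bullet> g i)) (at_right (0::real))"
          by (intro tendsto_intros)
        then have "\<forall>\<^sub>F \<epsilon> in at_right (0::real). 0 < x \<bullet> g i + \<epsilon> * (v \<bullet> g i)"
          by (rule order_tendstoD(1)) (use r(1)[OF True] in simp)
        then show ?thesis by eventually_elim simp
      next
        case False
        then have "0 \<le> v \<bullet> g i" "x \<bullet> g i = 0" using v i r(2)[of i] by auto
        then show ?thesis by (intro eventually_mono[OF eventually_at_right_less[of 0]]) simp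
      qed
    qed
    then have "\<forall>\<^sub>F \<epsilon> in at_right (0::real). \<epsilon> > 0 \<and> (\<forall>i\<in>J. 0 \<le> x \<bullet> g i + \<epsilon> * (v \<bullet> g i))"
      using eventually_at_right_less[of "0::real"] by eventually_elim simp
    then obtain \<epsilon> where "\<epsilon> > 0" "\<forall>i\<in>J. 0 \<le> x \<bullet> g i + \<epsilon> * (v \<bullet> g i)"
      using eventually_happens'[OF trivial_limit_at_right_real] by blast
    moreover have "(\<Sum>i\<in>J. x \<bullet> g i + \<epsilon> * (v \<bullet> g i)) = 1"
      using v r(3) by (simp add: sum.distrib sum_distrib_left[symmetric])
    ultimately show "v \<in> {v. \<exists>\<epsilon>>0. x + \<epsilon> *\<^sub>R v \<in> {x. (\<forall>i\<in>J. 0 \<le> x \<bullet> g i) \<and> (\<Sum>i\<in>J. x \<bullet> g i) = 1}}"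
      by (auto simp: inner_add_left)
  qed
qed

text \<open>A normal vector is constant on the affine hull of the face, so the relative interior
  point may be replaced by any \<open>q\<close> of that hull. The freedom is used to take for
  \<open>q\<close> the orthogonal projection of the remaining vertices, which makes the vectors
  \<open>w j - q\<close> orthogonal to the face.\<close>

lemma normal_cone_eq:
  assumes I: "I \<subseteq> J" "I \<noteq> {}" and q: "q = (\<Sum>i\<in>I. c i *\<^sub>R w i)" "(\<Sum>i\<in>I. c i) = 1"
  shows "normal_cone (convex hull (w ` I)) (convex hull (w ` J)) =
    {v. (\<forall>i\<in>I. v \<bullet> (w i - q) = 0) \<and> (\<forall>j\<in>J - I. v \<bullet> (w j - q) \<le> 0)}"
proof -
  define x where "x = (SOME x0. x0 \<in> rel_interior (convex hull (w ` I)))"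
  have x: "x \<in> rel_interior (convex hull (w ` I))"
    unfolding x_def by (rule someI_ex) (use I in \<open>auto simp: ex_in_conv rel_interior_eq_empty\<close>)
  note r = rel_interior_hull[OF I(1) x]
  have finI: "finite I" using I fin finite_subset by blast
  have avg: "v \<bullet> (\<Sum>i\<in>I. a i *\<^sub>R w i) = b" if "\<And>i. i \<in> I \<Longrightarrow> v \<bullet> w i = b" "(\<Sum>i\<in>I. a i) = 1" for v a b
  proof -
    have "v \<bullet> (\<Sum>i\<in>I. a i *\<^sub>R w i) = (\<Sum>i\<in>I. a i * b)"
      unfolding inner_sum_right using that by (intro sum.cong) auto
    then show ?thesis using that by (simp flip: sum_distrib_right)
  qed
  show ?thesis
    unfolding normal_cone_def x_def[symmetric] normal_cone_at_def
  proof (intro equalityI subsetI)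
    fix v assume v: "v \<in> {v. \<forall>z\<in>convex hull (w ` J). v \<bullet> (z - x) \<le> 0}"
    then have le: "v \<bullet> w j \<le> v \<bullet> x" if "j \<in> J" for j
      using that by (auto simp: inner_diff_right intro: hull_inc)
    \<comment> \<open>\<open>x\<close> is a combination with strictly positive weights of vertices
      on which \<open>v\<close> is at most its value at \<open>x\<close>; hence equality holds at
      each of them.\<close>
    have eq: "v \<bullet> w i = v \<bullet> x" if i: "i \<in> I" for i
    proof -
      have 1: "(\<Sum>i\<in>I. (x \<bullet> g i) * (v \<bullet> w i)) = v \<bullet> (\<Sum>i\<in>I. (x \<bullet> g i) *\<^sub>R w i)"
        by (simp only: inner_sum_right inner_scaleR_right)
      have 2: "(\<Sum>i\<in>I. (x \<bullet> g i) * (v \<bullet> x)) = v \<bullet> x"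
        using r(4) by (simp flip: sum_distrib_right)
      have z: "(\<Sum>i\<in>I. (x \<bullet> g i) * (v \<bullet> x - v \<bullet> w i)) = 0"
        by (simp only: right_diff_distrib sum_subtractf 1 2 r(5) diff_self)
      have "0 \<le> (x \<bullet> g j) * (v \<bullet> x - v \<bullet> w j)" if "j \<in> I" for j
        using r(1)[OF that] le[of j] I that by (intro mult_nonneg_nonneg) auto
      then have "(x \<bullet> g i) * (v \<bullet> x - v \<bullet> w i) = 0"
        using z finI i by (simp only: sum_nonneg_eq_0_iff)
      then show ?thesis using r(1)[OF i] by simp
    qed
    have "v \<bullet> q = v \<bullet> x" unfolding q(1) by (rule avg[OF eq q(2)])
    then show "v \<in> {v. (\<forall>i\<in>I. v \<bullet> (w i - q) = 0) \<and> (\<forall>j\<in>J - I. v \<bullet> (w j - q) \<le> 0)}"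
      using eq le by (simp add: inner_diff_right)
  next
    fix v assume v: "v \<in> {v. (\<forall>i\<in>I. v \<bullet> (w i - q) = 0) \<and> (\<forall>j\<in>J - I. v \<bullet> (w j - q) \<le> 0)}"
    then have "v \<bullet> w i = v \<bullet> q" if "i \<in> I" for i using that by (simp add: inner_diff_right)
    from avg[OF this r(4)] have vx: "v \<bullet> x = v \<bullet> q" by (simp add: r(5))
    have "v \<bullet> (z - x) \<le> 0" if "z \<in> convex hull (w ` J)" for z
    proof -
      have le: "v \<bullet> w j \<le> v \<bullet> q" if "j \<in> J" for j
        using v that by (cases "j \<in> I") (auto simp: inner_diff_right)
      have "v \<bullet> z = (\<Sum>i\<in>J. (z \<bullet> g i) * (v \<bullet> w i))"
        by (subst expand[of z, symmetric]) (simp only: inner_sum_right inner_scaleR_right)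
      also have "\<dots> \<le> (\<Sum>i\<in>J. (z \<bullet> g i) * (v \<bullet> q))"
        using that le by (intro sum_mono mult_left_mono) (auto simp: hull_eq)
      also have "\<dots> = v \<bullet> q" using that by (simp add: hull_eq flip: sum_distrib_right)
      finally show ?thesis using vx by (simp add: inner_diff_right)
    qed
    then show "v \<in> {v. \<forall>z\<in>convex hull (w ` J). v \<bullet> (z - x) \<le> 0}" by blast
  qed
qed

end

section \<open>The given simplex and its angles\<close>

locale weighted_simplex =
  fixes d :: nat and \<tau> :: "nat \<Rightarrow> real" and e :: "nat \<Rightarrow> 'a::euclidean_space"
  assumes \<tau>_pos: "\<And>i. i \<le> d \<Longrightarrow> \<tau> i > 0"
    and bij: "bij_betw e {0..d} (Basis :: 'a set)"
begin

definition T :: real where "T = (\<Sum>i=0..d. (\<tau> i)\<^sup>2)"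
text \<open>Every vertex lies on the hyperplane \<open>x \<bullet> nv = 1\<close>, so the direction
  space of the simplex is the orthogonal complement of \<open>nv\<close>, and the apex
  \<open>w 0\<close> is the foot of the perpendicular from the origin.\<close>

definition nv :: 'a where "nv = (\<Sum>i=0..d. \<tau> i *\<^sub>R e i)"
definition w :: "nat \<Rightarrow> 'a" where "w i = (if i = 0 then (1 / T) *\<^sub>R nv else (1 / \<tau> i) *\<^sub>R e i)"
text \<open>The dual basis of \<open>w\<close>. Only \<open>w 0\<close> has a component along
  \<open>e 0\<close>, which determines \<open>g 0\<close>; for the other indices a multiple of
  \<open>e 0\<close> is subtracted to make \<open>\<tau> i *\<^sub>R e i\<close> orthogonal to
  \<open>nv\<close>.\<close>

definition g :: "nat \<Rightarrow> 'a" where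
  "g i = (if i = 0 then (T / \<tau> 0) *\<^sub>R e 0 else \<tau> i *\<^sub>R e i - ((\<tau> i)\<^sup>2 / \<tau> 0) *\<^sub>R e 0)"

lemma T_pos: "T > 0"
proof -
  have "(\<tau> 0)\<^sup>2 \<le> T" unfolding T_def by (rule member_le_sum) auto
  then show ?thesis using \<tau>_pos[of 0] by (meson less_le_trans zero_less_power le0)
qed

lemma sum_sq_pos: "A \<subseteq> {0..d} \<Longrightarrow> A \<noteq> {} \<Longrightarrow> 0 < (\<Sum>i\<in>A. (\<tau> i)\<^sup>2)"
proof (rule sum_pos)
  fix i assume "A \<subseteq> {0..d}" "i \<in> A"
  then show "0 < (\<tau> i)\<^sup>2" using \<tau>_pos[of i] by auto
qed (auto intro: finite_subset)

lemma inner_e_e: "i \<le> d \<Longrightarrow> j \<le> d \<Longrightarrow> e i \<bullet> e j = (if i = j then 1 else 0)"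
proof -
  assume ij: "i \<le> d" "j \<le> d"
  then have "e i \<in> Basis" "e j \<in> Basis" using bij by (auto simp: bij_betw_def)
  moreover have "e i = e j \<longleftrightarrow> i = j" using bij ij by (auto simp: bij_betw_def inj_on_eq_iff)
  ultimately show ?thesis by (simp add: inner_Basis)
qed

lemma inner_nv_e: "j \<le> d \<Longrightarrow> nv \<bullet> e j = \<tau> j"
proof -
  assume j: "j \<le> d"
  have "nv \<bullet> e j = (\<Sum>i=0..d. if i = j then \<tau> j else 0)"
    unfolding nv_def inner_sum_left using j by (intro sum.cong refl) (auto simp: inner_e_e)
  then show ?thesis using j by simp
qed

lemma inner_e_nv: "j \<le> d \<Longrightarrow> e j \<bullet> nv = \<tau> j"
  using inner_nv_e by (simp add: inner_commute)

lemma inner_nv_nv: "nv \<bullet> nv = T"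
proof -
  have "nv \<bullet> nv = (\<Sum>i=0..d. \<tau> i * (e i \<bullet> nv))"
    by (subst nv_def) (simp only: inner_sum_left inner_scaleR_left)
  also have "\<dots> = T" unfolding T_def by (intro sum.cong refl) (simp add: inner_e_nv power2_eq_square)
  finally show ?thesis .
qed

lemma inner_w_nv: "i \<le> d \<Longrightarrow> w i \<bullet> nv = 1"
  using \<tau>_pos[of i] T_pos by (simp add: w_def inner_nv_nv inner_e_nv)

lemma inner_w_w:
  "i \<le> d \<Longrightarrow> j \<le> d \<Longrightarrow> w i \<bullet> w j = (if i = 0 \<or> j = 0 then 1 / T else if i = j then 1 / (\<tau> i)\<^sup>2 else 0)"
  using \<tau>_pos[of i] \<tau>_pos[of j] T_pos
  by (auto simp: w_def inner_nv_nv inner_e_nv inner_nv_e inner_e_e power2_eq_square)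

sublocale biorthogonal_basis "{0..d}" w g
proof
  fix i j assume "i \<in> {0..d}" "j \<in> {0..d}"
  then have "i \<le> d" "j \<le> d" "\<tau> i \<noteq> 0" "\<tau> j \<noteq> 0" "\<tau> 0 \<noteq> 0" "T \<noteq> 0"
    using \<tau>_pos[of i] \<tau>_pos[of j] \<tau>_pos[of 0] T_pos by auto
  then show "w i \<bullet> g j = (if i = j then 1 else 0)"
    by (cases "i = 0"; cases "j = 0")
       (simp_all add: w_def g_def inner_nv_e inner_e_e inner_diff_right power2_eq_square)
next
  fix x :: 'a
  show "(\<Sum>i\<in>{0..d}. (x \<bullet> g i) *\<^sub>R w i) = x"
  proof (rule euclidean_eqI)
    fix b :: 'a assume "b \<in> Basis"
    then obtain j where j: "j \<le> d" "b = e j" using bij_betw_imp_surj_on[OF bij] by force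
    have "(\<Sum>i\<in>{0..d}. (x \<bullet> g i) *\<^sub>R w i) \<bullet> e j = (x \<bullet> g 0) * (w 0 \<bullet> e j) + (\<Sum>i\<in>{1..d}. (x \<bullet> g i) * (w i \<bullet> e j))"
      unfolding inner_sum_left by (subst sum.atLeast_Suc_atMost) auto
    also have "(\<Sum>i\<in>{1..d}. (x \<bullet> g i) * (w i \<bullet> e j)) = (\<Sum>i\<in>{1..d}. if i = j then (x \<bullet> g j) / \<tau> j else 0)"
      using j by (intro sum.cong refl) (auto simp: w_def inner_e_e)
    also have "\<dots> = (if j = 0 then 0 else (x \<bullet> g j) / \<tau> j)" using j by auto
    finally have E: "(\<Sum>i\<in>{0..d}. (x \<bullet> g i) *\<^sub>R w i) \<bullet> e j = (x \<bullet> g 0) * (w 0 \<bullet> e j) + (if j = 0 then 0 else (x \<bullet> g j) / \<tau> j)" .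
    have "\<tau> j \<noteq> 0" "\<tau> 0 \<noteq> 0" "T \<noteq> 0" using j \<tau>_pos[of j] \<tau>_pos[of 0] T_pos by auto
    then show "(\<Sum>i\<in>{0..d}. (x \<bullet> g i) *\<^sub>R w i) \<bullet> b = x \<bullet> b"
      unfolding j(2) E using j(1)
      by (cases "j = 0") (simp_all add: w_def g_def inner_nv_e inner_diff_right power2_eq_square field_simps)
  qed
qed auto

text \<open>Both sides are linear in \<open>v\<close> and \<open>nv\<close> takes the value 1 at
  each vertex. The condition on the coordinate sum in the tangent cone thus becomes orthogonality to
  \<open>nv\<close>.\<close>

lemma sum_inner_g: "(\<Sum>i\<in>{0..d}. v \<bullet> g i) = v \<bullet> nv"
proof -
  have "v \<bullet> nv = (\<Sum>i\<in>{0..d}. (v \<bullet> g i) *\<^sub>R w i) \<bullet> nv" by (simp only: expand)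
  also have "\<dots> = (\<Sum>i\<in>{0..d}. v \<bullet> g i)"
    unfolding inner_sum_left by (intro sum.cong refl) (simp add: inner_w_nv)
  finally show ?thesis by simp
qed

lemma subspace_nv: "subspace {v. v \<bullet> nv = 0}"
  by (auto simp: subspace_def inner_add_left)

lemma subspace_face: "subspace {v. \<forall>i\<in>I. v \<bullet> (w i - q) = 0}"
  by (auto simp: subspace_def inner_add_left)

lemma shift: "{k+1..d} = (\<lambda>j. k + j) ` {1..d - k}" if "k < d"
  using that by (subst image_add_atLeastAtMost) auto

lemma sum_shift: "(\<Sum>j=1..d - k. f (k + j)) = (\<Sum>i=k+1..d. f i)" if "k < d" for f :: "nat \<Rightarrow> real"
  unfolding shift[OF that] by (subst sum.reindex) auto

lemma T_split: "T = (\<tau> 0)\<^sup>2 + (\<Sum>i=1..k. (\<tau> i)\<^sup>2) + (\<Sum>i=k+1..d. (\<tau> i)\<^sup>2)" if "k \<le> d"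
proof -
  have "T = (\<tau> 0)\<^sup>2 + (\<Sum>i=1..d. (\<tau> i)\<^sup>2)"
    unfolding T_def by (subst sum.atLeast_Suc_atMost) auto
  also have "{1..d} = {1..k} \<union> {k+1..d}" using that by auto
  also have "(\<Sum>i\<in>{1..k} \<union> {k+1..d}. (\<tau> i)\<^sup>2) = (\<Sum>i=1..k. (\<tau> i)\<^sup>2) + (\<Sum>i=k+1..d. (\<tau> i)\<^sup>2)"
    by (rule sum.union_disjoint) auto
  finally show ?thesis by simp
qed

lemma internal_angle_apex_face:
  assumes k: "k < d"
  shows "internal_angle (convex hull (w ` {0..k})) (convex hull (w ` {0..d})) =
    gfun (d - k) ((\<tau> 0)\<^sup>2) (\<lambda>j. (\<tau> (k + j))\<^sup>2) (\<lambda>_. 1)"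
proof -
  \<comment> \<open>This is \<open>g (k + j)\<close> divided by
    \<open>- (\<tau> (k + j))\<^sup>2\<close>. With this scaling the common part along
    \<open>e 0\<close> contributes \<open>1 / (\<tau> 0)\<^sup>2\<close> to every Gram entry, and
    the mutually orthogonal parts contribute the diagonal.\<close>
  define m where "m j = (1 / \<tau> 0) *\<^sub>R e 0 - (1 / \<tau> (k + j)) *\<^sub>R e (k + j)" for j
  have t0: "\<tau> 0 > 0" by (rule \<tau>_pos) simp
  have tj: "\<tau> (k + j) > 0" "k + j \<le> d" "k + j \<noteq> 0" if "j \<in> {1..d - k}" for j
    using that k \<tau>_pos[of "k + j"] by auto
  have eq: "tangent_cone (convex hull (w ` {0..k})) (convex hull (w ` {0..d})) =
     {v \<in> {v. v \<bullet> nv = 0}. \<forall>j\<in>{1..d - k}. 1 * (v \<bullet> m j) \<le> 0}"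
  proof -
    have "(\<forall>i\<in>{0..d} - {0..k}. 0 \<le> v \<bullet> g i) \<longleftrightarrow> (\<forall>j\<in>{1..d - k}. 1 * (v \<bullet> m j) \<le> 0)" for v
    proof -
      have *: "{0..d} - {0..k} = (\<lambda>j. k + j) ` {1..d - k}"
        unfolding shift[OF k, symmetric] by auto
      have "(\<forall>i\<in>{0..d} - {0..k}. 0 \<le> v \<bullet> g i) \<longleftrightarrow> (\<forall>j\<in>{1..d - k}. 0 \<le> v \<bullet> g (k + j))"
        unfolding * by blast
      also have "\<dots> \<longleftrightarrow> (\<forall>j\<in>{1..d - k}. 1 * (v \<bullet> m j) \<le> 0)"
      proof (intro ball_cong refl)
        fix j assume j: "j \<in> {1..d - k}"
        have "v \<bullet> g (k + j) = - ((\<tau> (k + j))\<^sup>2 * (v \<bullet> m j))"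
          using tj[OF j] t0 j by (auto simp: g_def m_def inner_diff_right power2_eq_square field_simps)
        then show "0 \<le> v \<bullet> g (k + j) \<longleftrightarrow> 1 * (v \<bullet> m j) \<le> 0"
          using tj[OF j] by (simp add: mult_le_0_iff)
      qed
      finally show ?thesis .
    qed
    note claim = this
    have T: "tangent_cone (convex hull (w ` {0..k})) (convex hull (w ` {0..d})) =
        {v. (\<Sum>i\<in>{0..d}. v \<bullet> g i) = 0 \<and> (\<forall>i\<in>{0..d} - {0..k}. 0 \<le> v \<bullet> g i)}"
      by (rule tangent_cone_eq) (use k in auto)
    show ?thesis unfolding T sum_inner_g mem_Collect_eq by (intro Collect_cong conj_cong refl claim)
  qed
  show ?thesis unfolding internal_angle_def eq
  proof (rule solid_angle_orthant[OF subspace_nv])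
    show "m j \<in> {v. v \<bullet> nv = 0}" if "j \<in> {1..d - k}" for j
      using tj[OF that] t0 by (simp add: m_def inner_diff_left inner_e_nv)
    show "m i \<bullet> m j = 1 / (\<tau> 0)\<^sup>2 + (if i = j then 1 / (\<tau> (k + i))\<^sup>2 else 0)"
      if "i \<in> {1..d - k}" "j \<in> {1..d - k}" for i j
      using tj[OF that(1)] tj[OF that(2)] t0 that
      by (auto simp: m_def inner_diff_left inner_diff_right inner_e_e power2_eq_square)
    have "0 < (\<tau> 0)\<^sup>2 + (\<Sum>j=1..d - k. (\<tau> (k + j))\<^sup>2)"
      using t0 by (intro add_pos_nonneg sum_nonneg) auto
    then show "(\<tau> 0)\<^sup>2 + (\<Sum>j=1..d - k. (\<tau> (k + j))\<^sup>2) \<noteq> 0" by simp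
    show "(\<tau> (k + j))\<^sup>2 \<noteq> 0" if "j \<in> {1..d - k}" for j using tj[OF that] by simp
  qed (use k t0 in auto)
qed

lemma external_angle_apex_face:
  assumes k: "k < d"
  shows "external_angle (convex hull (w ` {0..k})) (convex hull (w ` {0..d})) =
    gfun (d - k) (- (\<tau> 0)\<^sup>2 - (\<Sum>i=k+1..d. (\<tau> i)\<^sup>2)) (\<lambda>j. (\<tau> (k + j))\<^sup>2) (\<lambda>_. 1)"
proof -
  define A where "A = (\<Sum>i=1..k. (\<tau> i)\<^sup>2)"
  define D where "D = (\<tau> 0)\<^sup>2 + (\<Sum>i=k+1..d. (\<tau> i)\<^sup>2)"
  \<comment> \<open>The weights make \<open>q\<close> equal to \<open>1 / D\<close> times the part
    of \<open>nv\<close> along \<open>e 0\<close> and \<open>e (k+1), ..., e d\<close>. All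
    remaining vertices have this same orthogonal projection onto the affine hull of the face, and
    \<open>q \<bullet> q = 1 / D\<close> accounts for the leading parameter
    \<open>- D\<close>.\<close>
  define c where "c i = (if i = 0 then T / D else - (\<tau> i)\<^sup>2 / D)" for i
  define q where "q = (\<Sum>i\<in>{0..k}. c i *\<^sub>R w i)"
  have t0: "\<tau> 0 > 0" by (rule \<tau>_pos) simp
  have tj: "\<tau> (k + j) > 0" "k + j \<le> d" "k + j \<noteq> 0" if "j \<in> {1..d - k}" for j
    using that k \<tau>_pos[of "k + j"] by auto
  have Dpos: "D > 0" unfolding D_def using t0 by (intro add_pos_nonneg sum_nonneg) auto
  have TAD: "T = A + D" using T_split[of k] k by (simp add: A_def D_def)
  have sumc: "(\<Sum>i\<in>{0..k}. c i * f i) = (T / D) * f 0 - (\<Sum>i=1..k. (\<tau> i)\<^sup>2 * f i) / D" for f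
    by (subst sum.atLeast_Suc_atMost) (auto simp: c_def sum_negf sum_divide_distrib)
  have "(\<Sum>i\<in>{0..k}. c i) = T / D - A / D"
    using sumc[of "\<lambda>_. 1"] by (simp add: A_def)
  then have c1: "(\<Sum>i\<in>{0..k}. c i) = 1"
    using Dpos TAD by (simp add: field_simps)
  have qw: "q \<bullet> w j = (if j = 0 then 1 / T else if j \<le> k then 0 else 1 / D)" if j: "j \<le> d" for j
  proof -
    have "q \<bullet> w j = (T / D) * (w 0 \<bullet> w j) - (\<Sum>i=1..k. (\<tau> i)\<^sup>2 * (w i \<bullet> w j)) / D"
      unfolding q_def inner_sum_left inner_scaleR_left by (rule sumc)
    moreover have "(\<Sum>i=1..k. (\<tau> i)\<^sup>2 * (w i \<bullet> w j)) = (if j = 0 then A / T else if j \<le> k then 1 else 0)"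
    proof (cases "j = 0")
      case True
      then have "(\<Sum>i=1..k. (\<tau> i)\<^sup>2 * (w i \<bullet> w j)) = (\<Sum>i=1..k. (\<tau> i)\<^sup>2 / T)"
        using k by (intro sum.cong refl) (simp add: inner_w_w)
      then show ?thesis using True by (simp add: A_def sum_divide_distrib)
    next
      case False
      then have "(\<Sum>i=1..k. (\<tau> i)\<^sup>2 * (w i \<bullet> w j)) = (\<Sum>i=1..k. if i = j then 1 else 0)"
        using k j \<tau>_pos[of j] by (intro sum.cong refl) (auto simp: inner_w_w)
      then show ?thesis using False by auto
    qed
    moreover have "T / D * (1 / T) - A / T / D = 1 / T"
    proof -
      have "T / D * (1 / T) - A / T / D = (T - A) / (T * D)" using Dpos T_pos by (simp add: diff_divide_distrib)
      then show ?thesis using Dpos TAD by simp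
    qed
    ultimately show ?thesis
      using Dpos T_pos j by (auto simp: inner_w_w)
  qed
  have wq: "w j \<bullet> q = q \<bullet> w j" for j by (rule inner_commute)
  have qq: "q \<bullet> q = 1 / D"
  proof -
    have "q \<bullet> q = (\<Sum>i\<in>{0..k}. c i * (q \<bullet> w i))" by (subst (2) q_def) (simp only: inner_sum_right inner_scaleR_right)
    also have "\<dots> = 1 / D"
      unfolding sumc using k Dpos T_pos by (simp add: qw)
    finally show ?thesis .
  qed
  have eq: "normal_cone (convex hull (w ` {0..k})) (convex hull (w ` {0..d})) =
     {v \<in> {v. \<forall>i\<in>{0..k}. v \<bullet> (w i - q) = 0}. \<forall>j\<in>{1..d - k}. 1 * (v \<bullet> (w (k + j) - q)) \<le> 0}"
  proof -
    have J: "{0..d} - {0..k} = (\<lambda>j. k + j) ` {1..d - k}"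
      unfolding shift[OF k, symmetric] by auto
    have *: "(\<forall>i\<in>{0..d} - {0..k}. v \<bullet> (w i - q) \<le> 0) \<longleftrightarrow> (\<forall>j\<in>{1..d - k}. 1 * (v \<bullet> (w (k + j) - q)) \<le> 0)" for v
      unfolding J mult_1 by blast
    have N: "normal_cone (convex hull (w ` {0..k})) (convex hull (w ` {0..d})) =
        {v. (\<forall>i\<in>{0..k}. v \<bullet> (w i - q) = 0) \<and> (\<forall>j\<in>{0..d} - {0..k}. v \<bullet> (w j - q) \<le> 0)}"
      by (rule normal_cone_eq[OF _ _ q_def c1]) (use k in auto)
    show ?thesis unfolding N mem_Collect_eq * by (rule refl)
  qed
  have lam0: "- (\<tau> 0)\<^sup>2 - (\<Sum>i=k+1..d. (\<tau> i)\<^sup>2) = - D" by (simp add: D_def)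
  show ?thesis unfolding external_angle_def eq lam0
  proof (rule solid_angle_orthant[OF subspace_face])
    show "w (k + j) - q \<in> {v. \<forall>i\<in>{0..k}. v \<bullet> (w i - q) = 0}" if "j \<in> {1..d - k}" for j
      using tj[OF that] that k by (auto simp: inner_diff_left inner_diff_right wq qw qq inner_w_w)
    show "(w (k + i) - q) \<bullet> (w (k + j) - q) = 1 / - D + (if i = j then 1 / (\<tau> (k + i))\<^sup>2 else 0)"
      if "i \<in> {1..d - k}" "j \<in> {1..d - k}" for i j
      using tj[OF that(1)] tj[OF that(2)] that
      by (auto simp: inner_diff_left inner_diff_right wq qw qq inner_w_w)
    have "- D + (\<Sum>j=1..d - k. (\<tau> (k + j))\<^sup>2) = - (\<tau> 0)\<^sup>2"
      by (simp only: sum_shift[OF k, of "\<lambda>i. (\<tau> i)\<^sup>2"] D_def)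
    then show "- D + (\<Sum>j=1..d - k. (\<tau> (k + j))\<^sup>2) \<noteq> 0" using t0 by simp
    show "(\<tau> (k + j))\<^sup>2 \<noteq> 0" if "j \<in> {1..d - k}" for j using tj[OF that] by simp
  qed (use k Dpos in auto)
qed

text \<open>The vertices opposite to the base face, in the order used by \<open>gfun\<close>: the apex comes first.\<close>

definition opp :: "nat \<Rightarrow> nat \<Rightarrow> nat" where "opp k j = (if j = 1 then 0 else k + j)"

lemma opp_image: "{0..d} - {1..k+1} = opp k ` {1..d - k}" if "k < d"
proof -
  have "{1..d - k} = insert 1 {2..d - k}" using that by auto
  then have "opp k ` {1..d - k} = insert (opp k 1) (opp k ` {2..d - k})"
    by (simp only: image_insert)
  also have "opp k ` {2..d - k} = (\<lambda>j. k + j) ` {2..d - k}"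
    by (intro image_cong) (auto simp: opp_def)
  also have "(\<lambda>j. k + j) ` {2..d - k} = {k+2..d}"
    using that by (subst image_add_atLeastAtMost) auto
  also have "insert (opp k 1) {k+2..d} = {0..d} - {1..k+1}"
    by (auto simp: opp_def)
  finally show ?thesis by simp
qed

text \<open>Position 1 of the unmodified function belongs to the vertex \<open>k + 1\<close>, which
  lies in the face itself; overwriting it by the parameter \<open>- T\<close> of the apex removes
  exactly that term.\<close>

lemma base_sum:
  assumes k: "k < d"
  shows "(\<Sum>j=1..d - k. ((\<lambda>j. (\<tau> (k + j))\<^sup>2)(1 := - T)) j) = - (\<tau> 0)\<^sup>2 - (\<Sum>i=1..k+1. (\<tau> i)\<^sup>2)"
proof -
  have "(\<Sum>j=1..d - k. ((\<lambda>j. (\<tau> (k + j))\<^sup>2)(1 := - T)) j) = - T + (\<Sum>j=2..d - k. (\<tau> (k + j))\<^sup>2)"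
    using k by (subst sum.atLeast_Suc_atMost) (auto simp: numeral_2_eq_2 intro!: sum.cong)
  also have "(\<Sum>j=2..d - k. (\<tau> (k + j))\<^sup>2) = (\<Sum>j=1..d - k. (\<tau> (k + j))\<^sup>2) - (\<tau> (k + 1))\<^sup>2"
    using k by (subst (2) sum.atLeast_Suc_atMost) (auto simp: numeral_2_eq_2)
  also have "\<dots> = (\<Sum>i=k+1..d. (\<tau> i)\<^sup>2) - (\<tau> (k + 1))\<^sup>2"
    by (simp only: sum_shift[OF k, of "\<lambda>i. (\<tau> i)\<^sup>2"])
  finally show ?thesis using T_split[of k] k by simp
qed

lemma internal_angle_base_face:
  assumes k: "k < d"
  shows "internal_angle (convex hull (w ` {1..k+1})) (convex hull (w ` {0..d})) =
    gfun (d - k) ((\<tau> 0)\<^sup>2) ((\<lambda>j. (\<tau> (k + j))\<^sup>2)(1 := - T)) ((\<lambda>_. 1)(1 := - 1))"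
proof -
  \<comment> \<open>The facet normal \<open>g 0\<close> opposite the apex is not orthogonal to
    \<open>nv\<close>; its projection to the direction space is \<open>T\<close> times
    \<open>m 1\<close>. The factor is positive here and negative for the other normals, whence the
    sign \<open>- 1\<close> in the first position. The Gram entry
    \<open>1 / (\<tau> 0)\<^sup>2 - 1 / T\<close> of \<open>m 1\<close> explains the parameter
    \<open>- T\<close>.\<close>
  define m where "m j = (if j = 1 then (1 / \<tau> 0) *\<^sub>R e 0 - (1 / T) *\<^sub>R nv
     else (1 / \<tau> 0) *\<^sub>R e 0 - (1 / \<tau> (k + j)) *\<^sub>R e (k + j))" for j
  let ?eps = "(\<lambda>_. 1)(1 := - 1) :: nat \<Rightarrow> real"
  have t0: "\<tau> 0 > 0" by (rule \<tau>_pos) simp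
  have tj: "\<tau> (k + j) > 0" "k + j \<le> d" "k + j \<noteq> 0" if "j \<in> {1..d - k}" for j
    using that k \<tau>_pos[of "k + j"] by auto
  have eq: "tangent_cone (convex hull (w ` {1..k+1})) (convex hull (w ` {0..d})) =
     {v \<in> {v. v \<bullet> nv = 0}. \<forall>j\<in>{1..d - k}. ?eps j * (v \<bullet> m j) \<le> 0}"
  proof -
    have "(\<forall>i\<in>{0..d} - {1..k+1}. 0 \<le> v \<bullet> g i) \<longleftrightarrow> (\<forall>j\<in>{1..d - k}. ?eps j * (v \<bullet> m j) \<le> 0)" if v: "v \<bullet> nv = 0" for v
    proof -
      have "(\<forall>i\<in>{0..d} - {1..k+1}. 0 \<le> v \<bullet> g i) \<longleftrightarrow> (\<forall>j\<in>{1..d - k}. 0 \<le> v \<bullet> g (opp k j))"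
        unfolding opp_image[OF k] mult_1 by blast
      also have "\<dots> \<longleftrightarrow> (\<forall>j\<in>{1..d - k}. ?eps j * (v \<bullet> m j) \<le> 0)"
      proof (intro ball_cong refl)
        fix j assume j: "j \<in> {1..d - k}"
        show "0 \<le> v \<bullet> g (opp k j) \<longleftrightarrow> ?eps j * (v \<bullet> m j) \<le> 0"
        proof (cases "j = 1")
          case True
          then show ?thesis using v t0 T_pos
            by (simp add: opp_def m_def g_def inner_diff_right zero_le_divide_iff zero_le_mult_iff)
        next
          case False
          have "v \<bullet> g (k + j) = - ((\<tau> (k + j))\<^sup>2 * (v \<bullet> m j))"
            using tj[OF j] t0 False j by (auto simp: g_def m_def inner_diff_right power2_eq_square field_simps)
          then show ?thesis
            using tj[OF j] False by (simp add: mult_le_0_iff opp_def)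
        qed
      qed
      finally show ?thesis .
    qed
    note claim = this
    have T: "tangent_cone (convex hull (w ` {1..k+1})) (convex hull (w ` {0..d})) =
        {v. (\<Sum>i\<in>{0..d}. v \<bullet> g i) = 0 \<and> (\<forall>i\<in>{0..d} - {1..k+1}. 0 \<le> v \<bullet> g i)}"
      by (rule tangent_cone_eq) (use k in auto)
    show ?thesis unfolding T sum_inner_g mem_Collect_eq by (intro Collect_cong conj_cong refl claim)
  qed
  show ?thesis unfolding internal_angle_def eq
  proof (rule solid_angle_orthant[OF subspace_nv])
    show "m j \<in> {v. v \<bullet> nv = 0}" if "j \<in> {1..d - k}" for j
      using tj[OF that] t0 T_pos by (simp add: m_def inner_diff_left inner_e_nv inner_nv_nv)
    show "m i \<bullet> m j = 1 / (\<tau> 0)\<^sup>2 + (if i = j then 1 / ((\<lambda>j. (\<tau> (k + j))\<^sup>2)(1 := - T)) i else 0)"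
      if "i \<in> {1..d - k}" "j \<in> {1..d - k}" for i j
      using tj[OF that(1)] tj[OF that(2)] t0 T_pos
      by (auto simp: m_def inner_diff_left inner_diff_right inner_e_e inner_e_nv inner_nv_e inner_nv_nv power2_eq_square diff_divide_distrib)
    have "0 < (\<Sum>i=1..k+1. (\<tau> i)\<^sup>2)"
      using k by (intro sum_sq_pos) auto
    then show "(\<tau> 0)\<^sup>2 + (\<Sum>j=1..d - k. ((\<lambda>j. (\<tau> (k + j))\<^sup>2)(1 := - T)) j) \<noteq> 0"
      unfolding base_sum[OF k] by simp
    show "((\<lambda>j. (\<tau> (k + j))\<^sup>2)(1 := - T)) j \<noteq> 0" if "j \<in> {1..d - k}" for j using tj[OF that] T_pos by simp
  qed (use k t0 in auto)
qed

lemma external_angle_base_face: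
  assumes k: "k < d"
  shows "external_angle (convex hull (w ` {1..k+1})) (convex hull (w ` {0..d})) =
    gfun (d - k) (\<Sum>i=1..k+1. (\<tau> i)\<^sup>2) ((\<lambda>j. (\<tau> (k + j))\<^sup>2)(1 := - T)) (\<lambda>_. 1)"
proof -
  define A where "A = (\<Sum>i=1..k+1. (\<tau> i)\<^sup>2)"
  \<comment> \<open>With these weights \<open>q\<close> is the orthogonal projection onto the affine
    hull of the face both of the origin and of every remaining vertex, the apex included.\<close>
  define c where "c i = (\<tau> i)\<^sup>2 / A" for i
  define q where "q = (\<Sum>i\<in>{1..k+1}. c i *\<^sub>R w i)"
  have t0: "\<tau> 0 > 0" by (rule \<tau>_pos) simp
  have tj: "\<tau> (k + j) > 0" "k + j \<le> d" "k + j \<noteq> 0" if "j \<in> {1..d - k}" for j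
    using that k \<tau>_pos[of "k + j"] by auto
  have Apos: "A > 0" unfolding A_def using k by (intro sum_sq_pos) auto
  have c1: "(\<Sum>i\<in>{1..k+1}. c i) = 1"
    using Apos by (simp add: c_def A_def flip: sum_divide_distrib)
  have qw: "q \<bullet> w j = (if j = 0 then 1 / T else if j \<le> k + 1 then 1 / A else 0)" if j: "j \<le> d" for j
  proof (cases "j = 0")
    case True
    have "q \<bullet> w j = (\<Sum>i\<in>{1..k+1}. c i * (1 / T))"
      unfolding q_def inner_sum_left inner_scaleR_left using True k by (intro sum.cong refl) (auto simp: inner_w_w)
    then show ?thesis using True c1 by (simp only: sum_distrib_right[symmetric]) simp
  next
    case False
    have "q \<bullet> w j = (\<Sum>i\<in>{1..k+1}. if i = j then 1 / A else 0)"
      unfolding q_def inner_sum_left inner_scaleR_left using False k j \<tau>_pos[of j] by (intro sum.cong refl) (auto simp: inner_w_w c_def)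
    then show ?thesis using False by auto
  qed
  have wq: "w j \<bullet> q = q \<bullet> w j" for j by (rule inner_commute)
  have qq: "q \<bullet> q = 1 / A"
  proof -
    have "q \<bullet> q = (\<Sum>i\<in>{1..k+1}. c i * (q \<bullet> w i))" by (subst (2) q_def) (simp only: inner_sum_right inner_scaleR_right)
    also have "\<dots> = (\<Sum>i\<in>{1..k+1}. c i * (1 / A))"
      using k by (intro sum.cong refl) (simp add: qw)
    finally show ?thesis by (simp only: sum_distrib_right[symmetric] c1 mult_1)
  qed
  have eq: "normal_cone (convex hull (w ` {1..k+1})) (convex hull (w ` {0..d})) =
     {v \<in> {v. \<forall>i\<in>{1..k+1}. v \<bullet> (w i - q) = 0}. \<forall>j\<in>{1..d - k}. 1 * (v \<bullet> (w (opp k j) - q)) \<le> 0}"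
  proof -
    have *: "(\<forall>i\<in>{0..d} - {1..k+1}. v \<bullet> (w i - q) \<le> 0) \<longleftrightarrow> (\<forall>j\<in>{1..d - k}. 1 * (v \<bullet> (w (opp k j) - q)) \<le> 0)" for v
      unfolding opp_image[OF k] mult_1 by blast
    have N: "normal_cone (convex hull (w ` {1..k+1})) (convex hull (w ` {0..d})) =
        {v. (\<forall>i\<in>{1..k+1}. v \<bullet> (w i - q) = 0) \<and> (\<forall>j\<in>{0..d} - {1..k+1}. v \<bullet> (w j - q) \<le> 0)}"
      by (rule normal_cone_eq[OF _ _ q_def c1]) (use k in auto)
    show ?thesis unfolding N mem_Collect_eq * by (rule refl)
  qed
  show ?thesis unfolding external_angle_def eq A_def[symmetric]
  proof (rule solid_angle_orthant[OF subspace_face])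
    show "w (opp k j) - q \<in> {v. \<forall>i\<in>{1..k+1}. v \<bullet> (w i - q) = 0}" if "j \<in> {1..d - k}" for j
      using tj[OF that] that k by (auto simp: inner_diff_left inner_diff_right wq qw qq inner_w_w opp_def)
    show "(w (opp k i) - q) \<bullet> (w (opp k j) - q) = 1 / A + (if i = j then 1 / ((\<lambda>j. (\<tau> (k + j))\<^sup>2)(1 := - T)) i else 0)"
      if "i \<in> {1..d - k}" "j \<in> {1..d - k}" for i j
      using tj[OF that(1)] tj[OF that(2)] that
      by (auto simp: inner_diff_left inner_diff_right wq qw qq inner_w_w opp_def)
    show "A + (\<Sum>j=1..d - k. ((\<lambda>j. (\<tau> (k + j))\<^sup>2)(1 := - T)) j) \<noteq> 0"
      unfolding base_sum[OF k] A_def using t0 by simp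
    show "((\<lambda>j. (\<tau> (k + j))\<^sup>2)(1 := - T)) j \<noteq> 0" if "j \<in> {1..d - k}" for j using tj[OF that] T_pos by simp
  qed (use k Apos in auto)
qed

end

section \<open>The entire function \<open>Phi\<close> and complex Gaussian integrals\<close>

lemma norm_exp_neg_half_square:
  "norm (exp (- (z\<^sup>2) / 2 :: complex)) = exp ((Im z)\<^sup>2 / 2) * exp (- (Re z)\<^sup>2 / 2)"
  by (simp add: norm_exp_eq_Re exp_add[symmetric] power2_eq_square field_simps)

text \<open>Stated as a limit of the primitive, because the later arguments identify an integral
  over a half-line by comparing primitives at infinity.\<close>

lemma tendsto_FTC_atLeast:
  fixes F f :: "real \<Rightarrow> complex"
  assumes F: "\<And>x. (F has_vector_derivative f x) (at x)" and cont: "continuous_on UNIV f"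
    and int: "set_integrable lborel {a..} f"
  shows "(F \<longlongrightarrow> F a + (LINT x:{a..}|lborel. f x)) at_top"
proof -
  have "((\<lambda>y. \<integral>x. indicator {..y} x *\<^sub>R (indicator {a..} x *\<^sub>R f x) \<partial>lborel) \<longlongrightarrow> (LINT x:{a..}|lborel. f x)) at_top"
    unfolding set_lebesgue_integral_def
    by (rule tendsto_integral_at_top) (use int in \<open>auto simp: set_integrable_def\<close>)
  moreover have "\<forall>\<^sub>F y in at_top. (\<integral>x. indicator {..y} x *\<^sub>R (indicator {a..} x *\<^sub>R f x) \<partial>lborel) = F y - F a"
    using eventually_ge_at_top[of a]
  proof eventually_elim
    case (elim y)
    have "(\<integral>x. indicator {..y} x *\<^sub>R (indicator {a..} x *\<^sub>R f x) \<partial>lborel) = (\<integral>x. indicator {a..y} x *\<^sub>R f x \<partial>lborel)"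
      by (intro Bochner_Integration.integral_cong) (auto split: split_indicator)
    also have "\<dots> = F y - F a"
      by (intro integral_FTC_atLeastAtMost elim)
         (auto intro: has_vector_derivative_at_within F continuous_on_subset[OF cont])
    finally show ?case .
  qed
  ultimately have "((\<lambda>y. F y - F a) \<longlongrightarrow> (LINT x:{a..}|lborel. f x)) at_top"
    by (rule Lim_transform_eventually)
  from tendsto_add[OF tendsto_const[of "F a"] this] show ?thesis by simp
qed

section \<open>Analytic properties of \<open>Phi\<close>\<close>

lemma Phi_has_field_derivative:
  "(Phi has_field_derivative exp (- (z\<^sup>2) / 2) / complex_of_real (sqrt (2 * pi))) (at z)"
proof -
  have "(\<lambda>x::complex. exp (- (x\<^sup>2) / 2)) holomorphic_on UNIV"
    by (intro holomorphic_intros) auto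
  from holomorphic_convex_primitive'[OF convex_UNIV open_UNIV this]
  obtain g where g: "\<And>x::complex. (g has_field_derivative exp (- (x\<^sup>2) / 2)) (at x)"
    by auto
  have "contour_integral (linepath 0 w) (\<lambda>x. exp (- (x\<^sup>2) / 2)) = g w - g 0" for w
    by (rule contour_integral_unique)
       (use contour_integral_primitive[of UNIV g "\<lambda>x. exp (- (x\<^sup>2) / 2)" "linepath 0 w"] g in auto)
  then have Phi: "Phi = (\<lambda>w. 1 / 2 + complex_of_real (1 / sqrt (2 * pi)) * (g w - g 0))"
    by (simp add: Phi_def fun_eq_iff)
  show ?thesis unfolding Phi
    by (auto intro!: derivative_eq_intros g)
qed

lemma Phi_0: "Phi 0 = 1 / 2"
  by (simp add: Phi_def)

lemma holomorphic_Phi: "Phi holomorphic_on A"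
  using Phi_has_field_derivative DERIV_subset
  by (metis holomorphic_on_def field_differentiable_def field_differentiable_at_within)

lemma continuous_on_Phi [continuous_intros]:
  "continuous_on A f \<Longrightarrow> continuous_on A (\<lambda>x. Phi (f x))"
  using continuous_on_compose2[OF holomorphic_on_imp_continuous_on[OF holomorphic_Phi[of UNIV]]]
  by auto

lemma measurable_Phi [measurable]: "Phi \<in> borel_measurable borel"
  by (intro borel_measurable_continuous_onI continuous_intros)

lemma Phi_minus: "Phi (- z) = 1 - Phi z"
proof -
  have "((\<lambda>z. Phi z + Phi (- z)) has_field_derivative 0) (at z)" for z
    by (auto intro!: derivative_eq_intros DERIV_chain'[OF _ Phi_has_field_derivative])
  then obtain c where "\<And>z. Phi z + Phi (- z) = c"
    using has_field_derivative_zero_constant[of UNIV "\<lambda>z. Phi z + Phi (- z)"] by auto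
  then have "Phi z + Phi (- z) = Phi 0 + Phi (- 0)" by metis
  then show ?thesis by (simp add: Phi_0 algebra_simps)
qed

lemma integrable_exp_neg_half_square:
  "integrable lborel (\<lambda>v. exp (- ((complex_of_real v - z)\<^sup>2) / 2))"
proof (rule Bochner_Integration.integrable_bound)
  show "integrable lborel (\<lambda>v. (sqrt (2 * pi) * exp ((Im z)\<^sup>2 / 2)) * normal_density (Re z) 1 v)"
    by simp
  show "AE v in lborel. norm (exp (- ((complex_of_real v - z)\<^sup>2) / 2)) \<le>
     norm ((sqrt (2 * pi) * exp ((Im z)\<^sup>2 / 2)) * normal_density (Re z) 1 v)"
    by (subst norm_exp_neg_half_square) (simp add: normal_density_def)
qed simp

lemma integral_symmetrize:
  fixes f :: "real \<Rightarrow> 'b::{banach, second_countable_topology}"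
  assumes f: "integrable lborel f"
  shows "(\<integral>t. f t \<partial>lborel) = (LINT t:{0..}|lborel. f t + f (- t))"
proof -
  have i: "set_integrable lborel A f" if "A \<in> sets borel" for A
    unfolding set_integrable_def using that by (intro integrable_mult_indicator f) auto
  have f': "integrable lborel (\<lambda>t. f (- t))"
    using lborel_integrable_real_affine[OF f, of "-1" 0] by simp
  have i': "set_integrable lborel A (\<lambda>t. f (- t))" if "A \<in> sets borel" for A
    unfolding set_integrable_def using that by (intro integrable_mult_indicator f') auto
  have "(LINT t:{..0}|lborel. f t) = (LINT t:{0..}|lborel. f (- t))"
    unfolding set_lebesgue_integral_def
    by (subst lborel_integral_real_affine[of "-1" _ 0])
       (auto simp: indicator_def intro!: Bochner_Integration.integral_cong)
  moreover have "(LINT v:{0..} \<union> {..0}|lborel. f v) = (LINT v:{0..}|lborel. f v) + (LINT v:{..0}|lborel. f v)"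
  proof (intro set_integral_Un_AE i)
    have "AE x in lborel. x \<noteq> (0::real)" by (rule AE_lborel_singleton)
    then show "AE x in lborel. \<not> ((x::real) \<in> {0..} \<and> x \<in> {..0})" by eventually_elim auto
  qed auto
  moreover have "{0..} \<union> {..0} = (UNIV :: real set)" by auto
  ultimately show ?thesis
    using set_integral_add(2)[OF i i', of "{0..}"] by (simp add: set_lebesgue_integral_def)
qed

lemma half_normal_integral:
  "(LINT x:{0..}|lborel. std_normal_density x) = 1 / 2"
proof -
  have "1 = (LINT x:{0..}|lborel. std_normal_density x + std_normal_density (- x))"
    using integral_symmetrize[of std_normal_density] by simp
  also have "\<dots> = (LINT x:{0..}|lborel. 2 * std_normal_density x)"
    by (simp add: normal_density_def)
  finally show ?thesis by simp
qed

text \<open>On the real axis the limit is the mass of the normal law. The line at height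
  \<open>Im z\<close> is compared with the real axis along vertical segments of length
  \<open>\<bar>Im z\<bar>\<close>, on which the derivative of \<open>Phi\<close> is of order
  \<open>exp (- x\<^sup>2 / 2)\<close>.\<close>

lemma tendsto_Phi_at_top: "((\<lambda>x. Phi (z + complex_of_real x)) \<longlongrightarrow> 1) at_top"
proof -
  have real: "((\<lambda>x. Phi (complex_of_real x)) \<longlongrightarrow> 1) at_top"
  proof -
    let ?f = "\<lambda>x. complex_of_real (std_normal_density x)"
    have "((\<lambda>x. Phi (complex_of_real x)) has_vector_derivative ?f x) (at x)" for x
    proof -
      have "(Phi has_field_derivative ?f x) (at (complex_of_real x))"
        using Phi_has_field_derivative[of "complex_of_real x"]
        by (simp add: normal_density_def exp_of_real[symmetric])
      from has_vector_derivative_real_field[OF this] show ?thesis .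
    qed
    moreover have "set_integrable lborel {0..} ?f"
      unfolding set_integrable_def by (intro integrable_mult_indicator integrable_of_real) auto
    moreover have "continuous_on UNIV ?f" unfolding normal_density_def by (intro continuous_intros) auto
    ultimately have "((\<lambda>x. Phi (complex_of_real x)) \<longlongrightarrow> Phi (complex_of_real 0) + (LINT x:{0..}|lborel. ?f x)) at_top"
      by (intro tendsto_FTC_atLeast)
    also have "(LINT x:{0..}|lborel. ?f x) = complex_of_real (LINT x:{0..}|lborel. std_normal_density x)"
      unfolding set_lebesgue_integral_def
      by (subst integral_complex_of_real[symmetric]) (auto simp: scaleR_conv_of_real)
    finally show ?thesis by (simp add: Phi_0 half_normal_integral)
  qed
  define w where "w = \<i> * complex_of_real (Im z)"
  have diff: "norm (Phi (w + complex_of_real x) - Phi (complex_of_real x)) \<le> exp ((Im z)\<^sup>2 / 2) * exp (- x\<^sup>2 / 2) * \<bar>Im z\<bar>" for x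
  proof -
    have seg: "Re v = x \<and> (Im v)\<^sup>2 \<le> (Im z)\<^sup>2" if "v \<in> closed_segment (complex_of_real x) (w + complex_of_real x)" for v
    proof -
      from that obtain u where u: "0 \<le> u" "u \<le> 1" "v = (1 - u) *\<^sub>R complex_of_real x + u *\<^sub>R (w + complex_of_real x)"
        by (auto simp: in_segment)
      have "Re v = x" "Im v = u * Im z" using u by (auto simp: w_def algebra_simps)
      moreover have "(u * Im z)\<^sup>2 \<le> 1 * (Im z)\<^sup>2"
        unfolding power_mult_distrib using u by (intro mult_right_mono) (auto simp: power_le_one)
      ultimately show ?thesis by simp
    qed
    have "norm (Phi (w + complex_of_real x) - Phi (complex_of_real x)) \<le> (exp ((Im z)\<^sup>2 / 2) * exp (- x\<^sup>2 / 2)) * norm (w + complex_of_real x - complex_of_real x)"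
    proof (rule field_differentiable_bound[OF convex_closed_segment[of "complex_of_real x" "w + complex_of_real x"]])
      show "(Phi has_field_derivative exp (- (v\<^sup>2) / 2) / complex_of_real (sqrt (2 * pi))) (at v within closed_segment (complex_of_real x) (w + complex_of_real x))" for v
        by (intro DERIV_subset[OF Phi_has_field_derivative]) auto
      fix v assume v: "v \<in> closed_segment (complex_of_real x) (w + complex_of_real x)"
      have "1 \<le> 2 * pi" using pi_gt3 by simp
      then have "1 \<le> sqrt (2 * pi)" by simp
      then have "norm (exp (- (v\<^sup>2) / 2) / complex_of_real (sqrt (2 * pi))) \<le> norm (exp (- (v\<^sup>2) / 2))"
        unfolding norm_divide by (simp add: divide_le_eq mult_le_cancel_left1)
      also have "\<dots> \<le> exp ((Im z)\<^sup>2 / 2) * exp (- x\<^sup>2 / 2)"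
        unfolding norm_exp_neg_half_square using seg[OF v] by auto
      finally show "norm (exp (- (v\<^sup>2) / 2) / complex_of_real (sqrt (2 * pi))) \<le> exp ((Im z)\<^sup>2 / 2) * exp (- x\<^sup>2 / 2)" .
    qed auto
    also have "norm (w + complex_of_real x - complex_of_real x) = \<bar>Im z\<bar>" by (simp add: w_def norm_mult)
    finally show ?thesis .
  qed
  have "((\<lambda>x::real. exp ((Im z)\<^sup>2 / 2) * exp (- x\<^sup>2 / 2) * \<bar>Im z\<bar>) \<longlongrightarrow> 0) at_top"
    by real_asymp
  then have "((\<lambda>x. Phi (w + complex_of_real x) - Phi (complex_of_real x)) \<longlongrightarrow> 0) at_top"
    by (rule Lim_null_comparison[rotated]) (use diff in auto)
  from tendsto_add[OF this real] have "((\<lambda>x. Phi (w + complex_of_real x)) \<longlongrightarrow> 1) at_top" by simp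
  moreover have "filterlim (\<lambda>x. Re z + x) at_top at_top" by real_asymp
  ultimately have "((\<lambda>x. Phi (w + complex_of_real (Re z + x))) \<longlongrightarrow> 1) at_top"
    by (rule filterlim_compose)
  moreover have "(\<lambda>x. w + complex_of_real (Re z + x)) = (\<lambda>x. z + complex_of_real x)"
    by (simp add: w_def complex_eq_iff fun_eq_iff)
  ultimately show ?thesis by metis
qed

text \<open>A primitive of the integrand is \<open>sqrt (2 * pi) * Phi (v - z)\<close>, with limit
  \<open>sqrt (2 * pi)\<close>. The variable now enters as a shift of a real integral over a fixed
  half-line, which gives the conjugation rule and the norm bounds below.\<close>

lemma Phi_eq_integral:
  "Phi z = (LINT v:{0..}|lborel. exp (- ((complex_of_real v - z)\<^sup>2) / 2)) / complex_of_real (sqrt (2 * pi))"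
proof -
  let ?f = "\<lambda>v. exp (- ((complex_of_real v - z)\<^sup>2) / 2)"
  let ?F = "\<lambda>v. complex_of_real (sqrt (2 * pi)) * Phi (- z + complex_of_real v)"
  have "(?F has_vector_derivative ?f v) (at v)" for v
  proof -
    have "((\<lambda>v. complex_of_real (sqrt (2 * pi)) * Phi (- z + v)) has_field_derivative ?f v) (at (complex_of_real v))"
      by (auto intro!: derivative_eq_intros DERIV_chain'[OF _ Phi_has_field_derivative])
    from has_vector_derivative_real_field[OF this] show ?thesis .
  qed
  moreover have "set_integrable lborel {0..} ?f"
    unfolding set_integrable_def by (intro integrable_mult_indicator integrable_exp_neg_half_square) auto
  moreover have "continuous_on UNIV ?f" by (intro continuous_intros) auto
  ultimately have "(?F \<longlongrightarrow> ?F 0 + (LINT v:{0..}|lborel. ?f v)) at_top"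
    by (intro tendsto_FTC_atLeast)
  moreover have "(?F \<longlongrightarrow> complex_of_real (sqrt (2 * pi)) * 1) at_top"
    by (intro tendsto_mult tendsto_const tendsto_Phi_at_top)
  ultimately have "?F 0 + (LINT v:{0..}|lborel. ?f v) = complex_of_real (sqrt (2 * pi)) * 1"
    by (rule tendsto_unique[rotated]) auto
  then show ?thesis by (simp add: Phi_minus field_simps)
qed

lemma cnj_Phi: "cnj (Phi z) = Phi (cnj z)"
  unfolding Phi_eq_integral complex_cnj_divide set_lebesgue_integral_def
  by (subst Bochner_Integration.integral_cnj[symmetric]) (simp add: exp_cnj)

lemma norm_Phi_le: "norm (Phi z) \<le> exp ((Im z)\<^sup>2 / 2)"
proof -
  let ?f = "\<lambda>v. exp (- ((complex_of_real v - z)\<^sup>2) / 2)"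
  have "norm (LINT v:{0..}|lborel. ?f v) \<le> (\<integral>v. norm (indicat_real {0..} v *\<^sub>R ?f v) \<partial>lborel)"
    unfolding set_lebesgue_integral_def by (rule integral_norm_bound)
  also have "\<dots> \<le> (\<integral>v. norm (?f v) \<partial>lborel)"
    by (intro integral_mono integrable_norm integrable_mult_indicator integrable_exp_neg_half_square)
       (auto split: split_indicator)
  also have "\<dots> = (\<integral>v. (sqrt (2 * pi) * exp ((Im z)\<^sup>2 / 2)) * normal_density (Re z) 1 v \<partial>lborel)"
    by (subst norm_exp_neg_half_square) (simp add: normal_density_def)
  also have "\<dots> = sqrt (2 * pi) * exp ((Im z)\<^sup>2 / 2)" by simp
  finally show ?thesis
    by (subst Phi_eq_integral) (simp add: norm_divide field_simps)
qed

text \<open>For nonnegative \<open>v\<close> and \<open>x\<close> the square of \<open>v + x\<close>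
  is at least \<open>v\<^sup>2 + x\<^sup>2\<close>, so the factor
  \<open>exp (- x\<^sup>2 / 2)\<close> can be taken out. This decay is what makes the second
  integral in formula (ii) converge.\<close>

lemma norm_Phi_tail:
  assumes "x \<ge> 0"
  shows "norm (Phi (- complex_of_real x)) \<le> exp (- x\<^sup>2 / 2)"
proof -
  let ?f = "\<lambda>v. exp (- ((complex_of_real v - - complex_of_real x)\<^sup>2) / 2)"
  have "norm (LINT v:{0..}|lborel. ?f v) \<le> (\<integral>v. norm (indicat_real {0..} v *\<^sub>R ?f v) \<partial>lborel)"
    unfolding set_lebesgue_integral_def by (rule integral_norm_bound)
  also have "\<dots> \<le> (\<integral>v. (sqrt (2 * pi) * exp (- x\<^sup>2 / 2)) * std_normal_density v \<partial>lborel)"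
  proof (intro integral_mono integrable_norm integrable_mult_indicator integrable_exp_neg_half_square)
    fix v :: real
    have "exp (- (v + x)\<^sup>2 / 2) \<le> exp (- x\<^sup>2 / 2) * exp (- v\<^sup>2 / 2)" if "v \<ge> 0"
      unfolding exp_add[symmetric] using that assms by (simp add: power2_eq_square field_simps)
    then show "norm (indicat_real {0..} v *\<^sub>R ?f v) \<le> (sqrt (2 * pi) * exp (- x\<^sup>2 / 2)) * std_normal_density v"
      unfolding norm_scaleR norm_exp_neg_half_square by (auto simp: normal_density_def split: split_indicator)
  qed auto
  also have "\<dots> = sqrt (2 * pi) * exp (- x\<^sup>2 / 2)" by simp
  finally show ?thesis
    by (subst Phi_eq_integral) (simp add: norm_divide field_simps)
qed

text \<open>Splitting the line at 0 gives the halves \<open>Phi z\<close> and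
  \<open>Phi (- z)\<close>, so the independence of the complex mean is the reflection formula for
  \<open>Phi\<close>.\<close>

lemma complex_gaussian_integral:
  "(\<integral>v. exp (- ((complex_of_real v - z)\<^sup>2) / 2) \<partial>lborel) = complex_of_real (sqrt (2 * pi))"
proof -
  let ?f = "\<lambda>z v. exp (- ((complex_of_real v - z)\<^sup>2) / 2)"
  have i: "set_integrable lborel {0..} (?f z)" for z
    unfolding set_integrable_def by (intro integrable_mult_indicator integrable_exp_neg_half_square) auto
  have "?f z (- v) = ?f (- z) v" for v
    by (simp add: power2_eq_square algebra_simps)
  then have "(\<integral>v. ?f z v \<partial>lborel) = (LINT v:{0..}|lborel. ?f z v) + (LINT v:{0..}|lborel. ?f (- z) v)"
    using integral_symmetrize[OF integrable_exp_neg_half_square[of z]] set_integral_add(2)[OF i[of z] i[of "- z"]]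
    by (simp only:)
  also have "\<dots> = complex_of_real (sqrt (2 * pi)) * (Phi z + Phi (- z))"
    by (simp add: Phi_eq_integral field_simps)
  finally show ?thesis by (simp add: Phi_minus)
qed

section \<open>Normal densities with complex mean\<close>

text \<open>The normal density of variance \<open>1 / lam\<close> and mean \<open>c\<close>,
  continued to complex \<open>c\<close>. It still integrates to 1, but its norm integrates to
  \<open>exp (lam * (Im c)\<^sup>2 / 2)\<close>.\<close>

definition shifted_gauss :: "real \<Rightarrow> complex \<Rightarrow> real \<Rightarrow> complex" where
  "shifted_gauss lam c y = complex_of_real (sqrt (lam / (2 * pi))) * exp (- (complex_of_real lam * (complex_of_real y - c)\<^sup>2) / 2)"

context fixes lam :: real assumes lam: "lam > 0"
begin

lemma shifted_gauss_eq:
  "shifted_gauss lam c y = complex_of_real (sqrt (lam / (2 * pi))) * exp (- ((complex_of_real (sqrt lam * y) - complex_of_real (sqrt lam) * c)\<^sup>2) / 2)"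
proof -
  have "(complex_of_real (sqrt lam * y) - complex_of_real (sqrt lam) * c)\<^sup>2 = (complex_of_real (sqrt lam))\<^sup>2 * (complex_of_real y - c)\<^sup>2"
    by (simp add: power_mult_distrib[symmetric] algebra_simps)
  also have "(complex_of_real (sqrt lam))\<^sup>2 = complex_of_real lam"
    using lam by (simp flip: of_real_power)
  finally show ?thesis by (simp add: shifted_gauss_def)
qed

lemma norm_shifted_gauss:
  "norm (shifted_gauss lam c y) = exp (lam * (Im c)\<^sup>2 / 2) * normal_density (Re c) (1 / sqrt lam) y"
proof -
  have "(Re (complex_of_real (sqrt lam * y) - complex_of_real (sqrt lam) * c))\<^sup>2 = lam * (y - Re c)\<^sup>2"
    "(Im (complex_of_real (sqrt lam * y) - complex_of_real (sqrt lam) * c))\<^sup>2 = lam * (Im c)\<^sup>2"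
    using lam by (simp_all add: power_mult_distrib flip: right_diff_distrib)
  moreover have "norm (complex_of_real (sqrt (lam / (2 * pi)))) = sqrt (lam / (2 * pi))"
    unfolding norm_of_real using lam by simp
  moreover have "1 / sqrt (2 * pi * (1 / sqrt lam)\<^sup>2) = sqrt (lam / (2 * pi))"
    using lam by (simp add: power_divide real_sqrt_mult real_sqrt_divide)
  ultimately show ?thesis
    unfolding shifted_gauss_eq norm_mult norm_exp_neg_half_square normal_density_def
    using lam by (simp add: power_divide mult_ac)
qed

lemma integrable_shifted_gauss: "integrable lborel (shifted_gauss lam c)"
proof (rule Bochner_Integration.integrable_bound)
  show "integrable lborel (\<lambda>y. exp (lam * (Im c)\<^sup>2 / 2) * normal_density (Re c) (1 / sqrt lam) y)"
    using lam by simp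
  show "shifted_gauss lam c \<in> borel_measurable lborel" unfolding shifted_gauss_def by simp
qed (simp add: norm_shifted_gauss)

lemma integral_atMost_shifted_gauss:
  "(LINT y:{..s}|lborel. shifted_gauss lam c y) = Phi (complex_of_real (sqrt lam) * (complex_of_real s - c))"
proof -
  have "(LINT y:{..s}|lborel. shifted_gauss lam c y) = (\<integral>y. indicator {..s} (s + (- 1 / sqrt lam) * y) *\<^sub>R shifted_gauss lam c (s + (- 1 / sqrt lam) * y) \<partial>lborel) / sqrt lam"
    unfolding set_lebesgue_integral_def
    using lam by (subst lborel_integral_real_affine[of "- 1 / sqrt lam" _ s]) (auto simp: scaleR_conv_of_real)
  also have "(\<lambda>y. indicator {..s} (s + (- 1 / sqrt lam) * y) *\<^sub>R shifted_gauss lam c (s + (- 1 / sqrt lam) * y)) =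
     (\<lambda>y. complex_of_real (sqrt (lam / (2 * pi))) * (indicat_real {0..} y *\<^sub>R exp (- ((complex_of_real y - complex_of_real (sqrt lam) * (complex_of_real s - c))\<^sup>2) / 2)))"
  proof
    fix y
    have "(complex_of_real (sqrt lam * (s + (- 1 / sqrt lam) * y)) - complex_of_real (sqrt lam) * c)\<^sup>2 = (complex_of_real y - complex_of_real (sqrt lam) * (complex_of_real s - c))\<^sup>2"
    proof -
      have "complex_of_real (sqrt lam * (s + (- 1 / sqrt lam) * y)) - complex_of_real (sqrt lam) * c = - (complex_of_real y - complex_of_real (sqrt lam) * (complex_of_real s - c))"
        using lam by (simp add: complex_eq_iff algebra_simps)
      then show ?thesis by (simp only: power2_minus)
    qed
    then show "indicator {..s} (s + (- 1 / sqrt lam) * y) *\<^sub>R shifted_gauss lam c (s + (- 1 / sqrt lam) * y) = complex_of_real (sqrt (lam / (2 * pi))) * (indicat_real {0..} y *\<^sub>R exp (- ((complex_of_real y - complex_of_real (sqrt lam) * (complex_of_real s - c))\<^sup>2) / 2))"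
      using lam by (auto simp: shifted_gauss_eq indicator_def divide_le_0_iff zero_le_divide_iff)
  qed
  finally show ?thesis
    unfolding integral_mult_right_zero Phi_eq_integral set_lebesgue_integral_def
    using lam by (simp add: real_sqrt_divide real_sqrt_mult)
qed

text \<open>Completing the square: an exponential factor moves the mean by \<open>b / lam\<close>.
  Moments of exponentials thereby reduce to the total integral, even for complex mean and
  exponent.\<close>

lemma shifted_gauss_mult_exp:
  "exp (b * complex_of_real y) * shifted_gauss lam c y =
     exp (b * c + b\<^sup>2 / (2 * complex_of_real lam)) * shifted_gauss lam (c + b / complex_of_real lam) y"
proof -
  have "exp (b * complex_of_real y) * exp (- (complex_of_real lam * (complex_of_real y - c)\<^sup>2) / 2) =
     exp (b * c + b\<^sup>2 / (2 * complex_of_real lam)) * exp (- (complex_of_real lam * (complex_of_real y - (c + b / complex_of_real lam))\<^sup>2) / 2)"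
    unfolding exp_add[symmetric] using lam by (intro arg_cong[where f=exp]) (simp add: field_simps power2_eq_square)
  then show ?thesis by (simp add: shifted_gauss_def mult_ac)
qed

lemma integral_shifted_gauss: "(\<integral>y. shifted_gauss lam c y \<partial>lborel) = 1"
proof -
  have "(\<integral>y. shifted_gauss lam c y \<partial>lborel) = (\<integral>y. shifted_gauss lam c (0 + (1 / sqrt lam) * y) \<partial>lborel) / sqrt lam"
    using lam by (subst lborel_integral_real_affine[of "1 / sqrt lam" _ 0]) (auto simp: scaleR_conv_of_real)
  also have "\<dots> = (\<integral>y. complex_of_real (sqrt (lam / (2 * pi))) * exp (- ((complex_of_real y - complex_of_real (sqrt lam) * c)\<^sup>2) / 2) \<partial>lborel) / sqrt lam"
    using lam by (simp add: shifted_gauss_eq)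
  also have "\<dots> = 1"
    unfolding integral_mult_right_zero complex_gaussian_integral
    using lam by (simp add: real_sqrt_divide)
  finally show ?thesis .
qed

lemma exp_shifted_gauss:
  "integrable lborel (\<lambda>y. exp (b * complex_of_real y) * shifted_gauss lam c y)"
  "(\<integral>y. exp (b * complex_of_real y) * shifted_gauss lam c y \<partial>lborel) = exp (b * c + b\<^sup>2 / (2 * complex_of_real lam))"
  by (simp_all add: shifted_gauss_mult_exp integrable_shifted_gauss integral_shifted_gauss)

end

section \<open>Gaussian laws as complex mixtures\<close>

text \<open>Expanding the squares separates a factor in \<open>y\<close> alone from one linear and
  one quadratic exponential in \<open>c\<close>. For \<open>c = \<kappa> * \<xi>\<close> the last
  two are again Gaussian in \<xi>.\<close>

lemma prod_shifted_gauss: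
  assumes "finite I" "\<And>i. i \<in> I \<Longrightarrow> lam i > 0"
  shows "(\<Prod>i\<in>I. shifted_gauss (lam i) c (y i)) =
    complex_of_real ((\<Prod>i\<in>I. sqrt (lam i / (2 * pi))) * exp (- (\<Sum>i\<in>I. lam i * (y i)\<^sup>2) / 2)) *
      exp (c * complex_of_real (\<Sum>i\<in>I. lam i * y i)) * exp (- (complex_of_real (\<Sum>i\<in>I. lam i) * c\<^sup>2) / 2)"
proof -
  have "(\<Prod>i\<in>I. shifted_gauss (lam i) c (y i)) =
    (\<Prod>i\<in>I. complex_of_real (sqrt (lam i / (2 * pi)))) *
    exp (\<Sum>i\<in>I. - (complex_of_real (lam i) * (complex_of_real (y i) - c)\<^sup>2) / 2)"
    unfolding shifted_gauss_def prod.distrib exp_sum[OF assms(1)] by simp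
  also have "(\<Sum>i\<in>I. - (complex_of_real (lam i) * (complex_of_real (y i) - c)\<^sup>2) / 2) =
    (\<Sum>i\<in>I. complex_of_real (- (lam i * (y i)\<^sup>2) / 2) + c * complex_of_real (lam i * y i) - complex_of_real (lam i) * c\<^sup>2 / 2)"
    by (intro sum.cong refl) (simp add: power2_eq_square field_simps)
  also have "\<dots> = complex_of_real (- (\<Sum>i\<in>I. lam i * (y i)\<^sup>2) / 2) + c * complex_of_real (\<Sum>i\<in>I. lam i * y i)
      - complex_of_real (\<Sum>i\<in>I. lam i) * c\<^sup>2 / 2"
    by (simp add: sum.distrib sum_subtractf sum_distrib_left sum_distrib_right sum_divide_distrib sum_negf)
  finally show ?thesis
    by (simp only: diff_conv_add_uminus exp_add exp_of_real of_real_mult of_real_prod mult.assoc minus_divide_left)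
qed

lemma shifted_gauss_0: "r > 0 \<Longrightarrow> shifted_gauss r 0 y = complex_of_real (sqrt r) * (complex_of_real (std_normal_density y) * exp (- (complex_of_real ((r - 1) * y\<^sup>2) / 2)))"
proof -
  assume r: "r > 0"
  have "shifted_gauss r 0 y = complex_of_real (sqrt (r / (2 * pi)) * exp (- (r * y\<^sup>2) / 2))"
    by (simp add: shifted_gauss_def exp_of_real[symmetric])
  also have "sqrt (r / (2 * pi)) * exp (- (r * y\<^sup>2) / 2) = sqrt r * (std_normal_density y * exp (- ((r - 1) * y\<^sup>2 / 2)))"
    by (simp add: normal_density_def real_sqrt_divide exp_add[symmetric] field_simps)
  finally show ?thesis by (simp add: exp_of_real[symmetric])
qed

lemma shifted_gauss_1_0: "shifted_gauss 1 0 y = complex_of_real (std_normal_density y)"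
  by (simp add: shifted_gauss_0)

text \<open>The value of \<open>1 / sqrt b\<close> under the convention of
  \<open>sqrt_quot\<close>.\<close>

definition csqrt_inv :: "real \<Rightarrow> complex" where
  "csqrt_inv b = (if b > 0 then complex_of_real (1 / sqrt b) else 1 / (\<i> * complex_of_real (sqrt (- b))))"

lemma csqrt_inv_square: "b \<noteq> 0 \<Longrightarrow> (csqrt_inv b)\<^sup>2 = complex_of_real (1 / b)"
  by (auto simp: csqrt_inv_def power_divide power_mult_distrib simp flip: of_real_power)

lemma Im_csqrt_inv_square: "b \<noteq> 0 \<Longrightarrow> (Im (csqrt_inv b))\<^sup>2 = (if b > 0 then 0 else 1 / - b)"
  by (auto simp: csqrt_inv_def power_divide Im_divide power2_eq_square field_simps simp flip: real_sqrt_mult)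

lemma integrable_std_normal_exp:
  "b < 1 \<Longrightarrow> integrable lborel (\<lambda>\<xi>. std_normal_density \<xi> * exp (b * \<xi>\<^sup>2 / 2))"
proof -
  assume b: "b < 1"
  have "(\<lambda>\<xi>. std_normal_density \<xi> * exp (b * \<xi>\<^sup>2 / 2)) = (\<lambda>\<xi>. (1 / sqrt (1 - b)) * normal_density 0 (1 / sqrt (1 - b)) \<xi>)"
    using b by (auto simp: fun_eq_iff normal_density_def exp_add[symmetric] power_divide real_sqrt_divide real_sqrt_mult field_simps)
  then show ?thesis using b by simp
qed

locale gauss_mixture =
  fixes I :: "'i set" and lam0 :: real and lam :: "'i \<Rightarrow> real"
  assumes finI: "finite I" and lam: "\<And>i. i \<in> I \<Longrightarrow> lam i > 0"
    and lam0: "lam0 > 0 \<or> lam0 < - (\<Sum>i\<in>I. lam i)"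
begin

definition "Lam = (\<Sum>i\<in>I. lam i)"
definition "\<kappa> = csqrt_inv lam0"
text \<open>The precision of \<xi> after the quadratic factor of the product of densities has been
  absorbed into the standard normal density. It is also the factor by which the determinant of the
  covariance matrix differs from that of its diagonal part.\<close>

definition "\<rho> = (lam0 + Lam) / lam0"

abbreviation "\<nu> \<equiv> PiM I (\<lambda>_. lborel :: real measure)"

text \<open>The centered normal density with covariance
  \<open>1 / lam0 + \<delta>\<^sub>i\<^sub>j / lam i\<close>: by the Sherman-Morrison formula the
  inverse matrix has entries \<open>lam i * \<delta>\<^sub>i\<^sub>j - lam i * lam j / (lam0 +
  Lam)\<close>.\<close>

definition dens :: "('i \<Rightarrow> real) \<Rightarrow> real" where
  "dens y = (1 / sqrt \<rho>) * (\<Prod>i\<in>I. sqrt (lam i / (2 * pi))) * exp (- (\<Sum>i\<in>I. lam i * (y i)\<^sup>2) / 2)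
     * exp ((\<Sum>i\<in>I. lam i * y i)\<^sup>2 / (2 * (lam0 + Lam)))"

definition law :: "('i \<Rightarrow> real) measure" where
  "law = density \<nu> (\<lambda>y. ennreal (dens y))"

lemma Lam_nonneg: "Lam \<ge> 0"
  unfolding Lam_def using lam by (intro sum_nonneg) (auto intro: less_imp_le)

lemma lam0_nz: "lam0 \<noteq> 0" "lam0 + Lam \<noteq> 0"
  using lam0 Lam_nonneg by (auto simp: Lam_def)

lemma rho_pos: "\<rho> > 0"
  using lam0 Lam_nonneg unfolding \<rho>_def Lam_def by (auto simp: zero_less_divide_iff)

lemma kappa_square: "\<kappa>\<^sup>2 = complex_of_real (1 / lam0)"
  unfolding \<kappa>_def by (rule csqrt_inv_square[OF lam0_nz(1)])

text \<open>The integrability condition of the mixture: the absolute integrals of the factors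
  multiply to \<open>exp (Lam * (Im \<kappa>)\<^sup>2 * \<xi>\<^sup>2 / 2)\<close>, which has to
  lose against the standard normal density.\<close>

lemma Lam_Im_kappa: "Lam * (Im \<kappa>)\<^sup>2 < 1"
  using lam0 Lam_nonneg unfolding \<kappa>_def Im_csqrt_inv_square[OF lam0_nz(1)]
  by (auto simp: Lam_def field_simps)

lemma dens_nonneg: "dens y \<ge> 0"
  unfolding dens_def using rho_pos lam by (intro mult_nonneg_nonneg prod_nonneg) (auto intro: less_imp_le)

lemma measurable_dens [measurable]: "dens \<in> borel_measurable \<nu>"
  unfolding dens_def by measurable

text \<open>For fixed \<open>y\<close> this is the integral of
  \<open>exp (\<kappa> * S * \<xi>)\<close> against a normal density of precision \<rho>. Only
  \<open>\<kappa>\<^sup>2 / \<rho> = 1 / (lam0 + Lam)\<close> survives, so the result is real even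
  when \<kappa> is imaginary.\<close>

lemma mixture_dens:
  "integrable lborel (\<lambda>\<xi>. complex_of_real (std_normal_density \<xi>) * (\<Prod>i\<in>I. shifted_gauss (lam i) (\<kappa> * complex_of_real \<xi>) (y i)))"
  "(\<integral>\<xi>. complex_of_real (std_normal_density \<xi>) * (\<Prod>i\<in>I. shifted_gauss (lam i) (\<kappa> * complex_of_real \<xi>) (y i)) \<partial>lborel) = complex_of_real (dens y)"
proof -
  define C where "C = complex_of_real ((\<Prod>i\<in>I. sqrt (lam i / (2 * pi))) * exp (- (\<Sum>i\<in>I. lam i * (y i)\<^sup>2) / 2))"
  define S where "S = (\<Sum>i\<in>I. lam i * y i)"
  have eq: "complex_of_real (std_normal_density \<xi>) * (\<Prod>i\<in>I. shifted_gauss (lam i) (\<kappa> * complex_of_real \<xi>) (y i)) =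
     C / complex_of_real (sqrt \<rho>) * (exp ((\<kappa> * complex_of_real S) * complex_of_real \<xi>) * shifted_gauss \<rho> 0 \<xi>)" for \<xi>
  proof -
    have "exp (- (complex_of_real Lam * (\<kappa> * complex_of_real \<xi>)\<^sup>2) / 2) = exp (- (complex_of_real ((\<rho> - 1) * \<xi>\<^sup>2) / 2))"
      using lam0_nz unfolding power_mult_distrib kappa_square \<rho>_def by (simp add: field_simps)
    moreover have "(\<Prod>i\<in>I. shifted_gauss (lam i) (\<kappa> * complex_of_real \<xi>) (y i)) =
      C * exp (\<kappa> * complex_of_real \<xi> * complex_of_real S) * exp (- (complex_of_real Lam * (\<kappa> * complex_of_real \<xi>)\<^sup>2) / 2)"
      unfolding C_def S_def Lam_def by (rule prod_shifted_gauss[OF finI lam])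
    ultimately show ?thesis
      unfolding shifted_gauss_0[OF rho_pos] using rho_pos by (simp add: mult_ac)
  qed
  show "integrable lborel (\<lambda>\<xi>. complex_of_real (std_normal_density \<xi>) * (\<Prod>i\<in>I. shifted_gauss (lam i) (\<kappa> * complex_of_real \<xi>) (y i)))"
    unfolding eq by (intro integrable_mult_right exp_shifted_gauss rho_pos)
  have "(\<kappa> * complex_of_real S)\<^sup>2 / (2 * complex_of_real \<rho>) = complex_of_real (S\<^sup>2 / (2 * (lam0 + Lam)))"
    using lam0_nz unfolding power_mult_distrib kappa_square \<rho>_def by (simp add: field_simps)
  then have E: "exp (\<kappa> * complex_of_real S * 0 + (\<kappa> * complex_of_real S)\<^sup>2 / (2 * complex_of_real \<rho>)) =
      complex_of_real (exp (S\<^sup>2 / (2 * (lam0 + Lam))))"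
    by (simp only: mult_zero_right add_0_left exp_of_real)
  show "(\<integral>\<xi>. complex_of_real (std_normal_density \<xi>) * (\<Prod>i\<in>I. shifted_gauss (lam i) (\<kappa> * complex_of_real \<xi>) (y i)) \<partial>lborel) = complex_of_real (dens y)"
    unfolding eq integral_mult_right_zero exp_shifted_gauss(2)[OF rho_pos] E
    by (simp add: dens_def C_def S_def)
qed

context
  fixes h :: "'i \<Rightarrow> real \<Rightarrow> complex"
  assumes h [measurable]: "\<And>i. h i \<in> borel_measurable borel" and h1: "\<And>i x. norm (h i x) \<le> 1"
begin

interpretation P: product_sigma_finite "\<lambda>_::'i. lborel :: real measure"
  by standard
interpretation sigma_finite_measure \<nu>
  by (rule P.sigma_finite[OF finI])
interpretation Q: pair_sigma_finite "lborel :: real measure" \<nu>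
  by standard

lemma integrable_h_gauss: "i \<in> I \<Longrightarrow> integrable lborel (\<lambda>y. h i y * shifted_gauss (lam i) c y)"
  by (rule Bochner_Integration.integrable_bound[OF integrable_shifted_gauss[OF lam, of i c]])
     (auto simp: norm_mult shifted_gauss_def intro!: mult_left_le_one_le h1)

lemma integrable_mixture:
  "integrable (lborel \<Otimes>\<^sub>M \<nu>) (\<lambda>(\<xi>, y). complex_of_real (std_normal_density \<xi>) *
     (\<Prod>i\<in>I. h i (y i) * shifted_gauss (lam i) (\<kappa> * complex_of_real \<xi>) (y i)))"
proof (rule Q.Fubini_integrable)
  let ?f = "\<lambda>\<xi> y. complex_of_real (std_normal_density \<xi>) *
     (\<Prod>i\<in>I. h i (y i) * shifted_gauss (lam i) (\<kappa> * complex_of_real \<xi>) (y i))"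
  have [measurable]: "(\<lambda>p. snd p i) \<in> borel_measurable (lborel \<Otimes>\<^sub>M \<nu>)" if "i \<in> I" for i
    by (rule measurable_compose[OF measurable_snd])
       (use measurable_component_singleton[OF that, of "\<lambda>_. lborel"] in simp)
  have [measurable]: "(\<lambda>p. shifted_gauss (lam i) (\<kappa> * complex_of_real (fst p)) (snd p i)) \<in> borel_measurable (lborel \<Otimes>\<^sub>M \<nu>)"
    if [measurable]: "i \<in> I" for i
    unfolding shifted_gauss_def by measurable
  show meas [measurable]: "(\<lambda>(\<xi>, y). ?f \<xi> y) \<in> borel_measurable (lborel \<Otimes>\<^sub>M \<nu>)"
    unfolding split_beta
    by (intro borel_measurable_times borel_measurable_of_real borel_measurable_prod) measurable
  have i: "integrable \<nu> (?f \<xi>)" for \<xi>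
    by (intro integrable_mult_right P.product_integrable_prod finI integrable_h_gauss)
  then show "AE \<xi> in lborel. integrable \<nu> (\<lambda>y. case (\<xi>, y) of (\<xi>, y) \<Rightarrow> ?f \<xi> y)" by simp
  \<comment> \<open>Since the test functions have norm at most 1, each coordinate costs at most the
    absolute integral of its complex density.\<close>
  have bound: "(\<integral>y. norm (?f \<xi> y) \<partial>\<nu>) \<le> std_normal_density \<xi> * exp ((Lam * (Im \<kappa>)\<^sup>2) * \<xi>\<^sup>2 / 2)" for \<xi>
  proof -
    have "(\<integral>y. norm (?f \<xi> y) \<partial>\<nu>) = (\<integral>y. std_normal_density \<xi> * (\<Prod>i\<in>I. norm (h i (y i) * shifted_gauss (lam i) (\<kappa> * complex_of_real \<xi>) (y i))) \<partial>\<nu>)"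
      by (simp add: norm_mult prod_norm[symmetric])
    also have "\<dots> = std_normal_density \<xi> * (\<Prod>i\<in>I. \<integral>x. norm (h i x * shifted_gauss (lam i) (\<kappa> * complex_of_real \<xi>) x) \<partial>lborel)"
      by (subst P.product_integral_prod[symmetric]) (auto intro!: finI integrable_norm integrable_h_gauss)
    also have "\<dots> \<le> std_normal_density \<xi> * (\<Prod>i\<in>I. exp (lam i * (Im (\<kappa> * complex_of_real \<xi>))\<^sup>2 / 2))"
    proof (intro mult_left_mono prod_mono conjI)
      fix i assume i: "i \<in> I"
      have "(\<integral>x. norm (h i x * shifted_gauss (lam i) (\<kappa> * complex_of_real \<xi>) x) \<partial>lborel) \<le>
        (\<integral>x. norm (shifted_gauss (lam i) (\<kappa> * complex_of_real \<xi>) x) \<partial>lborel)"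
        using i by (intro integral_mono integrable_norm integrable_h_gauss integrable_shifted_gauss lam)
          (auto simp: norm_mult intro!: mult_left_le_one_le h1)
      also have "\<dots> = exp (lam i * (Im (\<kappa> * complex_of_real \<xi>))\<^sup>2 / 2)"
        using lam[OF i] by (simp add: norm_shifted_gauss)
      finally show "(\<integral>x. norm (h i x * shifted_gauss (lam i) (\<kappa> * complex_of_real \<xi>) x) \<partial>lborel) \<le> exp (lam i * (Im (\<kappa> * complex_of_real \<xi>))\<^sup>2 / 2)" .
    qed auto
    also have "(\<Prod>i\<in>I. exp (lam i * (Im (\<kappa> * complex_of_real \<xi>))\<^sup>2 / 2)) = exp ((Lam * (Im \<kappa>)\<^sup>2) * \<xi>\<^sup>2 / 2)"
    proof -
      have "(\<Sum>i\<in>I. lam i * (Im (\<kappa> * complex_of_real \<xi>))\<^sup>2 / 2) = Lam * (Im (\<kappa> * complex_of_real \<xi>))\<^sup>2 / 2"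
        by (simp only: Lam_def sum_distrib_right sum_divide_distrib)
      then show ?thesis
        unfolding exp_sum[OF finI, symmetric] by (simp add: power_mult_distrib mult_ac)
    qed
    finally show ?thesis .
  qed
  show "integrable lborel (\<lambda>\<xi>. \<integral>y. norm (case (\<xi>, y) of (\<xi>, y) \<Rightarrow> ?f \<xi> y) \<partial>\<nu>)"
  proof (rule Bochner_Integration.integrable_bound[OF integrable_std_normal_exp[OF Lam_Im_kappa]])
    show "(\<lambda>\<xi>. \<integral>y. norm (case (\<xi>, y) of (\<xi>, y) \<Rightarrow> ?f \<xi> y) \<partial>\<nu>) \<in> borel_measurable lborel"
      by measurable
    show "AE \<xi> in lborel. norm (\<integral>y. norm (case (\<xi>, y) of (\<xi>, y) \<Rightarrow> ?f \<xi> y) \<partial>\<nu>) \<le> norm (std_normal_density \<xi> * exp ((Lam * (Im \<kappa>)\<^sup>2) * \<xi>\<^sup>2 / 2))"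
      using bound by (auto simp: abs_of_nonneg[OF Bochner_Integration.integral_nonneg])
  qed
qed

text \<open>Integrating over \<xi> first yields the density, integrating over \<open>y\<close> first
  factorises over the coordinates. The test functions \<open>h\<close> are chosen later as 1 for the
  total mass, as exponentials for the characteristic function and as indicators of half-lines for
  orthants.\<close>

lemma mixture_integral:
  "integrable lborel (\<lambda>\<xi>. complex_of_real (std_normal_density \<xi>) *
     (\<Prod>i\<in>I. \<integral>x. h i x * shifted_gauss (lam i) (\<kappa> * complex_of_real \<xi>) x \<partial>lborel))"
  "(\<integral>y. (\<Prod>i\<in>I. h i (y i)) * complex_of_real (dens y) \<partial>\<nu>) = (\<integral>\<xi>. complex_of_real (std_normal_density \<xi>) *
     (\<Prod>i\<in>I. \<integral>x. h i x * shifted_gauss (lam i) (\<kappa> * complex_of_real \<xi>) x \<partial>lborel) \<partial>lborel)"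
  "integrable \<nu> (\<lambda>y. (\<Prod>i\<in>I. h i (y i)) * complex_of_real (dens y))"
proof -
  let ?f = "\<lambda>\<xi> y. complex_of_real (std_normal_density \<xi>) *
     (\<Prod>i\<in>I. h i (y i) * shifted_gauss (lam i) (\<kappa> * complex_of_real \<xi>) (y i))"
  have 1: "(\<integral>y. ?f \<xi> y \<partial>\<nu>) = complex_of_real (std_normal_density \<xi>) *
     (\<Prod>i\<in>I. \<integral>x. h i x * shifted_gauss (lam i) (\<kappa> * complex_of_real \<xi>) x \<partial>lborel)" for \<xi>
    by (subst P.product_integral_prod[symmetric]) (auto intro!: finI integrable_h_gauss)
  have 2: "(\<integral>\<xi>. ?f \<xi> y \<partial>lborel) = (\<Prod>i\<in>I. h i (y i)) * complex_of_real (dens y)" for y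
    unfolding mixture_dens(2)[symmetric] integral_mult_right_zero[symmetric]
    by (intro Bochner_Integration.integral_cong refl) (simp add: prod.distrib mult_ac)
  show "integrable lborel (\<lambda>\<xi>. complex_of_real (std_normal_density \<xi>) *
     (\<Prod>i\<in>I. \<integral>x. h i x * shifted_gauss (lam i) (\<kappa> * complex_of_real \<xi>) x \<partial>lborel))"
    using Q.integrable_fst[OF integrable_mixture] by (simp only: 1)
  show "(\<integral>y. (\<Prod>i\<in>I. h i (y i)) * complex_of_real (dens y) \<partial>\<nu>) = (\<integral>\<xi>. complex_of_real (std_normal_density \<xi>) *
     (\<Prod>i\<in>I. \<integral>x. h i x * shifted_gauss (lam i) (\<kappa> * complex_of_real \<xi>) x \<partial>lborel) \<partial>lborel)"
    using Q.Fubini_integral[OF integrable_mixture] by (simp only: 1 2)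
  show "integrable \<nu> (\<lambda>y. (\<Prod>i\<in>I. h i (y i)) * complex_of_real (dens y))"
    using Q.integrable_snd[OF integrable_mixture] by (simp only: 2)
qed

lemma integral_law:
  "(\<integral>y. (\<Prod>i\<in>I. h i (y i)) \<partial>law) = (\<integral>\<xi>. complex_of_real (std_normal_density \<xi>) *
     (\<Prod>i\<in>I. \<integral>x. h i x * shifted_gauss (lam i) (\<kappa> * complex_of_real \<xi>) x \<partial>lborel) \<partial>lborel)"
proof -
  have "(\<integral>y. (\<Prod>i\<in>I. h i (y i)) \<partial>law) = (\<integral>y. dens y *\<^sub>R (\<Prod>i\<in>I. h i (y i)) \<partial>\<nu>)"
    unfolding law_def by (rule integral_density) (auto simp: dens_nonneg)
  then show ?thesis unfolding mixture_integral(2)[symmetric] by (simp add: scaleR_conv_of_real mult.commute)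
qed

end

lemma prob_space_law: "prob_space law"
proof (rule prob_spaceI)
  have 1: "integrable \<nu> (\<lambda>y. complex_of_real (dens y))" "(\<integral>y. complex_of_real (dens y) \<partial>\<nu>) = 1"
    using mixture_integral(2,3)[of "\<lambda>_ _. 1"] lam by (simp_all add: integral_shifted_gauss)
  then have 2: "integrable \<nu> dens" "(\<integral>y. dens y \<partial>\<nu>) = 1"
    by (simp_all add: complex_of_real_integrable_eq)
  have "emeasure law (space law) = (\<integral>\<^sup>+y. ennreal (dens y) \<partial>\<nu>)"
    unfolding law_def by (subst emeasure_density) (auto intro!: nn_integral_cong)
  also have "\<dots> = ennreal 1"
    using nn_integral_eq_integral[OF 2(1)] dens_nonneg 2(2) by simp
  finally show "emeasure law (space law) = 1" by simp
qed

lemma sets_law [measurable_cong]: "sets law = sets (PiM I (\<lambda>_. borel))"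
  unfolding law_def by (simp cong: sets_PiM_cong)

text \<open>A coordinate with mean \<open>\<kappa> * \<xi>\<close> contributes the exponential of
  \<open>\<i> * t i * \<kappa> * \<xi> - (t i)\<^sup>2 / (2 * lam i)\<close>. The linear terms add
  up to \<open>b * \<xi>\<close>, and the standard normal integral turns this into
  \<open>exp (b\<^sup>2 / 2)\<close>.\<close>

lemma char_law:
  "(\<integral>y. iexp (\<Sum>i\<in>I. t i * y i) \<partial>law) = complex_of_real (exp (- ((\<Sum>i\<in>I. t i)\<^sup>2 / lam0 + (\<Sum>i\<in>I. (t i)\<^sup>2 / lam i)) / 2))"
proof -
  define b where "b = \<i> * complex_of_real (\<Sum>i\<in>I. t i) * \<kappa>"
  have "(\<integral>y. iexp (\<Sum>i\<in>I. t i * y i) \<partial>law) = (\<integral>y. (\<Prod>i\<in>I. iexp (t i * y i)) \<partial>law)"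
    by (simp add: exp_sum[OF finI] sum_distrib_left)
  also have "\<dots> = (\<integral>\<xi>. complex_of_real (std_normal_density \<xi>) *
     (\<Prod>i\<in>I. \<integral>x. iexp (t i * x) * shifted_gauss (lam i) (\<kappa> * complex_of_real \<xi>) x \<partial>lborel) \<partial>lborel)"
    by (rule integral_law) auto
  also have "\<dots> = (\<integral>\<xi>. exp (- complex_of_real (\<Sum>i\<in>I. (t i)\<^sup>2 / lam i) / 2) * (exp (b * complex_of_real \<xi>) * shifted_gauss 1 0 \<xi>) \<partial>lborel)"
  proof (intro Bochner_Integration.integral_cong refl)
    fix \<xi> :: real
    have "(\<Prod>i\<in>I. \<integral>x. iexp (t i * x) * shifted_gauss (lam i) (\<kappa> * complex_of_real \<xi>) x \<partial>lborel) =
      (\<Prod>i\<in>I. exp (\<i> * complex_of_real (t i) * (\<kappa> * complex_of_real \<xi>) + (\<i> * complex_of_real (t i))\<^sup>2 / (2 * complex_of_real (lam i))))"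
      using exp_shifted_gauss(2)[OF lam, of _ "\<i> * complex_of_real (t _)"]
      by (intro prod.cong refl) (simp add: mult.assoc)
    also have "\<dots> = exp ((\<Sum>i\<in>I. \<i> * complex_of_real (t i) * (\<kappa> * complex_of_real \<xi>)) + (\<Sum>i\<in>I. (\<i> * complex_of_real (t i))\<^sup>2 / (2 * complex_of_real (lam i))))"
      by (simp add: exp_sum[OF finI, symmetric] sum.distrib)
    also have "(\<Sum>i\<in>I. \<i> * complex_of_real (t i) * (\<kappa> * complex_of_real \<xi>)) = b * complex_of_real \<xi>"
      by (simp add: b_def sum_distrib_left sum_distrib_right mult_ac)
    also have "(\<Sum>i\<in>I. (\<i> * complex_of_real (t i))\<^sup>2 / (2 * complex_of_real (lam i))) = - complex_of_real (\<Sum>i\<in>I. (t i)\<^sup>2 / lam i) / 2"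
      by (simp add: power_mult_distrib sum_negf sum_divide_distrib mult.commute)
    finally show "complex_of_real (std_normal_density \<xi>) * (\<Prod>i\<in>I. \<integral>x. iexp (t i * x) * shifted_gauss (lam i) (\<kappa> * complex_of_real \<xi>) x \<partial>lborel)
       = exp (- complex_of_real (\<Sum>i\<in>I. (t i)\<^sup>2 / lam i) / 2) * (exp (b * complex_of_real \<xi>) * shifted_gauss 1 0 \<xi>)"
      by (simp only: exp_add shifted_gauss_1_0 mult_ac)
  qed
  also have "\<dots> = exp (- complex_of_real (\<Sum>i\<in>I. (t i)\<^sup>2 / lam i) / 2) * exp (b\<^sup>2 / 2)"
    by (simp add: exp_shifted_gauss)
  also have "b\<^sup>2 = - complex_of_real ((\<Sum>i\<in>I. t i)\<^sup>2 / lam0)"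
    by (simp add: b_def power_mult_distrib kappa_square)
  also have "exp (- complex_of_real A / 2) * exp (- complex_of_real B / 2) = complex_of_real (exp (- (A + B) / 2))" for A B
    by (simp add: exp_add[symmetric] exp_of_real[symmetric] diff_divide_distrib)
  finally show ?thesis by (simp only: add.commute)
qed

text \<open>Thresholds \<open>s i\<close> other than 0 are allowed because the mixed sign case
  conditions on a first coordinate and then needs the common level \<open>- s\<close>.\<close>

lemma orthant_law:
  fixes s :: "'i \<Rightarrow> real"
  shows "integrable lborel (\<lambda>\<xi>. complex_of_real (std_normal_density \<xi>) *
     (\<Prod>i\<in>I. Phi (complex_of_real (sqrt (lam i)) * (complex_of_real (s i) - \<kappa> * complex_of_real \<xi>))))"
    and "complex_of_real (measure law {y \<in> space law. \<forall>i\<in>I. y i \<le> s i}) =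
     (\<integral>\<xi>. complex_of_real (std_normal_density \<xi>) *
     (\<Prod>i\<in>I. Phi (complex_of_real (sqrt (lam i)) * (complex_of_real (s i) - \<kappa> * complex_of_real \<xi>))) \<partial>lborel)"
proof -
  interpret prob_space law by (rule prob_space_law)
  have im: "(indicator {..s i} :: real \<Rightarrow> complex) \<in> borel_measurable borel" for i by measurable
  have in1: "norm (indicator {..s i} x :: complex) \<le> 1" for i x by (simp add: indicator_def)
  have 1: "(\<Prod>i\<in>I. \<integral>x. indicator {..s i} x * shifted_gauss (lam i) c x \<partial>lborel) =
     (\<Prod>i\<in>I. Phi (complex_of_real (sqrt (lam i)) * (complex_of_real (s i) - c)))" for c
    using integral_atMost_shifted_gauss[OF lam, of _ "s _" c]
    by (intro prod.cong refl) (simp add: set_lebesgue_integral_def scaleR_conv_of_real of_real_indicator)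
  have 2: "(\<Prod>i\<in>I. indicator {..s i} (y i) :: complex) = complex_of_real (indicator {y \<in> space law. \<forall>i\<in>I. y i \<le> s i} y)"
    if "y \<in> space law" for y
    using that finI by (auto simp: indicator_def)
  show "integrable lborel (\<lambda>\<xi>. complex_of_real (std_normal_density \<xi>) *
     (\<Prod>i\<in>I. Phi (complex_of_real (sqrt (lam i)) * (complex_of_real (s i) - \<kappa> * complex_of_real \<xi>))))"
    using mixture_integral(1)[of "\<lambda>i. indicator {..s i}", OF im in1] by (simp add: 1)
  have A: "{y \<in> space law. \<forall>i\<in>I. y i \<le> s i} \<in> sets law" using finI by measurable
  have "(\<integral>y. (\<Prod>i\<in>I. indicator {..s i} (y i)) \<partial>law) = (\<integral>y. complex_of_real (indicator {y \<in> space law. \<forall>i\<in>I. y i \<le> s i} y) \<partial>law)"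
    by (intro Bochner_Integration.integral_cong refl 2)
  also have "\<dots> = complex_of_real (measure law {y \<in> space law. \<forall>i\<in>I. y i \<le> s i})"
    using A by (simp add: Int_absorb1)
  finally show "complex_of_real (measure law {y \<in> space law. \<forall>i\<in>I. y i \<le> s i}) =
     (\<integral>\<xi>. complex_of_real (std_normal_density \<xi>) *
     (\<Prod>i\<in>I. Phi (complex_of_real (sqrt (lam i)) * (complex_of_real (s i) - \<kappa> * complex_of_real \<xi>))) \<partial>lborel)"
    using integral_law[of "\<lambda>i. indicator {..s i}", OF im in1] by (simp add: 1)
qed

end

lemma quadratic_form_split:
  fixes lam t :: "nat \<Rightarrow> real"
  assumes "finite I"
  shows "(\<Sum>i\<in>I. \<Sum>j\<in>I. (1 / lam0 + (if i = j then 1 / lam i else 0)) * t i * t j) =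
    (\<Sum>i\<in>I. t i)\<^sup>2 / lam0 + (\<Sum>i\<in>I. (t i)\<^sup>2 / lam i)"
proof -
  have "(\<Sum>j\<in>I. (1 / lam0 + (if i = j then 1 / lam i else 0)) * t i * t j) =
     t i * (\<Sum>j\<in>I. t j) / lam0 + (t i)\<^sup>2 / lam i" if "i \<in> I" for i
  proof -
    have "(\<Sum>j\<in>I. (1 / lam0 + (if i = j then 1 / lam i else 0)) * t i * t j) =
      (\<Sum>j\<in>I. t i * t j / lam0 + (if i = j then (t i)\<^sup>2 / lam i else 0))"
      by (intro sum.cong refl) (auto simp: power2_eq_square algebra_simps)
    also have "\<dots> = t i * (\<Sum>j\<in>I. t j) / lam0 + (t i)\<^sup>2 / lam i"
      using that \<open>finite I\<close> by (simp add: sum.distrib sum_distrib_left sum_divide_distrib)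
    finally show ?thesis .
  qed
  then have "(\<Sum>i\<in>I. \<Sum>j\<in>I. (1 / lam0 + (if i = j then 1 / lam i else 0)) * t i * t j) =
    (\<Sum>i\<in>I. t i * (\<Sum>j\<in>I. t j) / lam0 + (t i)\<^sup>2 / lam i)" by (rule sum.cong[OF refl])
  also have "\<dots> = (\<Sum>i\<in>I. t i)\<^sup>2 / lam0 + (\<Sum>i\<in>I. (t i)\<^sup>2 / lam i)"
    by (simp add: sum.distrib power2_eq_square flip: sum_divide_distrib sum_distrib_right)
  finally show ?thesis .
qed

lemma sqrt_quot_eq: "b \<noteq> 0 \<Longrightarrow> sqrt_quot a b = complex_of_real (sqrt a) * csqrt_inv b"
  by (auto simp: sqrt_quot_def csqrt_inv_def real_sqrt_divide)

lemma gfun_eq_law: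
  assumes "gauss_mixture {1..l} lam0 lam"
  shows "gfun l lam0 lam (\<lambda>_. 1) =
    measure (gauss_mixture.law {1..l} lam0 lam) {y \<in> space (gauss_mixture.law {1..l} lam0 lam). \<forall>i\<in>{1..l}. y i \<le> 0}"
proof -
  interpret gauss_mixture "{1..l}" lam0 lam by fact
  interpret prob_space law by (rule prob_space_law)
  show ?thesis
  proof (cases "l = 0")
    case True
    then have "{y \<in> space law. \<forall>i\<in>{1..l}. y i \<le> 0} = space law" by auto
    then show ?thesis unfolding gfun_def using True prob_space by (simp only: simp_thms if_True)
  next
    case False
    have "is_centered_gaussian l (\<lambda>i j. 1 / lam0 + (if i = j then 1 / lam i else 0)) law"
      unfolding is_centered_gaussian_def
      using prob_space_law sets_law by (simp only: char_law quadratic_form_split[OF finite_atLeastAtMost]) simp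
    from centered_gaussian_eq[OF this] show ?thesis using False by (simp add: gfun_def Let_def)
  qed
qed

lemma gfun_integral:
  assumes pos: "\<forall>j\<in>{1..l}. lam j > 0" and lam0: "lam0 > 0 \<or> lam0 < - (\<Sum>j=1..l. lam j)"
  shows "integrable lborel (\<lambda>x::real.
          (\<Prod>j=1..l. Phi (sqrt_quot (lam j) lam0 * complex_of_real x)) *
            complex_of_real (exp (- x\<^sup>2 / 2)))" (is ?int)
    and "complex_of_real (gfun l lam0 lam (\<lambda>_. 1)) =
          complex_of_real (1 / sqrt (2 * pi)) *
          (LINT x|lborel.
             (\<Prod>j=1..l. Phi (sqrt_quot (lam j) lam0 * complex_of_real x)) *
               complex_of_real (exp (- x\<^sup>2 / 2)))" (is ?eq)
proof -
  interpret gauss_mixture "{1..l}" lam0 lam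
    using pos lam0 by unfold_locales auto
  let ?f = "\<lambda>\<xi>. complex_of_real (std_normal_density \<xi>) *
     (\<Prod>i=1..l. Phi (complex_of_real (sqrt (lam i)) * (complex_of_real 0 - \<kappa> * complex_of_real \<xi>)))"
  let ?g = "\<lambda>x. (\<Prod>j=1..l. Phi (sqrt_quot (lam j) lam0 * complex_of_real x)) * complex_of_real (exp (- x\<^sup>2 / 2))"
  \<comment> \<open>The orthant formula has the argument
    \<open>- sqrt (lam j) * \<kappa> * \<xi>\<close>; reflecting \<xi>, which preserves the normal
    density, removes the sign.\<close>
  have fg: "?f (0 + (-1) * x) = complex_of_real (1 / sqrt (2 * pi)) * ?g x" for x
    using lam0_nz by (simp add: normal_density_def \<kappa>_def sqrt_quot_eq mult_ac)
  have "integrable lborel (\<lambda>x. ?f (0 + (-1) * x))"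
    by (rule lborel_integrable_real_affine[OF orthant_law(1)[of "\<lambda>_. 0"]]) simp
  then have "integrable lborel (\<lambda>x. complex_of_real (sqrt (2 * pi)) * (complex_of_real (1 / sqrt (2 * pi)) * ?g x))"
    unfolding fg by (rule integrable_mult_right)
  moreover have "complex_of_real (sqrt (2 * pi)) * (complex_of_real (1 / sqrt (2 * pi)) * z) = z" for z
    by (simp add: mult.assoc[symmetric] flip: of_real_mult)
  ultimately show ?int by simp
  have "complex_of_real (gfun l lam0 lam (\<lambda>_. 1)) = (\<integral>x. ?f x \<partial>lborel)"
    unfolding gfun_eq_law[OF gauss_mixture_axioms] by (rule orthant_law(2)[of "\<lambda>_. 0"])
  also have "\<dots> = (\<integral>x. ?f (0 + (-1) * x) \<partial>lborel)"
    by (subst lborel_integral_real_affine[of "-1" _ 0]) simp_all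
  finally show ?eq unfolding fg by simp
qed

section \<open>Gaussian integrals of entire functions over a half-plane\<close>

lemma gauss_integrable: "a > 0 \<Longrightarrow> integrable lborel (\<lambda>x::real. exp (- (a * x\<^sup>2) / 2))"
proof -
  assume a: "a > 0"
  have "(\<lambda>x::real. exp (- (a * x\<^sup>2) / 2)) = (\<lambda>x. sqrt (2 * pi / a) * normal_density 0 (1 / sqrt a) x)"
    using a by (auto simp: fun_eq_iff normal_density_def power_divide real_sqrt_divide real_sqrt_mult field_simps)
  then show ?thesis using a by simp
qed

lemma lborel_pair_gauss_integrable:
  assumes "a > 0" "b > 0"
  shows "integrable (lborel \<Otimes>\<^sub>M lborel) (\<lambda>(t::real, s::real). exp (- (b * t\<^sup>2) / 2) * exp (- (a * s\<^sup>2) / 2))"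
  using gauss_integrable[OF assms(1)] gauss_integrable[OF assms(2)]
  by (intro lborel_pair.Fubini_integrable) (simp_all add: abs_mult)

text \<open>\<open>a\<close> and \<open>m\<close> are the Gaussian rates in the real and the
  imaginary direction, and \<open>L\<close> limits the growth of \<open>H\<close> away from the real
  axis. \<open>L < m\<close> gives integrability over the half-plane; \<open>a < m\<close> is needed
  because replacing height \<open>t\<close> by height 0 costs
  \<open>exp (a * t\<^sup>2 / 2)\<close>.\<close>

locale half_plane_gauss =
  fixes a m L :: real and H :: "complex \<Rightarrow> complex"
  assumes a: "0 < a" "a < m" and L: "0 \<le> L" "L < m"
    and H_hol: "H holomorphic_on UNIV"
    and H_bound: "\<And>w. norm (H w) \<le> exp (L * (Im w)\<^sup>2 / 2)"
    and H_cnj: "\<And>w. cnj (H w) = H (cnj w)"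
begin

lemma continuous_H [continuous_intros]: "continuous_on A f \<Longrightarrow> continuous_on A (\<lambda>x. H (f x))"
  using continuous_on_compose2[OF holomorphic_on_imp_continuous_on[OF H_hol]] by auto

lemma measurable_H [measurable]: "H \<in> borel_measurable borel"
  by (intro borel_measurable_continuous_onI continuous_intros)

text \<open>The weight \<open>exp (- (a * s\<^sup>2) / 2) * H w\<close> at
  \<open>w = s + \<i> * t\<close>, rewritten for fixed \<open>t\<close> as an entire function of
  \<open>w\<close>. This makes the contour movable.\<close>

definition q :: "real \<Rightarrow> complex \<Rightarrow> complex" where
  "q t w = exp (- (complex_of_real a * (w - \<i> * complex_of_real t)\<^sup>2) / 2) * H w"

lemma norm_q: "norm (q t (Complex x y)) \<le> exp (- (a * x\<^sup>2) / 2) * (exp (a * (y - t)\<^sup>2 / 2) * exp (L * y\<^sup>2 / 2))"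
proof -
  have "Re (- (complex_of_real a * (Complex x y - \<i> * complex_of_real t)\<^sup>2) / 2) = - (a * x\<^sup>2) / 2 + a * (y - t)\<^sup>2 / 2"
    by (simp add: power2_eq_square field_simps)
  then have "norm (q t (Complex x y)) = exp (- (a * x\<^sup>2) / 2) * exp (a * (y - t)\<^sup>2 / 2) * norm (H (Complex x y))"
    unfolding q_def norm_mult norm_exp_eq_Re by (simp only: exp_add)
  also have "\<dots> \<le> exp (- (a * x\<^sup>2) / 2) * exp (a * (y - t)\<^sup>2 / 2) * exp (L * y\<^sup>2 / 2)"
    using H_bound[of "Complex x y"] by (intro mult_left_mono) auto
  finally show ?thesis by (simp add: mult.assoc)
qed

lemma continuous_q [continuous_intros]: "continuous_on A f \<Longrightarrow> continuous_on A (\<lambda>x. q t (f x))"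
  unfolding q_def by (intro continuous_intros) auto

lemma integrable_q_line: "set_integrable lborel {0..} (\<lambda>x. q t (Complex x y))"
  unfolding set_integrable_def
proof (intro integrable_mult_indicator)
  show "integrable lborel (\<lambda>x. q t (Complex x y))"
  proof (rule Bochner_Integration.integrable_bound)
    show "integrable lborel (\<lambda>x. exp (- (a * x\<^sup>2) / 2) * (exp (a * (y - t)\<^sup>2 / 2) * exp (L * y\<^sup>2 / 2)))"
      by (intro integrable_mult_left gauss_integrable a)
    have "continuous_on UNIV (\<lambda>x. q t (Complex x y))"
      unfolding Complex_eq by (intro continuous_intros)
    then show "(\<lambda>x. q t (Complex x y)) \<in> borel_measurable lborel"
      by (simp add: borel_measurable_continuous_onI)
    show "AE x in lborel. norm (q t (Complex x y)) \<le> norm (exp (- (a * x\<^sup>2) / 2) * (exp (a * (y - t)\<^sup>2 / 2) * exp (L * y\<^sup>2 / 2)))"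
      using norm_q[of t] by auto
  qed
qed auto

definition J :: "real \<Rightarrow> complex" where "J t = (LINT x:{0..}|lborel. q t (Complex x t))"
definition J1 :: "real \<Rightarrow> complex" where "J1 t = (LINT x:{0..}|lborel. q t (Complex x 0))"

text \<open>Cauchy's theorem is used through a global primitive \<open>Q\<close> of
  \<open>q t\<close>: the difference of \<open>Q\<close> across the far vertical side vanishes
  because of the factor \<open>exp (- (a * x\<^sup>2) / 2)\<close>.\<close>

lemma contour_shift:
  assumes t: "t \<ge> 0"
  shows "J t = J1 t - \<i> * (LINT y:{0..t}|lborel. q t (Complex 0 y))"
proof -
  have "q t holomorphic_on UNIV" unfolding q_def by (intro holomorphic_intros H_hol) auto
  from holomorphic_convex_primitive'[OF convex_UNIV open_UNIV this]
  obtain Q where Q: "\<And>w. (Q has_field_derivative q t w) (at w)" by auto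
  have horiz: "((\<lambda>x. Q (Complex x y)) has_vector_derivative q t (Complex x y)) (at x)" for x y
  proof -
    have "((\<lambda>z. Q (z + \<i> * complex_of_real y)) has_field_derivative q t (complex_of_real x + \<i> * complex_of_real y) * 1) (at (complex_of_real x))"
      by (rule DERIV_chain'[OF _ Q]) (auto intro!: derivative_eq_intros)
    from has_vector_derivative_real_field[OF this] show ?thesis by (simp add: Complex_eq)
  qed
  have vert: "((\<lambda>y. Q (Complex 0 y)) has_vector_derivative \<i> * q t (Complex 0 y)) (at y)" for y
  proof -
    have "((\<lambda>z. Q (\<i> * z)) has_field_derivative q t (\<i> * complex_of_real y) * \<i>) (at (complex_of_real y))"
      by (rule DERIV_chain'[OF _ Q]) (auto intro!: derivative_eq_intros)
    from has_vector_derivative_real_field[OF this] show ?thesis by (simp add: Complex_eq mult.commute)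
  qed
  have cont: "continuous_on UNIV (\<lambda>x. q t (Complex x y))" for y
    unfolding Complex_eq by (intro continuous_intros)
  have lim1: "((\<lambda>x. Q (Complex x t)) \<longlongrightarrow> Q (Complex 0 t) + J t) at_top"
    unfolding J_def by (intro tendsto_FTC_atLeast horiz cont integrable_q_line)
  have lim2: "((\<lambda>x. Q (Complex x 0)) \<longlongrightarrow> Q (Complex 0 0) + J1 t) at_top"
    unfolding J1_def by (intro tendsto_FTC_atLeast horiz cont integrable_q_line)
  have diff: "norm (Q (Complex x t) - Q (Complex x 0)) \<le> exp (- (a * x\<^sup>2) / 2) * (exp (a * t\<^sup>2 / 2) * exp (L * t\<^sup>2 / 2) * t)" for x
  proof -
    let ?S = "closed_segment (Complex x 0) (Complex x t)"
    have "norm (Q (Complex x t) - Q (Complex x 0)) \<le> (exp (- (a * x\<^sup>2) / 2) * (exp (a * t\<^sup>2 / 2) * exp (L * t\<^sup>2 / 2))) * norm (Complex x t - Complex x 0)"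
    proof (rule field_differentiable_bound[OF convex_closed_segment[of "Complex x 0" "Complex x t"]])
      show "(Q has_field_derivative q t w) (at w within ?S)" for w
        by (intro DERIV_subset[OF Q]) auto
      fix w assume "w \<in> ?S"
      then obtain u where u: "0 \<le> u" "u \<le> 1" "w = (1 - u) *\<^sub>R Complex x 0 + u *\<^sub>R Complex x t"
        by (auto simp: in_segment)
      define y where "y = u * t"
      have y: "0 \<le> y" "y \<le> t" using u t by (auto simp: y_def mult_left_le_one_le)
      have w: "w = Complex x y" using u(3) by (simp add: y_def complex_eq_iff algebra_simps)
      have "(y - t)\<^sup>2 \<le> t\<^sup>2" "y\<^sup>2 \<le> t\<^sup>2" using y by (auto intro: power_mono simp: power2_commute[of y])
      then have "exp (a * (y - t)\<^sup>2 / 2) * exp (L * y\<^sup>2 / 2) \<le> exp (a * t\<^sup>2 / 2) * exp (L * t\<^sup>2 / 2)"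
        using a L by (intro mult_mono) (auto intro: mult_left_mono)
      then have "exp (- (a * x\<^sup>2) / 2) * (exp (a * (y - t)\<^sup>2 / 2) * exp (L * y\<^sup>2 / 2)) \<le> exp (- (a * x\<^sup>2) / 2) * (exp (a * t\<^sup>2 / 2) * exp (L * t\<^sup>2 / 2))"
        by (intro mult_left_mono) auto
      then show "norm (q t w) \<le> exp (- (a * x\<^sup>2) / 2) * (exp (a * t\<^sup>2 / 2) * exp (L * t\<^sup>2 / 2))"
        unfolding w using norm_q[of t x y] by linarith
    qed auto
    also have "norm (Complex x t - Complex x 0) = t" using t by (simp add: cmod_def)
    finally show ?thesis by (simp add: mult.assoc)
  qed
  have "((\<lambda>x::real. exp (- (a * x\<^sup>2) / 2) * (exp (a * t\<^sup>2 / 2) * exp (L * t\<^sup>2 / 2) * t)) \<longlongrightarrow> 0) at_top"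
    using a by real_asymp
  then have "((\<lambda>x. Q (Complex x t) - Q (Complex x 0)) \<longlongrightarrow> 0) at_top"
    by (rule Lim_null_comparison[rotated]) (use diff in auto)
  moreover have "((\<lambda>x. Q (Complex x t) - Q (Complex x 0)) \<longlongrightarrow> (Q (Complex 0 t) + J t) - (Q (Complex 0 0) + J1 t)) at_top"
    by (intro tendsto_diff lim1 lim2)
  ultimately have "(Q (Complex 0 t) + J t) - (Q (Complex 0 0) + J1 t) = 0"
    using tendsto_unique trivial_limit_at_top_linorder by blast
  then have "J t = J1 t - (Q (Complex 0 t) - Q (Complex 0 0))"
    by (simp add: algebra_simps)
  also have "Q (Complex 0 t) - Q (Complex 0 0) = (\<integral>y. indicator {0..t} y *\<^sub>R (\<i> * q t (Complex 0 y)) \<partial>lborel)"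
  proof (rule integral_FTC_atLeastAtMost[OF t, symmetric])
    show "((\<lambda>y. Q (Complex 0 y)) has_vector_derivative \<i> * q t (Complex 0 y)) (at y within {0..t})" for y
      by (rule has_vector_derivative_at_within[OF vert])
    show "continuous_on {0..t} (\<lambda>y. \<i> * q t (Complex 0 y))"
      unfolding Complex_eq by (intro continuous_intros)
  qed
  also have "\<dots> = \<i> * (LINT y:{0..t}|lborel. q t (Complex 0 y))"
    unfolding set_lebesgue_integral_def by (subst integral_mult_right_zero[symmetric]) (auto intro!: Bochner_Integration.integral_cong)
  finally show ?thesis .
qed

lemma cnj_q: "cnj (q t w) = q (- t) (cnj w)"
  by (simp add: q_def H_cnj exp_cnj)

lemma cnj_J: "cnj (J t) = J (- t)"
  unfolding J_def set_lebesgue_integral_def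
  by (subst Bochner_Integration.integral_cnj[symmetric]) (simp add: cnj_q complex_cnj)

lemma cnj_J1: "cnj (J1 t) = J1 (- t)"
  unfolding J1_def set_lebesgue_integral_def
  by (subst Bochner_Integration.integral_cnj[symmetric]) (simp add: cnj_q complex_cnj)

lemma q_vertical: "q t (Complex 0 y) = complex_of_real (exp (a * (y - t)\<^sup>2 / 2)) * H (\<i> * complex_of_real y)"
proof -
  have "- (complex_of_real a * (Complex 0 y - \<i> * complex_of_real t)\<^sup>2) / 2 = complex_of_real (a * (y - t)\<^sup>2 / 2)"
    by (simp add: complex_eq_iff power2_eq_square field_simps)
  moreover have "Complex 0 y = \<i> * complex_of_real y" by (simp add: complex_eq_iff)
  ultimately show ?thesis unfolding q_def by (simp only: exp_of_real)
qed

text \<open>The differences at \<open>t\<close> and \<open>- t\<close> are conjugate, so their sum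
  is twice a real part; the factor \<open>- \<i>\<close> of the vertical segment turns that into an
  imaginary part. On the segment the Gaussian weight is real, so only \<open>Im\<close> of
  \<open>H\<close> remains.\<close>

lemma J_sub_J1:
  assumes t: "t \<ge> 0"
  shows "(J t - J1 t) + (J (- t) - J1 (- t)) =
    complex_of_real (2 * (LINT y:{0..t}|lborel. exp (a * (y - t)\<^sup>2 / 2) * Im (H (\<i> * complex_of_real y))))"
proof -
  let ?X = "LINT y:{0..t}|lborel. q t (Complex 0 y)"
  have "continuous_on {0..t} (\<lambda>y. q t (Complex 0 y))"
    unfolding Complex_eq by (intro continuous_intros)
  then have i: "integrable lborel (\<lambda>y. indicator {0..t} y *\<^sub>R q t (Complex 0 y))"
    using borel_integrable_atLeastAtMost' unfolding set_integrable_def by blast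
  have "Im ?X = (LINT y:{0..t}|lborel. exp (a * (y - t)\<^sup>2 / 2) * Im (H (\<i> * complex_of_real y)))"
    unfolding set_lebesgue_integral_def integral_Im[OF i, symmetric]
    by (intro Bochner_Integration.integral_cong refl) (simp add: q_vertical)
  moreover have "(J t - J1 t) + (J (- t) - J1 (- t)) = (J t - J1 t) + cnj (J t - J1 t)"
    by (simp add: cnj_J cnj_J1)
  moreover have "\<dots> = complex_of_real (2 * Im ?X)"
    unfolding contour_shift[OF t] complex_add_cnj by simp
  ultimately show ?thesis by simp
qed

text \<open>Characterised by \<open>1 / lam0 = 1 / a - 1 / m\<close>; it is the rate left over after
  integrating out \<open>t\<close>, with opposite signs on the two pieces of the contour.\<close>

definition lam0 :: real where "lam0 = a * m / (m - a)"

lemma pair_integrable: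
  "integrable (lborel \<Otimes>\<^sub>M lborel) (\<lambda>(t, x). complex_of_real (exp (- (m * t\<^sup>2) / 2)) * (indicator {0..} x *\<^sub>R q t (Complex x t)))"
proof (rule Bochner_Integration.integrable_bound[OF lborel_pair_gauss_integrable[of a "m - L"]])
  show "AE p in lborel \<Otimes>\<^sub>M lborel. norm (case p of (t, x) \<Rightarrow> complex_of_real (exp (- (m * t\<^sup>2) / 2)) * (indicator {0..} x *\<^sub>R q t (Complex x t)))
    \<le> norm (case p of (t, s) \<Rightarrow> exp (- ((m - L) * t\<^sup>2) / 2) * exp (- (a * s\<^sup>2) / 2))"
  proof (intro AE_I2, clarify)
    fix t x :: real
    have "norm (indicator {0..} x *\<^sub>R q t (Complex x t)) \<le> norm (q t (Complex x t))" by (simp add: indicator_def)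
    also have "\<dots> \<le> exp (- (a * x\<^sup>2) / 2) * exp (L * t\<^sup>2 / 2)" using norm_q[of t x t] by simp
    finally have "norm (complex_of_real (exp (- (m * t\<^sup>2) / 2)) * (indicator {0..} x *\<^sub>R q t (Complex x t))) \<le>
      exp (- (m * t\<^sup>2) / 2) * (exp (- (a * x\<^sup>2) / 2) * exp (L * t\<^sup>2 / 2))"
      unfolding norm_mult by (simp only: norm_of_real abs_exp_cancel mult_left_mono exp_ge_zero)
    also have "\<dots> = exp (- ((m - L) * t\<^sup>2) / 2) * exp (- (a * x\<^sup>2) / 2)"
      by (simp add: exp_add[symmetric] field_simps)
    finally show "norm (complex_of_real (exp (- (m * t\<^sup>2) / 2)) * (indicator {0..} x *\<^sub>R q t (Complex x t))) \<le>
      norm (exp (- ((m - L) * t\<^sup>2) / 2) * exp (- (a * x\<^sup>2) / 2))" by simp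
  qed
qed (use a L in \<open>auto simp: q_def Complex_eq\<close>)

lemma gauss_J_integrable:
  "integrable lborel (\<lambda>t. complex_of_real (exp (- (m * t\<^sup>2) / 2)) * J t)"
  using lborel_pair.integrable_fst[OF pair_integrable]
  by (simp only: prod.case integral_mult_right_zero J_def set_lebesgue_integral_def)

text \<open>On the real half-line \<open>t\<close> enters only through a Gaussian of precision
  \<open>m - a\<close> and the phase \<open>a * x * t\<close>. Its integral lowers the exponent by
  \<open>a\<^sup>2 * x\<^sup>2 / (2 * (m - a))\<close>, and
  \<open>a + a\<^sup>2 / (m - a) = lam0\<close>.\<close>

lemma gauss_J1:
  "integrable lborel (\<lambda>t. complex_of_real (exp (- (m * t\<^sup>2) / 2)) * J1 t)"
  "(\<integral>t. complex_of_real (exp (- (m * t\<^sup>2) / 2)) * J1 t \<partial>lborel) = complex_of_real (sqrt (2 * pi / (m - a))) *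
     (LINT y:{0..}|lborel. complex_of_real (exp (- (lam0 * y\<^sup>2) / 2)) * H (complex_of_real y))"
proof -
  let ?f = "\<lambda>t x. complex_of_real (exp (- (m * t\<^sup>2) / 2)) * (indicator {0..} x *\<^sub>R q t (Complex x 0))"
  have int: "integrable (lborel \<Otimes>\<^sub>M lborel) (\<lambda>(t, x). ?f t x)"
  proof (rule Bochner_Integration.integrable_bound[OF lborel_pair_gauss_integrable[of a "m - a"]])
    show "AE p in lborel \<Otimes>\<^sub>M lborel. norm (case p of (t, x) \<Rightarrow> ?f t x)
      \<le> norm (case p of (t, s) \<Rightarrow> exp (- ((m - a) * t\<^sup>2) / 2) * exp (- (a * s\<^sup>2) / 2))"
    proof (intro AE_I2, clarify)
      fix t x :: real
      have "norm (indicator {0..} x *\<^sub>R q t (Complex x 0)) \<le> norm (q t (Complex x 0))" by (simp add: indicator_def)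
      also have "\<dots> \<le> exp (- (a * x\<^sup>2) / 2) * exp (a * t\<^sup>2 / 2)" using norm_q[of t x 0] by simp
      finally have "norm (?f t x) \<le> exp (- (m * t\<^sup>2) / 2) * (exp (- (a * x\<^sup>2) / 2) * exp (a * t\<^sup>2 / 2))"
        unfolding norm_mult by (simp only: norm_of_real abs_exp_cancel mult_left_mono exp_ge_zero)
      also have "\<dots> = exp (- ((m - a) * t\<^sup>2) / 2) * exp (- (a * x\<^sup>2) / 2)"
        by (simp add: exp_add[symmetric] field_simps)
      finally show "norm (?f t x) \<le> norm (exp (- ((m - a) * t\<^sup>2) / 2) * exp (- (a * x\<^sup>2) / 2))" by simp
    qed
  qed (use a L in \<open>auto simp: q_def Complex_eq\<close>)
  have fst: "(\<integral>x. ?f t x \<partial>lborel) = complex_of_real (exp (- (m * t\<^sup>2) / 2)) * J1 t" for t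
    by (simp only: J1_def set_lebesgue_integral_def integral_mult_right_zero)
  have ma: "m - a > 0" using a by simp
  have snd: "(\<integral>t. ?f t x \<partial>lborel) = indicator {0..} x *\<^sub>R (complex_of_real (sqrt (2 * pi / (m - a))) *
      (complex_of_real (exp (- (lam0 * x\<^sup>2) / 2)) * H (complex_of_real x)))" for x
  proof -
    let ?b = "\<i> * complex_of_real (a * x)"
    have "?f t x = (indicator {0..} x *\<^sub>R (complex_of_real (sqrt (2 * pi / (m - a)) * exp (- (a * x\<^sup>2) / 2)) * H (complex_of_real x))) *
        (exp (?b * complex_of_real t) * shifted_gauss (m - a) 0 t)" for t
    proof -
      have c: "complex_of_real (sqrt (2 * pi / (m - a))) * complex_of_real (sqrt ((m - a) / (2 * pi))) = 1"
        using ma by (simp flip: of_real_mult real_sqrt_mult)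
      have "complex_of_real (exp (- (m * t\<^sup>2) / 2)) * exp (- (complex_of_real a * (Complex x 0 - \<i> * complex_of_real t)\<^sup>2) / 2)
         = complex_of_real (exp (- (a * x\<^sup>2) / 2)) * (exp (?b * complex_of_real t) * exp (- (complex_of_real (m - a) * (complex_of_real t - 0)\<^sup>2) / 2))"
        unfolding exp_of_real[symmetric] exp_add[symmetric]
        by (intro arg_cong[where f=exp]) (simp add: complex_eq_iff power2_eq_square field_simps)
      then have "complex_of_real (exp (- (m * t\<^sup>2) / 2)) * q t (Complex x 0)
         = (complex_of_real (sqrt (2 * pi / (m - a))) * complex_of_real (sqrt ((m - a) / (2 * pi)))) * (complex_of_real (exp (- (a * x\<^sup>2) / 2)) * (exp (?b * complex_of_real t) * exp (- (complex_of_real (m - a) * (complex_of_real t - 0)\<^sup>2) / 2))) * H (complex_of_real x)"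
        unfolding c q_def by (simp add: Complex_eq mult_ac)
      then show ?thesis by (simp add: shifted_gauss_def indicator_def mult_ac)
    qed
    then have "(\<integral>t. ?f t x \<partial>lborel) = (indicator {0..} x *\<^sub>R (complex_of_real (sqrt (2 * pi / (m - a)) * exp (- (a * x\<^sup>2) / 2)) * H (complex_of_real x))) *
        exp (?b * 0 + ?b\<^sup>2 / (2 * complex_of_real (m - a)))"
      by (simp only: integral_mult_right_zero exp_shifted_gauss(2)[OF ma])
    also have "?b * 0 + ?b\<^sup>2 / (2 * complex_of_real (m - a)) = complex_of_real (- (a * x)\<^sup>2 / (2 * (m - a)))"
      by (simp add: power_mult_distrib)
    also have "exp (complex_of_real (- (a * x)\<^sup>2 / (2 * (m - a)))) = complex_of_real (exp (- (a * x)\<^sup>2 / (2 * (m - a))))"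
      by (rule exp_of_real)
    also have "(indicator {0..} x *\<^sub>R (complex_of_real (sqrt (2 * pi / (m - a)) * exp (- (a * x\<^sup>2) / 2)) * H (complex_of_real x))) * \<dots> =
      indicator {0..} x *\<^sub>R (complex_of_real (sqrt (2 * pi / (m - a))) * (complex_of_real (exp (- (a * x\<^sup>2) / 2) * exp (- (a * x)\<^sup>2 / (2 * (m - a)))) * H (complex_of_real x)))"
      by (simp add: indicator_def mult_ac)
    also have "exp (- (a * x\<^sup>2) / 2) * exp (- (a * x)\<^sup>2 / (2 * (m - a))) = exp (- (lam0 * x\<^sup>2) / 2)"
      unfolding exp_add[symmetric] lam0_def using ma by (simp add: field_simps power2_eq_square)
    finally show ?thesis .
  qed
  show "integrable lborel (\<lambda>t. complex_of_real (exp (- (m * t\<^sup>2) / 2)) * J1 t)"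
    using lborel_pair.integrable_fst[OF int] by (simp only: fst)
  have "(\<integral>t. complex_of_real (exp (- (m * t\<^sup>2) / 2)) * J1 t \<partial>lborel) = (\<integral>x. (\<integral>t. ?f t x \<partial>lborel) \<partial>lborel)"
    using lborel_pair.Fubini_integral[OF int] by (simp only: fst)
  also have "\<dots> = complex_of_real (sqrt (2 * pi / (m - a))) *
     (LINT y:{0..}|lborel. complex_of_real (exp (- (lam0 * y\<^sup>2) / 2)) * H (complex_of_real y))"
    unfolding snd set_lebesgue_integral_def integral_mult_right_zero[symmetric]
    by (intro Bochner_Integration.integral_cong refl) (simp add: indicator_def)
  finally show "(\<integral>t. complex_of_real (exp (- (m * t\<^sup>2) / 2)) * J1 t \<partial>lborel) = \<dots>" .
qed

text \<open>Completing the square gives precision \<open>m - a\<close> and mean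
  \<open>- a * y / (m - a)\<close>, with \<open>lam0 * y\<^sup>2 / 2\<close> left in the exponent.
  The bound \<open>y\<close> lies \<open>m * y / (m - a)\<close> above this mean, which is
  \<open>m * y / sqrt (m - a)\<close> in standard units.\<close>

lemma tail_integral:
  "(LINT t:{y..}|lborel. complex_of_real (exp (- (m * t\<^sup>2) / 2) * exp (a * (y - t)\<^sup>2 / 2))) =
    complex_of_real (sqrt (2 * pi / (m - a)) * exp (lam0 * y\<^sup>2 / 2)) * Phi (complex_of_real (- (m / sqrt (m - a)) * y))"
proof -
  have ma: "m - a > 0" using a by simp
  \<comment> \<open>Reflecting \<open>t\<close> turns the upper tail into a lower one, the form in
    which \<open>Phi\<close> is available.\<close>
  have "(LINT t:{y..}|lborel. complex_of_real (exp (- (m * t\<^sup>2) / 2) * exp (a * (y - t)\<^sup>2 / 2))) =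
     (LINT t:{..-y}|lborel. complex_of_real (exp (- (m * t\<^sup>2) / 2) * exp (a * (y + t)\<^sup>2 / 2)))"
    unfolding set_lebesgue_integral_def
    by (subst lborel_integral_real_affine[of "-1" _ 0])
       (auto simp: indicator_def intro!: Bochner_Integration.integral_cong)
  also have "\<dots> = (LINT t:{..-y}|lborel. complex_of_real (sqrt (2 * pi / (m - a)) * exp (lam0 * y\<^sup>2 / 2)) * shifted_gauss (m - a) (complex_of_real (a * y / (m - a))) t)"
  proof (intro set_lebesgue_integral_cong allI impI)
    fix t
    have c: "sqrt (2 * pi / (m - a)) * sqrt ((m - a) / (2 * pi)) = 1"
      using ma by (simp flip: real_sqrt_mult)
    have "- (m * t\<^sup>2) / 2 + a * (y + t)\<^sup>2 / 2 = lam0 * y\<^sup>2 / 2 + - ((m - a) * (t - a * y / (m - a))\<^sup>2) / 2"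
    proof -
      define r z where "r = a\<^sup>2 / (m - a)" and "z = a * y / (m - a)"
      have mz: "(m - a) * z = a * y" and az: "a * y * z = r * y\<^sup>2"
        using ma by (simp_all add: z_def r_def power2_eq_square)
      have "(m - a) * (t - z)\<^sup>2 = (m - a) * t\<^sup>2 - 2 * t * ((m - a) * z) + ((m - a) * z) * z"
        by (simp add: power2_eq_square algebra_simps)
      then have sq: "(m - a) * (t - z)\<^sup>2 = (m - a) * t\<^sup>2 - 2 * t * (a * y) + r * y\<^sup>2"
        unfolding mz az .
      have lam0: "lam0 = a + r"
        unfolding lam0_def r_def using ma by (simp add: field_simps power2_eq_square)
      show ?thesis
        unfolding z_def[symmetric] sq lam0 by (simp add: power2_eq_square algebra_simps add_divide_distrib diff_divide_distrib)
    qed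
    then have "exp (- (m * t\<^sup>2) / 2) * exp (a * (y + t)\<^sup>2 / 2) = (sqrt (2 * pi / (m - a)) * sqrt ((m - a) / (2 * pi))) * (exp (lam0 * y\<^sup>2 / 2) * exp (- ((m - a) * (t - a * y / (m - a))\<^sup>2) / 2))"
      unfolding c exp_add[symmetric] by simp
    moreover have "shifted_gauss (m - a) (complex_of_real (a * y / (m - a))) t = complex_of_real (sqrt ((m - a) / (2 * pi)) * exp (- ((m - a) * (t - a * y / (m - a))\<^sup>2) / 2))"
      unfolding shifted_gauss_def by (simp add: exp_of_real[symmetric])
    ultimately show "complex_of_real (exp (- (m * t\<^sup>2) / 2) * exp (a * (y + t)\<^sup>2 / 2)) =
      complex_of_real (sqrt (2 * pi / (m - a)) * exp (lam0 * y\<^sup>2 / 2)) * shifted_gauss (m - a) (complex_of_real (a * y / (m - a))) t"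
      by (simp only: of_real_mult mult_ac)
  qed simp
  also have "\<dots> = complex_of_real (sqrt (2 * pi / (m - a)) * exp (lam0 * y\<^sup>2 / 2)) * (LINT t:{..-y}|lborel. shifted_gauss (m - a) (complex_of_real (a * y / (m - a))) t)"
    by (rule set_integral_mult_right)
  also have "(LINT t:{..-y}|lborel. shifted_gauss (m - a) (complex_of_real (a * y / (m - a))) t) = Phi (complex_of_real (- (m / sqrt (m - a)) * y))"
  proof -
    have "sqrt (m - a) * (- y - a * y / (m - a)) = - (m / sqrt (m - a)) * y"
    proof -
      have "- y - a * y / (m - a) = - (m / (m - a)) * y" using ma by (simp add: field_simps)
      moreover have "sqrt (m - a) * (m / (m - a)) = m / sqrt (m - a)"
        using ma by (simp add: real_div_sqrt field_simps)
      ultimately show ?thesis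
        by (simp only: mult_minus_left mult_minus_right mult.assoc[symmetric])
    qed
    then have "complex_of_real (sqrt (m - a)) * (complex_of_real (- y) - complex_of_real (a * y / (m - a))) = complex_of_real (- (m / sqrt (m - a)) * y)"
      by (simp only: of_real_mult[symmetric] of_real_diff[symmetric])
    then show ?thesis unfolding integral_atMost_shifted_gauss[OF ma] by (simp only:)
  qed
  finally show ?thesis .
qed

lemma Im_H_bound: "\<bar>Im (H (\<i> * complex_of_real y))\<bar> \<le> exp (L * y\<^sup>2 / 2)"
  using order_trans[OF abs_Im_le_cmod H_bound[of "\<i> * complex_of_real y"]] by simp

text \<open>Exchanging the integrations over the triangle \<open>0 \<le> y \<le> t\<close> leaves
  the tail over \<open>t \<ge> y\<close> as the inner integral.\<close>

lemma gauss_imaginary_part: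
  "(LINT t:{0..}|lborel. complex_of_real (exp (- (m * t\<^sup>2) / 2) * (LINT y:{0..t}|lborel. exp (a * (y - t)\<^sup>2 / 2) * Im (H (\<i> * complex_of_real y))))) =
    complex_of_real (sqrt (2 * pi / (m - a))) * (LINT y:{0..}|lborel. complex_of_real (exp (lam0 * y\<^sup>2 / 2)) *
      Phi (complex_of_real (- (m / sqrt (m - a)) * y)) * complex_of_real (Im (H (\<i> * complex_of_real y))))" (is "?lhs = ?rhs")
proof -
  \<comment> \<open>On the triangle \<open>a * (y - t)\<^sup>2 + L * y\<^sup>2\<close> is at most
    \<open>max a L * t\<^sup>2\<close>, so the integrand is bounded by
    \<open>exp (- (\<delta> * t\<^sup>2) / 2)\<close>. Half of this rate is passed on to
    \<open>y\<close>, as \<open>y\<^sup>2 \<le> t\<^sup>2\<close>.\<close>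
  define \<delta> where "\<delta> = m - max a L"
  have \<delta>: "\<delta> > 0" using a L by (simp add: \<delta>_def)
  let ?f = "\<lambda>t y. complex_of_real (indicator {(t, y). 0 \<le> y \<and> y \<le> t} (t, y) * (exp (- (m * t\<^sup>2) / 2) * exp (a * (y - t)\<^sup>2 / 2) * Im (H (\<i> * complex_of_real y))))"
  have int: "integrable (lborel \<Otimes>\<^sub>M lborel) (\<lambda>(t, y). ?f t y)"
  proof (rule Bochner_Integration.integrable_bound[OF lborel_pair_gauss_integrable[of "\<delta> / 2" "\<delta> / 2"]])
    show "AE p in lborel \<Otimes>\<^sub>M lborel. norm (case p of (t, y) \<Rightarrow> ?f t y)
      \<le> norm (case p of (t, s) \<Rightarrow> exp (- (\<delta> / 2 * t\<^sup>2) / 2) * exp (- (\<delta> / 2 * s\<^sup>2) / 2))"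
    proof (intro AE_I2, clarify)
      fix t y :: real
      show "norm (?f t y) \<le> norm (exp (- (\<delta> / 2 * t\<^sup>2) / 2) * exp (- (\<delta> / 2 * y\<^sup>2) / 2))"
      proof (cases "0 \<le> y \<and> y \<le> t")
        case True
        have yt: "y\<^sup>2 \<le> t\<^sup>2" using True by (intro power_mono) auto
        have "a * (y - t)\<^sup>2 + L * y\<^sup>2 \<le> max a L * (y - t)\<^sup>2 + max a L * y\<^sup>2"
          by (intro add_mono mult_right_mono) auto
        also have "\<dots> = max a L * (t\<^sup>2 - 2 * (y * (t - y)))" by (simp add: power2_eq_square algebra_simps)
        also have "\<dots> \<le> max a L * t\<^sup>2" using True a by (intro mult_left_mono) auto
        finally have "- (m * t\<^sup>2) / 2 + a * (y - t)\<^sup>2 / 2 + L * y\<^sup>2 / 2 \<le> - (\<delta> * t\<^sup>2) / 2"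
          by (simp add: \<delta>_def algebra_simps)
        also have "\<dots> \<le> - (\<delta> / 2 * t\<^sup>2) / 2 + - (\<delta> / 2 * y\<^sup>2) / 2"
        proof -
          have "\<delta> * y\<^sup>2 \<le> \<delta> * t\<^sup>2" using yt \<delta> by simp
          then show ?thesis by linarith
        qed
        finally have e: "exp (- (m * t\<^sup>2) / 2) * exp (a * (y - t)\<^sup>2 / 2) * exp (L * y\<^sup>2 / 2) \<le> exp (- (\<delta> / 2 * t\<^sup>2) / 2) * exp (- (\<delta> / 2 * y\<^sup>2) / 2)"
          unfolding exp_add[symmetric] by simp
        have "norm (?f t y) = exp (- (m * t\<^sup>2) / 2) * exp (a * (y - t)\<^sup>2 / 2) * \<bar>Im (H (\<i> * complex_of_real y))\<bar>"
          using True by (simp add: norm_mult abs_mult del: of_real_mult)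
        also have "\<dots> \<le> exp (- (m * t\<^sup>2) / 2) * exp (a * (y - t)\<^sup>2 / 2) * exp (L * y\<^sup>2 / 2)"
          by (intro mult_left_mono Im_H_bound) auto
        finally show ?thesis using e by simp
      qed (auto simp: indicator_def)
    qed
    have "{(t, y). 0 \<le> y \<and> y \<le> (t::real)} = {p \<in> space (borel \<Otimes>\<^sub>M borel). 0 \<le> snd p \<and> snd p \<le> fst p}"
      by (auto simp: space_pair_measure)
    then have [measurable]: "{(t, y). 0 \<le> y \<and> y \<le> (t::real)} \<in> sets (borel \<Otimes>\<^sub>M borel)" by simp
    have [measurable]: "(\<lambda>x. Im (H (\<i> * complex_of_real x))) \<in> borel_measurable borel"
      by (intro borel_measurable_continuous_onI continuous_intros)
    show "(\<lambda>(t, y). ?f t y) \<in> borel_measurable (lborel \<Otimes>\<^sub>M lborel)"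
      by measurable
  qed (use \<delta> in auto)
  have fst: "(\<integral>y. ?f t y \<partial>lborel) = indicator {0..} t *\<^sub>R complex_of_real (exp (- (m * t\<^sup>2) / 2) * (LINT y:{0..t}|lborel. exp (a * (y - t)\<^sup>2 / 2) * Im (H (\<i> * complex_of_real y))))" for t
  proof -
    have "(\<integral>y. ?f t y \<partial>lborel) = complex_of_real (\<integral>y. (indicator {0..} t * exp (- (m * t\<^sup>2) / 2)) * (indicator {0..t} y *\<^sub>R (exp (a * (y - t)\<^sup>2 / 2) * Im (H (\<i> * complex_of_real y)))) \<partial>lborel)"
      unfolding integral_complex_of_real[symmetric]
      by (intro Bochner_Integration.integral_cong refl) (auto simp: indicator_def)
    also have "\<dots> = indicator {0..} t *\<^sub>R complex_of_real (exp (- (m * t\<^sup>2) / 2) * (LINT y:{0..t}|lborel. exp (a * (y - t)\<^sup>2 / 2) * Im (H (\<i> * complex_of_real y))))"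
      unfolding integral_mult_right_zero set_lebesgue_integral_def by (simp add: indicator_def)
    finally show ?thesis .
  qed
  have snd: "(\<integral>t. ?f t y \<partial>lborel) = indicator {0..} y *\<^sub>R (complex_of_real (sqrt (2 * pi / (m - a))) * (complex_of_real (exp (lam0 * y\<^sup>2 / 2)) *
      Phi (complex_of_real (- (m / sqrt (m - a)) * y)) * complex_of_real (Im (H (\<i> * complex_of_real y)))))" for y
  proof -
    have "(\<integral>t. ?f t y \<partial>lborel) = (\<integral>t. (indicator {0..} y *\<^sub>R complex_of_real (Im (H (\<i> * complex_of_real y)))) * (indicator {y..} t *\<^sub>R complex_of_real (exp (- (m * t\<^sup>2) / 2) * exp (a * (y - t)\<^sup>2 / 2))) \<partial>lborel)"
      by (intro Bochner_Integration.integral_cong refl) (auto simp: indicator_def)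
    also have "\<dots> = (indicator {0..} y *\<^sub>R complex_of_real (Im (H (\<i> * complex_of_real y)))) * (LINT t:{y..}|lborel. complex_of_real (exp (- (m * t\<^sup>2) / 2) * exp (a * (y - t)\<^sup>2 / 2)))"
      unfolding integral_mult_right_zero set_lebesgue_integral_def ..
    finally show ?thesis unfolding tail_integral by (simp add: indicator_def mult_ac)
  qed
  have "?lhs = (\<integral>t. (\<integral>y. ?f t y \<partial>lborel) \<partial>lborel)"
    unfolding fst set_lebesgue_integral_def ..
  also have "\<dots> = (\<integral>y. (\<integral>t. ?f t y \<partial>lborel) \<partial>lborel)"
    using lborel_pair.Fubini_integral[OF int] by simp
  also have "\<dots> = ?rhs"
    unfolding snd set_lebesgue_integral_def integral_mult_right_zero[symmetric]
    by (intro Bochner_Integration.integral_cong refl) (simp add: indicator_def)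
  finally show ?thesis .
qed

lemma gauss_J:
  "(\<integral>t. complex_of_real (exp (- (m * t\<^sup>2) / 2)) * J t \<partial>lborel) = complex_of_real (sqrt (2 * pi / (m - a))) *
     ((LINT y:{0..}|lborel. complex_of_real (exp (- (lam0 * y\<^sup>2) / 2)) * H (complex_of_real y)) +
      2 * (LINT y:{0..}|lborel. complex_of_real (exp (lam0 * y\<^sup>2 / 2)) *
        Phi (complex_of_real (- (m / sqrt (m - a)) * y)) * complex_of_real (Im (H (\<i> * complex_of_real y)))))"
proof -
  let ?g = "\<lambda>t. complex_of_real (exp (- (m * t\<^sup>2) / 2)) * (J t - J1 t)"
  have i: "integrable lborel ?g"
    unfolding right_diff_distrib by (intro Bochner_Integration.integrable_diff gauss_J_integrable gauss_J1)
  have "(\<integral>t. complex_of_real (exp (- (m * t\<^sup>2) / 2)) * J t \<partial>lborel) = (\<integral>t. ?g t + complex_of_real (exp (- (m * t\<^sup>2) / 2)) * J1 t \<partial>lborel)"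
    by (intro Bochner_Integration.integral_cong refl) (simp add: algebra_simps)
  also have "\<dots> = (\<integral>t. ?g t \<partial>lborel) + (\<integral>t. complex_of_real (exp (- (m * t\<^sup>2) / 2)) * J1 t \<partial>lborel)"
    by (intro Bochner_Integration.integral_add i gauss_J1)
  \<comment> \<open>Only \<open>J - J1\<close> is folded onto \<open>t \<ge> 0\<close>, where the
    conjugate values combine; \<open>J1\<close> is integrated over the whole line.\<close>
  also have "(\<integral>t. ?g t \<partial>lborel) = (LINT t:{0..}|lborel. ?g t + ?g (- t))"
    by (rule integral_symmetrize[OF i])
  also have "\<dots> = (LINT t:{0..}|lborel. 2 * complex_of_real (exp (- (m * t\<^sup>2) / 2) * (LINT y:{0..t}|lborel. exp (a * (y - t)\<^sup>2 / 2) * Im (H (\<i> * complex_of_real y)))))"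
  proof (intro set_lebesgue_integral_cong allI impI)
    fix t :: real assume "t \<in> {0..}"
    then have t: "t \<ge> 0" by simp
    have "?g t + ?g (- t) = complex_of_real (exp (- (m * t\<^sup>2) / 2)) * ((J t - J1 t) + (J (- t) - J1 (- t)))"
      by (simp add: algebra_simps)
    then show "?g t + ?g (- t) = 2 * complex_of_real (exp (- (m * t\<^sup>2) / 2) * (LINT y:{0..t}|lborel. exp (a * (y - t)\<^sup>2 / 2) * Im (H (\<i> * complex_of_real y))))"
      unfolding J_sub_J1[OF t] by (simp add: mult_ac)
  qed simp
  finally show ?thesis
    unfolding set_integral_mult_right gauss_imaginary_part gauss_J1(2) by (simp add: algebra_simps)
qed

end

section \<open>The mixed sign case\<close>

lemma shifted_gauss_normal_density:
  "a > 0 \<Longrightarrow> shifted_gauss a 0 s = complex_of_real (normal_density 0 (1 / sqrt a) s)"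
  by (simp add: shifted_gauss_def normal_density_def power_divide real_sqrt_divide real_sqrt_mult mult.commute exp_of_real[symmetric])

lemma (in pair_prob_space) integral_mult_bounded:
  fixes f :: "'a \<Rightarrow> complex" and g :: "'b \<Rightarrow> complex"
  assumes [measurable]: "f \<in> borel_measurable M1" "g \<in> borel_measurable M2"
    and f1: "\<And>x. norm (f x) \<le> 1" and g1: "\<And>y. norm (g y) \<le> 1"
  shows "(\<integral>p. f (fst p) * g (snd p) \<partial>(M1 \<Otimes>\<^sub>M M2)) = (\<integral>x. f x \<partial>M1) * (\<integral>y. g y \<partial>M2)"
proof -
  have "integrable (M1 \<Otimes>\<^sub>M M2) (\<lambda>p. f (fst p) * g (snd p))"
    by (rule P.integrable_const_bound[where B=1]) (auto simp: norm_mult intro!: mult_le_one f1 g1)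
  from integral_fst'[OF this] have "(\<integral>p. f (fst p) * g (snd p) \<partial>(M1 \<Otimes>\<^sub>M M2)) = (\<integral>x. (\<integral>y. f x * g y \<partial>M2) \<partial>M1)"
    by simp
  then show ?thesis by simp
qed

text \<open>In the locale below \<open>(s, y)\<close> has independent components, with \<open>s\<close> of variance \<open>1 / a\<close> and \<open>y\<close> of
  covariance \<open>\<delta>\<^sub>i\<^sub>j / \<lambda>\<^sub>i - 1 / m\<close>; \<open>(s / c, s + y\<^sub>2, \<dots>, s + y\<^sub>l)\<close> then has the required covariance.
  The values of \<open>a\<close>, \<open>c\<close> and \<open>m\<close> come from the linear regression of \<open>\<eta>\<^sub>2, \<dots>, \<eta>\<^sub>l\<close> on \<open>\<eta>\<^sub>1\<close>.\<close>

locale mixed_sign =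
  fixes l :: nat and lam0 :: real and lam :: "nat \<Rightarrow> real" and eps :: real
  assumes l: "l \<ge> 1" and lam0: "lam0 > 0" and lam: "\<And>j. j \<in> {2..l} \<Longrightarrow> lam j > 0"
    and lam1: "lam 1 < - (lam0 + (\<Sum>j=2..l. lam j))" and eps: "eps \<in> {1, - 1}"
begin

definition "m = - lam 1 - lam0"
definition "a = m * lam0 / (m + lam0)"
definition "L = (\<Sum>j=2..l. lam j)"
text \<open>With \<open>eps\<close> inside the argument, the domain of integration is the half-plane
  \<open>Re w \<ge> 0\<close> for both signs.\<close>

definition H :: "complex \<Rightarrow> complex" where
  "H w = (\<Prod>j=2..l. Phi (complex_of_real (eps * sqrt (lam j)) * w))"

lemma L_nonneg: "L \<ge> 0"
  unfolding L_def using lam by (intro sum_nonneg) (auto intro: less_imp_le)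

lemma m_pos: "m > L" "m > 0"
  using lam1 L_nonneg by (auto simp: m_def L_def)

lemma a_pos: "a > 0" "a < m"
  using m_pos lam0 by (auto simp: a_def divide_less_eq algebra_simps)

text \<open>This and the next identity translate the constants of the half-plane formula back into
  the given parameters. Both rest on \<open>m - a = m\<^sup>2 / (m + lam0)\<close>, where
  \<open>m + lam0 = - lam 1\<close>.\<close>

lemma lam0_eq: "a * m / (m - a) = lam0"
proof -
  have "m - a = m * m / (m + lam0)" unfolding a_def using m_pos lam0 by (simp add: field_simps)
  moreover have "a * m = lam0 * (m * m / (m + lam0))" by (simp add: a_def)
  ultimately show ?thesis using m_pos lam0 by simp
qed

lemma lam1_eq: "m / sqrt (m - a) = sqrt (- lam 1)"
proof -
  define n where "n = - lam 1"
  have n: "n = m + lam0" "n > 0" using m_pos lam0 by (auto simp: n_def m_def)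
  have "m - a = m\<^sup>2 / n" unfolding a_def n using m_pos lam0 by (simp add: field_simps power2_eq_square)
  then have "sqrt (m - a) = m / sqrt n"
    using m_pos by (simp add: real_sqrt_divide)
  then show ?thesis unfolding n_def[symmetric] using m_pos by simp
qed

lemma eps_sq: "eps * eps = 1" "\<bar>eps\<bar> = 1" "eps\<^sup>2 = 1"
  using eps by auto

lemma norm_H_le: "norm (H w) \<le> exp (L * (Im w)\<^sup>2 / 2)"
proof -
  have "norm (H w) \<le> (\<Prod>j=2..l. exp ((Im (complex_of_real (eps * sqrt (lam j)) * w))\<^sup>2 / 2))"
    unfolding H_def prod_norm[symmetric] by (intro prod_mono conjI norm_Phi_le norm_ge_zero)
  also have "\<dots> = (\<Prod>j=2..l. exp (lam j * (Im w)\<^sup>2 / 2))"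
    using lam by (intro prod.cong refl) (simp add: power_mult_distrib eps_sq less_imp_le)
  also have "\<dots> = exp (L * (Im w)\<^sup>2 / 2)"
    unfolding exp_sum[OF finite_atLeastAtMost, symmetric] L_def by (simp only: sum_distrib_right sum_divide_distrib)
  finally show ?thesis .
qed

sublocale W: half_plane_gauss a m L H
proof
  show "H holomorphic_on UNIV"
    unfolding H_def
    by (intro holomorphic_on_prod holomorphic_on_compose[OF _ holomorphic_Phi, unfolded o_def] holomorphic_intros)
  show "cnj (H w) = H (cnj w)" for w
    unfolding H_def by (simp add: cnj_Phi)
qed (use a_pos L_nonneg m_pos norm_H_le in auto)

text \<open>The law of the residuals after regression on the first coordinate; the negative leading
  parameter is admissible because \<open>m > L\<close>.\<close>

sublocale G: gauss_mixture "{2..l}" "- m" lam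
  using lam m_pos by unfold_locales (auto simp: L_def)

lemma kappa: "G.\<kappa> = - \<i> / complex_of_real (sqrt m)"
  using m_pos by (simp add: G.\<kappa>_def csqrt_inv_def field_simps)

lemma index_split: "{1..l} = insert 1 {2..l}"
  using l by auto

definition "c = (m + lam0) / m"
definition N :: "real measure" where "N = density lborel (normal_density 0 (1 / sqrt a))"
definition f :: "real \<times> (nat \<Rightarrow> real) \<Rightarrow> nat \<Rightarrow> real" where
  "f p = (\<lambda>j\<in>{1..l}. if j = 1 then fst p / c else fst p + snd p j)"

sublocale pair_prob_space N G.law
  unfolding pair_prob_space_def pair_sigma_finite_def
  using prob_space_normal_density[of "1 / sqrt a" 0] G.prob_space_law a_pos
  by (auto simp: N_def prob_space_imp_sigma_finite)

lemma c_pos: "c > 0"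
  using m_pos lam0 by (simp add: c_def)

lemma sets_N [measurable_cong]: "sets N = sets borel"
  by (simp add: N_def)

lemma measurable_snd_component [measurable]:
  "j \<in> {2..l} \<Longrightarrow> (\<lambda>p. snd p j) \<in> borel_measurable (N \<Otimes>\<^sub>M G.law)"
  by (rule measurable_compose[OF measurable_snd])
     (use measurable_component_singleton[of j "{2..l}" "\<lambda>_. borel :: real measure"] in \<open>simp cong: measurable_cong_sets add: G.sets_law\<close>)

lemma measurable_f [measurable]: "f \<in> measurable (N \<Otimes>\<^sub>M G.law) (PiM {1..l} (\<lambda>_. borel))"
  unfolding f_def
proof (rule measurable_restrict)
  fix j assume j: "j \<in> {1..l}"
  show "(\<lambda>p. if j = 1 then fst p / c else fst p + snd p j) \<in> borel_measurable (N \<Otimes>\<^sub>M G.law)"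
  proof (cases "j = 1")
    case False
    then have "j \<in> {2..l}" using j by auto
    then show ?thesis using False by simp
  qed simp
qed

lemma char_N: "(\<integral>s. iexp (b * s) \<partial>N) = complex_of_real (exp (- (b\<^sup>2 / a) / 2))"
proof -
  have "(\<integral>s. iexp (b * s) \<partial>N) = (\<integral>s. normal_density 0 (1 / sqrt a) s *\<^sub>R iexp (b * s) \<partial>lborel)"
    unfolding N_def by (rule integral_density) auto
  also have "\<dots> = (\<integral>s. exp ((\<i> * complex_of_real b) * complex_of_real s) * shifted_gauss a 0 s \<partial>lborel)"
    by (simp add: shifted_gauss_normal_density[OF a_pos(1)] scaleR_conv_of_real mult_ac)
  also have "\<dots> = exp ((\<i> * complex_of_real b) * 0 + (\<i> * complex_of_real b)\<^sup>2 / (2 * complex_of_real a))"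
    by (rule exp_shifted_gauss(2)[OF a_pos(1)])
  also have "(\<i> * complex_of_real b) * 0 + (\<i> * complex_of_real b)\<^sup>2 / (2 * complex_of_real a) = complex_of_real (- (b\<^sup>2 / a) / 2)"
    by (simp add: power_mult_distrib)
  finally show ?thesis by (simp only: exp_of_real)
qed

lemma is_centered_gaussian_mixed:
  "is_centered_gaussian l (\<lambda>i j. 1 / lam0 + (if i = j then 1 / lam i else 0))
     (distr (N \<Otimes>\<^sub>M G.law) (PiM {1..l} (\<lambda>_. borel)) f)"
proof -
  have "(\<integral>x. iexp (\<Sum>i\<in>{1..l}. t i * x i) \<partial>distr (N \<Otimes>\<^sub>M G.law) (PiM {1..l} (\<lambda>_. borel)) f) =
     complex_of_real (exp (- (\<Sum>i\<in>{1..l}. \<Sum>j\<in>{1..l}. (1 / lam0 + (if i = j then 1 / lam i else 0)) * t i * t j) / 2))" for t :: "nat \<Rightarrow> real"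
  proof -
    define T where "T = (\<Sum>j=2..l. t j)"
    define R where "R = (\<Sum>j=2..l. (t j)\<^sup>2 / lam j)"
    define b where "b = t 1 / c + T"
    have [measurable]: "(\<lambda>y. \<Sum>j=2..l. t j * y j) \<in> borel_measurable G.law"
      by (simp cong: measurable_cong_sets add: G.sets_law)
    have lin: "(\<Sum>i\<in>{1..l}. t i * f p i) = b * fst p + (\<Sum>j=2..l. t j * snd p j)" for p
    proof -
      have "(\<Sum>i\<in>{1..l}. t i * f p i) = t 1 * f p 1 + (\<Sum>j=2..l. t j * f p j)"
        unfolding index_split by simp
      also have "t 1 * f p 1 = t 1 / c * fst p" using l by (simp add: f_def)
      also have "(\<Sum>j=2..l. t j * f p j) = (\<Sum>j=2..l. t j * fst p + t j * snd p j)"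
        by (intro sum.cong refl) (auto simp: f_def algebra_simps)
      also have "\<dots> = T * fst p + (\<Sum>j=2..l. t j * snd p j)"
        by (simp add: sum.distrib T_def sum_distrib_right)
      finally show ?thesis by (simp add: b_def algebra_simps)
    qed
    have "(\<integral>x. iexp (\<Sum>i\<in>{1..l}. t i * x i) \<partial>distr (N \<Otimes>\<^sub>M G.law) (PiM {1..l} (\<lambda>_. borel)) f) =
      (\<integral>p. iexp (\<Sum>i\<in>{1..l}. t i * f p i) \<partial>(N \<Otimes>\<^sub>M G.law))"
      by (rule integral_distr[OF measurable_f]) measurable
    also have "\<dots> = (\<integral>p. iexp (b * fst p) * iexp (\<Sum>j=2..l. t j * snd p j) \<partial>(N \<Otimes>\<^sub>M G.law))"
      unfolding lin of_real_add distrib_left exp_add ..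
    also have "\<dots> = (\<integral>s. iexp (b * s) \<partial>N) * (\<integral>y. iexp (\<Sum>j=2..l. t j * y j) \<partial>G.law)"
      by (rule integral_mult_bounded) auto
    also have "\<dots> = complex_of_real (exp (- (b\<^sup>2 / a + T\<^sup>2 / - m + R) / 2))"
      unfolding char_N G.char_law of_real_mult[symmetric] exp_add[symmetric]
      by (simp add: T_def R_def diff_divide_distrib add_divide_distrib)
    also have "b\<^sup>2 / a + T\<^sup>2 / - m + R = (\<Sum>i\<in>{1..l}. \<Sum>j\<in>{1..l}. (1 / lam0 + (if i = j then 1 / lam i else 0)) * t i * t j)"
    proof -
      have q: "(\<Sum>i\<in>{1..l}. \<Sum>j\<in>{1..l}. (1 / lam0 + (if i = j then 1 / lam i else 0)) * t i * t j) = (t 1 + T)\<^sup>2 / lam0 + ((t 1)\<^sup>2 / lam 1 + R)"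
      proof -
        have "(\<Sum>i\<in>{1..l}. t i) = t 1 + T" "(\<Sum>i\<in>{1..l}. (t i)\<^sup>2 / lam i) = (t 1)\<^sup>2 / lam 1 + R"
          unfolding index_split by (simp_all add: T_def R_def)
        then show ?thesis by (simp only: quadratic_form_split[OF finite_atLeastAtMost])
      qed
      have "(t 1)\<^sup>2 / lam 1 = - ((t 1)\<^sup>2 / (m + lam0))" by (simp add: m_def)
      \<comment> \<open>Comparing coefficients, this amounts to
        \<open>1 / a - 1 / m = 1 / lam0\<close> and \<open>c * a = lam0\<close>, the relations by
        which the regression constants are determined.\<close>
      moreover have "b\<^sup>2 / a + T\<^sup>2 / - m = (t 1 + T)\<^sup>2 / lam0 - (t 1)\<^sup>2 / (m + lam0)"
      proof -
        have nz: "m \<noteq> 0" "lam0 \<noteq> 0" "m + lam0 \<noteq> 0" using m_pos lam0 by auto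
        have "b = (m * t 1 + (m + lam0) * T) / (m + lam0)"
          unfolding b_def c_def using nz by (simp add: field_simps)
        then have "b\<^sup>2 / a = (m * t 1 + (m + lam0) * T)\<^sup>2 / ((m + lam0) * m * lam0)"
          unfolding a_def using nz by (simp add: power_divide power2_eq_square)
        then have "b\<^sup>2 / a + T\<^sup>2 / - m = ((m * t 1 + (m + lam0) * T)\<^sup>2 - T\<^sup>2 * (m + lam0) * lam0) / ((m + lam0) * m * lam0)"
          using nz by (simp add: diff_divide_distrib)
        also have "(m * t 1 + (m + lam0) * T)\<^sup>2 - T\<^sup>2 * (m + lam0) * lam0 = m * ((m + lam0) * (t 1 + T)\<^sup>2 - lam0 * (t 1)\<^sup>2)"
          by (simp add: power2_eq_square algebra_simps)
        also have "\<dots> / ((m + lam0) * m * lam0) = (t 1 + T)\<^sup>2 / lam0 - (t 1)\<^sup>2 / (m + lam0)"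
          using nz by (simp add: diff_divide_distrib right_diff_distrib)
        finally show ?thesis .
      qed
      ultimately show ?thesis unfolding q by linarith
    qed
    finally show ?thesis .
  qed
  then show ?thesis
    unfolding is_centered_gaussian_def using P.prob_space_distr[OF measurable_f] by auto
qed

lemma gfun_eq_measure:
  "gfun l lam0 lam ((\<lambda>_. 1)(1 := eps)) =
     measure (N \<Otimes>\<^sub>M G.law) {p \<in> space (N \<Otimes>\<^sub>M G.law). eps * fst p \<le> 0 \<and> (\<forall>j\<in>{2..l}. snd p j \<le> - fst p)}"
proof -
  let ?P = "PiM {1..l} (\<lambda>_. borel) :: (nat \<Rightarrow> real) measure"
  let ?A = "{x \<in> space ?P. \<forall>i\<in>{1..l}. ((\<lambda>_. 1)(1 := eps)) i * x i \<le> 0}"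
  have A: "?A \<in> sets ?P" by measurable
  have "f -` ?A \<inter> space (N \<Otimes>\<^sub>M G.law) =
    {p \<in> space (N \<Otimes>\<^sub>M G.law). eps * fst p \<le> 0 \<and> (\<forall>j\<in>{2..l}. snd p j \<le> - fst p)}"
  proof -
    have "f p \<in> ?A \<longleftrightarrow> eps * fst p \<le> 0 \<and> (\<forall>j\<in>{2..l}. snd p j \<le> - fst p)" for p
    proof -
      have "f p \<in> space ?P" by (simp add: f_def space_PiM)
      moreover have "eps * (fst p / c) \<le> 0 \<longleftrightarrow> eps * fst p \<le> 0"
        using c_pos by (simp add: divide_le_0_iff)
      ultimately show ?thesis
        using l unfolding index_split by (auto simp: f_def)
    qed
    then show ?thesis by blast
  qed
  then have "measure (distr (N \<Otimes>\<^sub>M G.law) ?P f) ?A = measure (N \<Otimes>\<^sub>M G.law) {p \<in> space (N \<Otimes>\<^sub>M G.law). eps * fst p \<le> 0 \<and> (\<forall>j\<in>{2..l}. snd p j \<le> - fst p)}"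
    unfolding measure_distr[OF measurable_f A] by (rule arg_cong)
  then show ?thesis
    using l by (simp add: gfun_def Let_def centered_gaussian_eq[OF is_centered_gaussian_mixed])
qed

text \<open>The conditional probability, given \<open>s\<close>, that every residual is at most
  \<open>- s\<close>, in the form supplied by \<open>G.orthant_law\<close>.\<close>

definition K :: "real \<Rightarrow> complex" where
  "K s = (\<integral>\<xi>. complex_of_real (std_normal_density \<xi>) *
     (\<Prod>j=2..l. Phi (complex_of_real (sqrt (lam j)) * (complex_of_real (- s) - G.\<kappa> * complex_of_real \<xi>))) \<partial>lborel)"

lemma gfun_eq_K:
  "complex_of_real (gfun l lam0 lam ((\<lambda>_. 1)(1 := eps))) =
    (\<integral>s. complex_of_real (normal_density 0 (1 / sqrt a) s) * (indicator {s. eps * s \<le> 0} s * K s) \<partial>lborel)"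
proof -
  let ?A = "{p \<in> space (N \<Otimes>\<^sub>M G.law). eps * fst p \<le> 0 \<and> (\<forall>j\<in>{2..l}. snd p j \<le> - fst p)}"
  let ?ind = "\<lambda>p. complex_of_real (indicator ?A p)"
  have A: "?A \<in> sets (N \<Otimes>\<^sub>M G.law)" by measurable
  have int: "integrable (N \<Otimes>\<^sub>M G.law) ?ind"
    using A by (intro integrable_of_real integrable_real_indicator) (auto simp: P.emeasure_eq_measure)
  have spN: "space N = UNIV" by (simp add: N_def)
  have inner: "(\<integral>y. ?ind (s, y) \<partial>G.law) = indicator {s. eps * s \<le> 0} s * K s" for s
  proof -
    have B: "{y \<in> space G.law. \<forall>j\<in>{2..l}. y j \<le> - s} \<in> sets G.law"
      by measurable
    have "(\<integral>y. ?ind (s, y) \<partial>G.law) = (\<integral>y. indicator {s. eps * s \<le> 0} s * complex_of_real (indicator {y \<in> space G.law. \<forall>j\<in>{2..l}. y j \<le> - s} y) \<partial>G.law)"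
      by (intro Bochner_Integration.integral_cong refl) (auto simp: indicator_def space_pair_measure spN)
    also have "\<dots> = indicator {s. eps * s \<le> 0} s * complex_of_real (measure G.law {y \<in> space G.law. \<forall>j\<in>{2..l}. y j \<le> - s})"
      using B by (simp add: Int_absorb1)
    finally show ?thesis unfolding G.orthant_law(2)[of "\<lambda>_. - s"] K_def .
  qed
  \<comment> \<open>Measurability is inherited from the inner integral of the Fubini
    theorem.\<close>
  have Km: "(\<lambda>s. indicator {s. eps * s \<le> 0} s * K s) \<in> borel_measurable lborel"
    using M2.borel_measurable_lebesgue_integral[of "\<lambda>s y. ?ind (s, y)" N] int
    by (simp only: inner) (simp add: N_def)
  have "complex_of_real (gfun l lam0 lam ((\<lambda>_. 1)(1 := eps))) = (\<integral>p. ?ind p \<partial>(N \<Otimes>\<^sub>M G.law))"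
    unfolding gfun_eq_measure using A by (simp add: Int_absorb1)
  also have "\<dots> = (\<integral>s. indicator {s. eps * s \<le> 0} s * K s \<partial>N)"
    using integral_fst'[OF int] by (simp only: inner)
  also have "\<dots> = (\<integral>s. normal_density 0 (1 / sqrt a) s *\<^sub>R (indicator {s. eps * s \<le> 0} s * K s) \<partial>lborel)"
    unfolding N_def by (rule integral_density) (use Km in auto)
  finally show ?thesis by (simp add: scaleR_conv_of_real)
qed

text \<open>Since \<open>G.\<kappa> = - \<i> / sqrt m\<close>, the substitution
  \<open>\<xi> = eps * sqrt m * t\<close> turns the arguments of \<open>Phi\<close> into
  \<open>eps * sqrt (lam j) * (x + \<i> * t)\<close>.\<close>

lemma K_eq:
  "K (- eps * x) = complex_of_real (sqrt (m / (2 * pi))) *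
    (\<integral>t. complex_of_real (exp (- (m * t\<^sup>2) / 2)) * H (Complex x t) \<partial>lborel)"
proof -
  have sm: "eps * sqrt m \<noteq> 0" "\<bar>eps * sqrt m\<bar> = sqrt m" using m_pos eps_sq(2) by (auto simp: abs_mult)
  have "K (- eps * x) = \<bar>eps * sqrt m\<bar> *\<^sub>R (\<integral>t. complex_of_real (std_normal_density (0 + eps * sqrt m * t)) *
     (\<Prod>j=2..l. Phi (complex_of_real (sqrt (lam j)) * (complex_of_real (- (- eps * x)) - G.\<kappa> * complex_of_real (0 + eps * sqrt m * t)))) \<partial>lborel)"
    unfolding K_def by (rule lborel_integral_real_affine[OF sm(1)])
  also have "\<dots> = (\<integral>t. complex_of_real (sqrt (m / (2 * pi))) * (complex_of_real (exp (- (m * t\<^sup>2) / 2)) * H (Complex x t)) \<partial>lborel)"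
  proof -
    have d: "sqrt m * std_normal_density (0 + eps * sqrt m * t) = sqrt (m / (2 * pi)) * exp (- (m * t\<^sup>2) / 2)" for t
      using m_pos by (simp add: normal_density_def power_mult_distrib eps_sq real_sqrt_divide)
    have p: "(\<Prod>j=2..l. Phi (complex_of_real (sqrt (lam j)) * (complex_of_real (- (- eps * x)) - G.\<kappa> * complex_of_real (0 + eps * sqrt m * t)))) = H (Complex x t)" for t
      unfolding H_def kappa
      using m_pos by (intro prod.cong refl arg_cong[where f=Phi]) (simp add: complex_eq_iff algebra_simps)
    have "\<bar>eps * sqrt m\<bar> *\<^sub>R (complex_of_real (std_normal_density (0 + eps * sqrt m * t)) * z) =
       complex_of_real (sqrt (m / (2 * pi))) * (complex_of_real (exp (- (m * t\<^sup>2) / 2)) * z)" for t z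
      unfolding sm(2) scaleR_conv_of_real mult.assoc[symmetric] of_real_mult[symmetric] d ..
    then show ?thesis unfolding p by (simp flip: integral_scaleR_right)
  qed
  finally show ?thesis by (simp only: integral_mult_right_zero)
qed

lemma q_eq: "W.q t (Complex x t) = complex_of_real (exp (- (a * x\<^sup>2) / 2)) * H (Complex x t)"
proof -
  have "- (complex_of_real a * (Complex x t - \<i> * complex_of_real t)\<^sup>2) / 2 = complex_of_real (- (a * x\<^sup>2) / 2)"
    by (simp add: complex_eq_iff power2_eq_square)
  then show ?thesis unfolding W.q_def by (simp only: exp_of_real)
qed

text \<open>Substituting \<open>s = - eps * x\<close> turns the sign condition into
  \<open>x \<ge> 0\<close>. After exchanging the integrations, the inner integral over the
  horizontal half-line at height \<open>t\<close> is \<open>W.J t\<close>.\<close>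

lemma gfun_eq_J:
  "complex_of_real (gfun l lam0 lam ((\<lambda>_. 1)(1 := eps))) =
    complex_of_real (sqrt (a / (2 * pi)) * sqrt (m / (2 * pi))) *
    (\<integral>t. complex_of_real (exp (- (m * t\<^sup>2) / 2)) * W.J t \<partial>lborel)"
proof -
  let ?F = "\<lambda>t x. complex_of_real (exp (- (m * t\<^sup>2) / 2)) * (indicator {0..} x *\<^sub>R W.q t (Complex x t))"
  have e: "- eps \<noteq> 0" "\<bar>- eps\<bar> = 1" using eps_sq by auto
  have "complex_of_real (gfun l lam0 lam ((\<lambda>_. 1)(1 := eps))) =
    \<bar>- eps\<bar> *\<^sub>R (\<integral>x. complex_of_real (normal_density 0 (1 / sqrt a) (0 + - eps * x)) * (indicator {s. eps * s \<le> 0} (0 + - eps * x) * K (0 + - eps * x)) \<partial>lborel)"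
    unfolding gfun_eq_K by (rule lborel_integral_real_affine[OF e(1)])
  also have "\<dots> = (\<integral>x. complex_of_real (sqrt (a / (2 * pi)) * sqrt (m / (2 * pi))) * (\<integral>t. ?F t x \<partial>lborel) \<partial>lborel)"
    unfolding e(2) scaleR_one
  proof (intro Bochner_Integration.integral_cong refl)
    fix x
    have n: "normal_density 0 (1 / sqrt a) (0 + - eps * x) = sqrt (a / (2 * pi)) * exp (- (a * x\<^sup>2) / 2)"
      using a_pos by (simp add: normal_density_def power_mult_distrib eps_sq power_divide real_sqrt_divide real_sqrt_mult)
    have Kx: "K (0 + - eps * x) = complex_of_real (sqrt (m / (2 * pi))) *
        (\<integral>t. complex_of_real (exp (- (m * t\<^sup>2) / 2)) * H (Complex x t) \<partial>lborel)"
      using K_eq[of x] by (simp only: add_0_left)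
    have i: "indicator {s. eps * s \<le> 0} (0 + - eps * x) = (indicator {0..} x :: complex)"
      using eps_sq(1) by (simp add: indicator_def mult.assoc[symmetric])
    have "(\<integral>t. ?F t x \<partial>lborel) = (\<integral>t. (indicator {0..} x * complex_of_real (exp (- (a * x\<^sup>2) / 2))) * (complex_of_real (exp (- (m * t\<^sup>2) / 2)) * H (Complex x t)) \<partial>lborel)"
      unfolding q_eq by (intro Bochner_Integration.integral_cong refl) (simp add: indicator_def)
    then have F: "(\<integral>t. ?F t x \<partial>lborel) = (indicator {0..} x * complex_of_real (exp (- (a * x\<^sup>2) / 2))) * (\<integral>t. complex_of_real (exp (- (m * t\<^sup>2) / 2)) * H (Complex x t) \<partial>lborel)"
      by (simp only: integral_mult_right_zero)
    show "complex_of_real (normal_density 0 (1 / sqrt a) (0 + - eps * x)) * (indicator {s. eps * s \<le> 0} (0 + - eps * x) * K (0 + - eps * x)) =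
      complex_of_real (sqrt (a / (2 * pi)) * sqrt (m / (2 * pi))) * (\<integral>t. ?F t x \<partial>lborel)"
      unfolding F n i Kx by (simp only: of_real_mult mult_ac)
  qed
  also have "\<dots> = complex_of_real (sqrt (a / (2 * pi)) * sqrt (m / (2 * pi))) * (\<integral>x. (\<integral>t. ?F t x \<partial>lborel) \<partial>lborel)"
    by (rule integral_mult_right_zero)
  also have "(\<integral>x. (\<integral>t. ?F t x \<partial>lborel) \<partial>lborel) = (\<integral>t. (\<integral>x. ?F t x \<partial>lborel) \<partial>lborel)"
    by (rule lborel_pair.Fubini_integral[OF W.pair_integrable])
  also have "\<dots> = (\<integral>t. complex_of_real (exp (- (m * t\<^sup>2) / 2)) * W.J t \<partial>lborel)"
    unfolding W.J_def set_lebesgue_integral_def integral_mult_right_zero ..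
  finally show ?thesis .
qed

lemma H_real: "H (complex_of_real y) = (\<Prod>j=2..l. Phi (complex_of_real (eps * sqrt (lam j) * y)))"
  by (simp add: H_def)

lemma H_imag: "H (\<i> * complex_of_real y) = (\<Prod>j=2..l. Phi (\<i> * complex_of_real (eps * sqrt (lam j) * y)))"
  by (simp add: H_def mult_ac)

lemma gfun_mixed_integral:
  "complex_of_real (gfun l lam0 lam ((\<lambda>_. 1)(1 := eps))) =
    complex_of_real (sqrt (lam0 / (2 * pi))) *
      ((LINT y:{0..}|lborel. complex_of_real (exp (- (lam0 * y\<^sup>2) / 2)) *
          (\<Prod>j=2..l. Phi (complex_of_real (eps * sqrt (lam j) * y)))) +
       2 * (LINT y:{0..}|lborel. complex_of_real (exp (lam0 * y\<^sup>2 / 2)) *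
          Phi (complex_of_real (- sqrt (- lam 1) * y)) *
          complex_of_real (Im (\<Prod>j=2..l. Phi (\<i> * complex_of_real (eps * sqrt (lam j) * y))))))"
proof -
  have W0: "W.lam0 = lam0" unfolding W.lam0_def by (rule lam0_eq)
  have "sqrt (a / (2 * pi)) * sqrt (m / (2 * pi)) * sqrt (2 * pi / (m - a)) = sqrt (lam0 / (2 * pi))"
  proof -
    have "(a / (2 * pi)) * (m / (2 * pi)) * (2 * pi / (m - a)) = (a * m / (m - a)) / (2 * pi)"
      by simp
    then show ?thesis unfolding real_sqrt_mult[symmetric] lam0_eq by (rule arg_cong)
  qed
  then show ?thesis
    unfolding gfun_eq_J W.gauss_J W0 lam1_eq H_real H_imag
    by (simp only: mult.assoc[symmetric] of_real_mult[symmetric])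
qed

lemma set_integrable_real_part:
  "set_integrable lborel {0..} (\<lambda>y. complex_of_real (exp (- (lam0 * y\<^sup>2) / 2)) *
     (\<Prod>j=2..l. Phi (complex_of_real (eps * sqrt (lam j) * y))))"
  unfolding set_integrable_def H_real[symmetric]
proof (rule integrable_mult_indicator)
  show "integrable lborel (\<lambda>y. complex_of_real (exp (- (lam0 * y\<^sup>2) / 2)) * H (complex_of_real y))"
  proof (rule Bochner_Integration.integrable_bound[OF gauss_integrable[OF lam0]])
    show "AE y in lborel. norm (complex_of_real (exp (- (lam0 * y\<^sup>2) / 2)) * H (complex_of_real y)) \<le> norm (exp (- (lam0 * y\<^sup>2) / 2))"
      using norm_H_le[of "complex_of_real _"] by (auto simp: norm_mult intro!: mult_left_le)
  qed simp
qed simp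

text \<open>The decay rate \<open>- lam 1\<close> of the \<open>Phi\<close> factor outweighs the
  growth rates \<open>lam0\<close> and \<open>L\<close> of the other two: the net rate is
  \<open>- lam 1 - lam0 - L = m - L\<close>, which is positive.\<close>

lemma set_integrable_imaginary_part:
  "set_integrable lborel {0..} (\<lambda>y. complex_of_real (exp (lam0 * y\<^sup>2 / 2)) *
     Phi (complex_of_real (- sqrt (- lam 1) * y)) *
     complex_of_real (Im (\<Prod>j=2..l. Phi (\<i> * complex_of_real (eps * sqrt (lam j) * y)))))"
  unfolding set_integrable_def H_imag[symmetric]
proof (rule Bochner_Integration.integrable_bound)
  let ?f = "\<lambda>y. complex_of_real (exp (lam0 * y\<^sup>2 / 2)) * Phi (complex_of_real (- sqrt (- lam 1) * y)) *
     complex_of_real (Im (H (\<i> * complex_of_real y)))"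
  show "integrable lborel (\<lambda>y. exp (- ((m - L) * y\<^sup>2) / 2))"
    by (rule gauss_integrable) (use m_pos in simp)
  have "(\<lambda>x. Im (H (\<i> * complex_of_real x))) \<in> borel_measurable borel"
    by (intro borel_measurable_continuous_onI continuous_intros W.continuous_H)
  then show "(\<lambda>y. indicator {0..} y *\<^sub>R ?f y) \<in> borel_measurable lborel"
    by (intro borel_measurable_scaleR borel_measurable_times borel_measurable_of_real measurable_compose[OF _ measurable_Phi]) auto
  show "AE y in lborel. norm (indicator {0..} y *\<^sub>R ?f y) \<le> norm (exp (- ((m - L) * y\<^sup>2) / 2))"
  proof (rule AE_I2)
    fix y :: real
    show "norm (indicator {0..} y *\<^sub>R ?f y) \<le> norm (exp (- ((m - L) * y\<^sup>2) / 2))"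
    proof (cases "y \<ge> 0")
      case True
      have l1: "- lam 1 > 0" using m_pos lam0 by (simp add: m_def)
      have "norm (Phi (complex_of_real (- sqrt (- lam 1) * y))) \<le> exp (- (sqrt (- lam 1) * y)\<^sup>2 / 2)"
        using norm_Phi_tail[of "sqrt (- lam 1) * y"] True l1 by simp
      then have P: "norm (Phi (complex_of_real (- sqrt (- lam 1) * y))) \<le> exp (- (- lam 1 * y\<^sup>2) / 2)"
        using l1 by (simp add: power_mult_distrib)
      have "norm (indicator {0..} y *\<^sub>R ?f y) = exp (lam0 * y\<^sup>2 / 2) * norm (Phi (complex_of_real (- sqrt (- lam 1) * y))) * \<bar>Im (H (\<i> * complex_of_real y))\<bar>"
        using True by (simp add: norm_mult)
      also have "\<dots> \<le> exp (lam0 * y\<^sup>2 / 2) * exp (- (- lam 1 * y\<^sup>2) / 2) * exp (L * y\<^sup>2 / 2)"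
        by (intro mult_mono P W.Im_H_bound) auto
      also have "\<dots> = exp (- ((m - L) * y\<^sup>2) / 2)"
        unfolding exp_add[symmetric] by (intro arg_cong[where f=exp]) (simp add: m_def field_simps)
      finally show ?thesis by simp
    qed (simp add: indicator_def)
  qed
qed

end

theorem theorem1p7:
  fixes d k :: nat
    and \<tau> :: "nat \<Rightarrow> real"
    and e :: "nat \<Rightarrow> 'a::euclidean_space"
    and u :: 'a and S :: "'a set"
  assumes "d \<ge> 2"
    and "\<forall>i\<in>{0..d}. \<tau> i > 0"
    and "bij_betw e {0..d} (Basis :: 'a set)"
    and "u = (1 / (\<Sum>i=0..d. (\<tau> i)\<^sup>2)) *\<^sub>R (\<Sum>i=0..d. \<tau> i *\<^sub>R e i)"
    and "S = convex hull (insert u ((\<lambda>i. (1 / \<tau> i) *\<^sub>R e i) ` {1..d}))"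
    and "k \<in> {0..d - 1}"
  shows
    "int d simplex S \<and>
     \<comment> \<open>(i)\<close>
     (let F = convex hull (insert u ((\<lambda>i. (1 / \<tau> i) *\<^sub>R e i) ` {1..k})) in
        F face_of S \<and> aff_dim F = int k \<and>
        internal_angle F S =
          gfun (d - k) ((\<tau> 0)\<^sup>2) (\<lambda>j. (\<tau> (k + j))\<^sup>2) (\<lambda>_. 1) \<and>
        external_angle F S =
          gfun (d - k) (- (\<tau> 0)\<^sup>2 - (\<Sum>i=k+1..d. (\<tau> i)\<^sup>2)) (\<lambda>j. (\<tau> (k + j))\<^sup>2) (\<lambda>_. 1)) \<and>
     (\<forall>l lam0 lam.
        (\<forall>j\<in>{1..l}. lam j > 0) \<and> (lam0 > 0 \<or> lam0 < - (\<Sum>j=1..l. lam j)) \<longrightarrow>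
        integrable lborel (\<lambda>x::real.
          (\<Prod>j=1..l. Phi (sqrt_quot (lam j) lam0 * complex_of_real x)) *
            complex_of_real (exp (- x\<^sup>2 / 2))) \<and>
        complex_of_real (gfun l lam0 lam (\<lambda>_. 1)) =
          complex_of_real (1 / sqrt (2 * pi)) *
          (LINT x|lborel.
             (\<Prod>j=1..l. Phi (sqrt_quot (lam j) lam0 * complex_of_real x)) *
               complex_of_real (exp (- x\<^sup>2 / 2)))) \<and>
     \<comment> \<open>(ii)\<close>
     (let F = convex hull ((\<lambda>i. (1 / \<tau> i) *\<^sub>R e i) ` {1..k + 1}) in
        F face_of S \<and> aff_dim F = int k \<and>
        internal_angle F S =
          gfun (d - k) ((\<tau> 0)\<^sup>2)
            ((\<lambda>j. (\<tau> (k + j))\<^sup>2)(1 := - (\<Sum>i=0..d. (\<tau> i)\<^sup>2))) ((\<lambda>_. 1)(1 := - 1)) \<and>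
        external_angle F S =
          gfun (d - k) (\<Sum>i=1..k+1. (\<tau> i)\<^sup>2)
            ((\<lambda>j. (\<tau> (k + j))\<^sup>2)(1 := - (\<Sum>i=0..d. (\<tau> i)\<^sup>2))) (\<lambda>_. 1)) \<and>
     (\<forall>l lam0 lam eps1.
        l \<ge> 1 \<and> lam0 > 0 \<and> (\<forall>j\<in>{2..l}. lam j > 0) \<and>
        lam 1 < - (lam0 + (\<Sum>j=2..l. lam j)) \<and> eps1 \<in> {1, - 1} \<longrightarrow>
        set_integrable lborel {0..} (\<lambda>y::real.
          complex_of_real (exp (- (lam0 * y\<^sup>2) / 2)) *
            (\<Prod>j=2..l. Phi (complex_of_real (eps1 * sqrt (lam j) * y)))) \<and>
        set_integrable lborel {0..} (\<lambda>y::real.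
          complex_of_real (exp (lam0 * y\<^sup>2 / 2)) *
            Phi (complex_of_real (- sqrt (- lam 1) * y)) *
            complex_of_real
              (Im (\<Prod>j=2..l. Phi (\<i> * complex_of_real (eps1 * sqrt (lam j) * y))))) \<and>
        complex_of_real (gfun l lam0 lam ((\<lambda>_. 1)(1 := eps1))) =
          complex_of_real (sqrt (lam0 / (2 * pi))) *
          ((LINT y:{0..}|lborel.
              complex_of_real (exp (- (lam0 * y\<^sup>2) / 2)) *
                (\<Prod>j=2..l. Phi (complex_of_real (eps1 * sqrt (lam j) * y)))) +
           2 * (LINT y:{0..}|lborel.
              complex_of_real (exp (lam0 * y\<^sup>2 / 2)) *
                Phi (complex_of_real (- sqrt (- lam 1) * y)) *
                complex_of_real
                  (Im (\<Prod>j=2..l. Phi (\<i> * complex_of_real (eps1 * sqrt (lam j) * y)))))))"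
proof -
  interpret R: weighted_simplex d \<tau> e
    using assms(2,3) by unfold_locales auto
  have k: "k < d" using assms(1,6) by auto
  have u: "u = R.w 0" using assms(4) by (simp add: R.w_def R.T_def R.nv_def)
  have img: "(\<lambda>i. (1 / \<tau> i) *\<^sub>R e i) ` {1..n} = R.w ` {1..n}" for n
    by (intro image_cong) (auto simp: R.w_def)
  have ins: "insert u (R.w ` {1..n}) = R.w ` {0..n}" for n
  proof -
    have "{0..n} = insert 0 {1..n}" by auto
    then show ?thesis by (simp only: u image_insert)
  qed
  have S: "S = convex hull (R.w ` {0..d})" using assms(5) by (simp only: img ins)
  have T: "(\<Sum>i=0..d. (\<tau> i)\<^sup>2) = R.T" by (simp add: R.T_def)
  have simplex: "int d simplex S" unfolding S by (rule R.simplex_hull) simp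
  have i: "let F = convex hull (insert u ((\<lambda>i. (1 / \<tau> i) *\<^sub>R e i) ` {1..k})) in
        F face_of S \<and> aff_dim F = int k \<and>
        internal_angle F S =
          gfun (d - k) ((\<tau> 0)\<^sup>2) (\<lambda>j. (\<tau> (k + j))\<^sup>2) (\<lambda>_. 1) \<and>
        external_angle F S =
          gfun (d - k) (- (\<tau> 0)\<^sup>2 - (\<Sum>i=k+1..d. (\<tau> i)\<^sup>2)) (\<lambda>j. (\<tau> (k + j))\<^sup>2) (\<lambda>_. 1)"
    unfolding Let_def img ins S
    using k by (intro conjI R.face_of_hull R.aff_dim_hull R.internal_angle_apex_face R.external_angle_apex_face) auto
  have ii: "let F = convex hull ((\<lambda>i. (1 / \<tau> i) *\<^sub>R e i) ` {1..k + 1}) in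
        F face_of S \<and> aff_dim F = int k \<and>
        internal_angle F S =
          gfun (d - k) ((\<tau> 0)\<^sup>2)
            ((\<lambda>j. (\<tau> (k + j))\<^sup>2)(1 := - (\<Sum>i=0..d. (\<tau> i)\<^sup>2))) ((\<lambda>_. 1)(1 := - 1)) \<and>
        external_angle F S =
          gfun (d - k) (\<Sum>i=1..k+1. (\<tau> i)\<^sup>2)
            ((\<lambda>j. (\<tau> (k + j))\<^sup>2)(1 := - (\<Sum>i=0..d. (\<tau> i)\<^sup>2))) (\<lambda>_. 1)"
    unfolding Let_def img S T
    using k by (intro conjI R.face_of_hull R.aff_dim_hull R.internal_angle_base_face R.external_angle_base_face) auto
  show ?thesis
  proof (intro conjI simplex i ii allI impI, goal_cases)
    case (1 l lam0 lam)
    then show ?case by (intro gfun_integral(1)) auto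
  next
    case (2 l lam0 lam)
    then show ?case by (intro gfun_integral(2)) auto
  next
    case (3 l lam0 lam eps1)
    then interpret mixed_sign l lam0 lam eps1 by unfold_locales auto
    show ?case by (rule set_integrable_real_part)
  next
    case (4 l lam0 lam eps1)
    then interpret mixed_sign l lam0 lam eps1 by unfold_locales auto
    show ?case by (rule set_integrable_imaginary_part)
  next
    case (5 l lam0 lam eps1)
    then interpret mixed_sign l lam0 lam eps1 by unfold_locales auto
    show ?case by (rule gfun_mixed_integral)
  qed
qed

end
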